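(* There is a computable function $f$ and an algorithm that, given an instance $$\mathcal B=(U,\mathcal F,d,m,(B_1,\dots,B_m),(k_1,\dots,k_m),(\mathcal V_1,\dots,\mathcal V_m),s,F)$$ of Heterogeneous Multidimensional Fingerprint Bin Packing, computes a feasible partition or concludes that there is none in $$f\bigl(|\mathcal F|+d+m+\lVert B_1\rVert_1\bigr)\cdot\bigl(T(|U|)+|\mathcal B|^{O(1)}\bigr)$$ steps, where $T\colon\mathbb N\to\mathbb N$ is an upper bound on the time complexity of the predicates $\mathcal V_1,\dots,\mathcal V_m$.
   Context: $\mathbb N=\{0,1,2,\dots\}$, $\mathbb N^+=\{1,2,\dots\}$, $[n]=\{1,\dots,n\}$. A multiset over $\mathcal F$ is a function $\mathcal F\to\mathbb N$ giving multiplicities. $|\mathcal B|$ denotes the size of the instance. An instance of Heterogeneous Multidimensional Fingerprint Bin Packing consists of: a finite set $U$ of items; a finite set $\mathcal F$ of fingerprints; a dimension $d\in\mathbb N^+$; a number of bin kinds $m\in\mathbb N^+$; bin capacities $B_1,\dots,B_m\in\mathbb N^d$ with $\lVert B_1\rVert_1\ge\lVert B_2\rVert_1\ge\dots\ge\lVert B_m\rVert_1$; available bin counts $k_1,\dots,k_m$; predicates $\mathcal V_1,\dots,\mathcal V_m\colon\mathbb N^{\mathcal F}\to\{0,1\}$ deciding the validity of a multiset of fingerprints; item sizes $s\colon U\to\mathbb N^d\setminus\{0\}$ with $\lVert s(u)\rVert_1\le\lVert B_1\rVert_1$ for all $u\in U$; and item fingerprints $F\colon U\to\mathcal F$. A feasible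 partition is a partition $\{U_{i,j}\}_{i\in[m],\,j\in[k_i]}$ of $U$ such that for all $i,j$: $\sum_{u\in U_{i,j}}s(u)\le B_i$ (componentwise), and $\mathcal V_i$ evaluates to $1$ on the multiset of the fingerprints $F(u)$, $u\in U_{i,j}$ (counted with multiplicity). *)

theory Defs
  imports
    Complex_Main
    "HOL-Library.Multiset"
    "HOL-Library.Disjoint_Sets"
    "HOL-Library.Log_Nat"
begin

section \<open>Model of computation\<close>

text \<open>
  Algorithms are programs of a small first-order, call-by-value language with recursion over
  S-expressions with natural-number leaves.  Every executed construct costs one step.  The only
  arithmetic is addition and truncated subtraction, so (as for unit-cost random access machines
  with this instruction set) bit lengths grow by at most one per step and step counts are
  polynomially related to Turing machine time.
\<close>

datatype val = Num nat | PairV val val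

datatype expr =
    Var nat
  | Const nat
  | MkPair expr expr
  | Fst expr
  | Snd expr
  | Add expr expr
  | Sub expr expr
  | Cond expr expr expr
  | LetIn expr expr
  | Call nat expr
  | Ext expr

text \<open>
  A program is the list of its function bodies.  Function 0 is the entry point; every function
  has one argument.  Variables are de Bruijn indices into the environment.  A conditional takes
  its second branch exactly on \<open>Num 0\<close>, which also serves as the empty list.
\<close>

type_synonym prog = "expr list"

text \<open>
  External subroutines, called by \<open>Ext\<close>, are given by the set of triples (argument, result,
  running time); a call is charged the running time of the subroutine.
\<close>

type_synonym ext = "(val \<times> val \<times> nat) set"

text \<open>\<open>eval P Q env e v t\<close>: in \<open>env\<close>, the expression \<open>e\<close> terminates with value \<open>v\<close> after
  exactly \<open>t\<close> steps.\<close>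

inductive eval :: "prog \<Rightarrow> ext \<Rightarrow> val list \<Rightarrow> expr \<Rightarrow> val \<Rightarrow> nat \<Rightarrow> bool"
  for P :: prog and Q :: ext
where
  eval_Var: "n < length env \<Longrightarrow> eval P Q env (Var n) (env ! n) 1"
| eval_Const: "eval P Q env (Const n) (Num n) 1"
| eval_MkPair: "eval P Q env a v s \<Longrightarrow> eval P Q env b w t
    \<Longrightarrow> eval P Q env (MkPair a b) (PairV v w) (s + t + 1)"
| eval_Fst: "eval P Q env a (PairV v w) t \<Longrightarrow> eval P Q env (Fst a) v (t + 1)"
| eval_Snd: "eval P Q env a (PairV v w) t \<Longrightarrow> eval P Q env (Snd a) w (t + 1)"
| eval_Add: "eval P Q env a (Num x) s \<Longrightarrow> eval P Q env b (Num y) t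
    \<Longrightarrow> eval P Q env (Add a b) (Num (x + y)) (s + t + 1)"
| eval_Sub: "eval P Q env a (Num x) s \<Longrightarrow> eval P Q env b (Num y) t
    \<Longrightarrow> eval P Q env (Sub a b) (Num (x - y)) (s + t + 1)"
| eval_Cond_nonzero: "eval P Q env c v s \<Longrightarrow> v \<noteq> Num 0 \<Longrightarrow> eval P Q env a w t
    \<Longrightarrow> eval P Q env (Cond c a b) w (s + t + 1)"
| eval_Cond_zero: "eval P Q env c (Num 0) s \<Longrightarrow> eval P Q env b w t
    \<Longrightarrow> eval P Q env (Cond c a b) w (s + t + 1)"
| eval_LetIn: "eval P Q env a v s \<Longrightarrow> eval P Q (v # env) b w t
    \<Longrightarrow> eval P Q env (LetIn a b) w (s + t + 1)"
| eval_Call: "eval P Q env a v s \<Longrightarrow> g < length P \<Longrightarrow> eval P Q [v] (P ! g) w t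
    \<Longrightarrow> eval P Q env (Call g a) w (s + t + 1)"
| eval_Ext: "eval P Q env a v s \<Longrightarrow> (v, w, t) \<in> Q
    \<Longrightarrow> eval P Q env (Ext a) w (s + t + 1)"

inductive_cases eval_VarE: "eval P Q env (Var n) v t"
inductive_cases eval_ConstE: "eval P Q env (Const n) v t"
inductive_cases eval_MkPairE: "eval P Q env (MkPair a b) v t"
inductive_cases eval_FstE: "eval P Q env (Fst a) v t"
inductive_cases eval_SndE: "eval P Q env (Snd a) v t"
inductive_cases eval_AddE: "eval P Q env (Add a b) v t"
inductive_cases eval_SubE: "eval P Q env (Sub a b) v t"
inductive_cases eval_CondE: "eval P Q env (Cond c a b) v t"
inductive_cases eval_LetInE: "eval P Q env (LetIn a b) v t"
inductive_cases eval_CallE: "eval P Q env (Call g a) v t"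
inductive_cases eval_ExtE: "eval P Q env (Ext a) v t"

lemma eval_deterministic:
  assumes "eval P Q env e v t" and "single_valued Q" and "eval P Q env e v' t'"
  shows "v' = v \<and> t' = t"
  using assms(1,3)
proof (induction arbitrary: v' t' rule: eval.induct)
  case eval_Var then show ?case by (auto elim: eval_VarE)
next
  case eval_Const then show ?case by (auto elim: eval_ConstE)
next
  case eval_MkPair from eval_MkPair.prems show ?case
    by (rule eval_MkPairE) (auto dest!: eval_MkPair.IH)
next
  case eval_Fst from eval_Fst.prems show ?case
    by (rule eval_FstE) (auto dest!: eval_Fst.IH)
next
  case eval_Snd from eval_Snd.prems show ?case
    by (rule eval_SndE) (auto dest!: eval_Snd.IH)
next
  case eval_Add from eval_Add.prems show ?case
    by (rule eval_AddE) (auto dest!: eval_Add.IH)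
next
  case eval_Sub from eval_Sub.prems show ?case
    by (rule eval_SubE) (auto dest!: eval_Sub.IH)
next
  case eval_Cond_nonzero from eval_Cond_nonzero.prems show ?case
    by (rule eval_CondE) (use eval_Cond_nonzero.hyps in \<open>auto dest!: eval_Cond_nonzero.IH\<close>)
next
  case eval_Cond_zero from eval_Cond_zero.prems show ?case
    by (rule eval_CondE) (auto dest!: eval_Cond_zero.IH)
next
  case eval_LetIn from eval_LetIn.prems show ?case
    by (rule eval_LetInE) (auto dest!: eval_LetIn.IH)
next
  case eval_Call from eval_Call.prems show ?case
    by (rule eval_CallE) (auto dest!: eval_Call.IH)
next
  case (eval_Ext env a v s w t)
  from eval_Ext.prems obtain v2 s2 t2
    where "t' = s2 + t2 + 1" "eval P Q env a v2 s2" "(v2, v', t2) \<in> Q"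
    by (auto elim: eval_ExtE)
  moreover from this(2) have "v2 = v \<and> s2 = s" by (rule eval_Ext.IH)
  ultimately show ?case
    using eval_Ext.hyps assms(2) by (auto dest: single_valuedD)
qed

definition runs :: "prog \<Rightarrow> ext \<Rightarrow> val \<Rightarrow> val \<Rightarrow> nat \<Rightarrow> bool" where
  "runs P Q x y t \<longleftrightarrow> P \<noteq> [] \<and> eval P Q [x] (P ! 0) y t"

definition computable :: "(nat \<Rightarrow> nat) \<Rightarrow> bool" where
  "computable f \<longleftrightarrow> (\<exists>P. \<forall>n. \<exists>t. runs P {} (Num n) (Num (f n)) t)"

fun enc_list :: "val list \<Rightarrow> val" where
  "enc_list [] = Num 0"
| "enc_list (v # vs) = PairV v (enc_list vs)"

text \<open>Length of a value in bits, up to a constant factor: numbers are counted in binary.\<close>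

fun val_size :: "val \<Rightarrow> nat" where
  "val_size (Num n) = 1 + floorlog 2 n"
| "val_size (PairV v w) = 1 + val_size v + val_size w"


section \<open>Heterogeneous Multidimensional Fingerprint Bin Packing\<close>

text \<open>
  Vectors of length \<open>d\<close> are functions of which only the arguments \<open>1, \<dots>, d\<close> matter; likewise bin
  kinds are the numbers \<open>1, \<dots>, m\<close>.
\<close>

definition norm1 :: "nat \<Rightarrow> (nat \<Rightarrow> nat) \<Rightarrow> nat" where
  "norm1 d v = (\<Sum>c = 1..d. v c)"

record ('u, 'f) packing =
  items :: "'u set"
  fingerprints :: "'f set"
  ndims :: nat
  kinds :: nat
  capacity :: "nat \<Rightarrow> nat \<Rightarrow> nat"
  bins :: "nat \<Rightarrow> nat"
  valid :: "nat \<Rightarrow> 'f multiset \<Rightarrow> bool"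
  item_size :: "'u \<Rightarrow> nat \<Rightarrow> nat"
  fingerprint :: "'u \<Rightarrow> 'f"

definition is_packing :: "('u, 'f) packing \<Rightarrow> bool" where
  "is_packing B \<longleftrightarrow>
     finite (items B) \<and> finite (fingerprints B) \<and> ndims B \<ge> 1 \<and> kinds B \<ge> 1 \<and>
     (\<forall>i \<in> {1..<kinds B}. norm1 (ndims B) (capacity B i) \<ge> norm1 (ndims B) (capacity B (Suc i))) \<and>
     (\<forall>u \<in> items B.
        (\<exists>c \<in> {1..ndims B}. item_size B u c \<noteq> 0) \<and>
        norm1 (ndims B) (item_size B u) \<le> norm1 (ndims B) (capacity B 1) \<and>
        fingerprint B u \<in> fingerprints B)"

text \<open>The parts are allowed to be empty, and the predicates are required to hold on all parts,
  empty ones included.\<close>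

definition feasible_partition :: "('u, 'f) packing \<Rightarrow> (nat \<Rightarrow> nat \<Rightarrow> 'u set) \<Rightarrow> bool" where
  "feasible_partition B W \<longleftrightarrow>
     (\<Union>i \<in> {1..kinds B}. \<Union>j \<in> {1..bins B i}. W i j) = items B \<and>
     disjoint_family_on (\<lambda>(i, j). W i j) (SIGMA i:{1..kinds B}. {1..bins B i}) \<and>
     (\<forall>i \<in> {1..kinds B}. \<forall>j \<in> {1..bins B i}.
        (\<forall>c \<in> {1..ndims B}. (\<Sum>u \<in> W i j. item_size B u c) \<le> capacity B i c) \<and>
        valid B i (image_mset (fingerprint B) (mset_set (W i j))))"


section \<open>Input, output and the validity predicates as subroutines\<close>

definition enc_vec :: "nat \<Rightarrow> (nat \<Rightarrow> nat) \<Rightarrow> val" where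
  "enc_vec d v = enc_list (map (\<lambda>c. Num (v c)) [1..<Suc d])"

text \<open>
  An instance is presented by listing its items and its fingerprints in some order.  A fingerprint
  is written as its (0-based) position in the list \<open>fs\<close>; only the number of fingerprints is part of
  the input.  All numbers, including the bin counts, are measured in binary.  Since a program only
  sees this encoding, a claim that one program works for all instances should be made for one fixed
  infinite type of items and fingerprints, so that the program cannot depend on the type.
\<close>

definition index_of :: "'a list \<Rightarrow> 'a \<Rightarrow> nat" where
  "index_of xs x = (THE i. i < length xs \<and> xs ! i = x)"

definition enc_input :: "('u, 'f) packing \<Rightarrow> 'u list \<Rightarrow> 'f list \<Rightarrow> val" where
  "enc_input B us fs = enc_list
     [Num (length fs), Num (ndims B), Num (kinds B),
      enc_list (map (\<lambda>i. PairV (Num (bins B i)) (enc_vec (ndims B) (capacity B i)))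
        [1..<Suc (kinds B)]),
      enc_list (map (\<lambda>u. PairV (Num (index_of fs (fingerprint B u)))
                              (enc_vec (ndims B) (item_size B u))) us)]"

definition input_size :: "('u, 'f) packing \<Rightarrow> 'u list \<Rightarrow> 'f list \<Rightarrow> nat" where
  "input_size B us fs = val_size (enc_input B us fs)"

text \<open>
  The validity predicates are accessed through subroutine calls: the argument of a call is a kind
  \<open>i\<close> together with the vector of multiplicities of a multiset over the fingerprints.  The time of
  evaluating the \<open>i\<close>-th predicate on \<open>M\<close> is \<open>\<tau> i M\<close>, whatever implementation it comes from.
\<close>

definition validity_calls ::
    "('u, 'f) packing \<Rightarrow> 'f list \<Rightarrow> (nat \<Rightarrow> 'f multiset \<Rightarrow> nat) \<Rightarrow> ext" where
  "validity_calls B fs \<tau> =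
     {(PairV (Num i) (enc_list (map (\<lambda>g. Num (count M g)) fs)), Num (of_bool (valid B i M)), \<tau> i M)
      | i M. i \<in> {1..kinds B} \<and> set_mset M \<subseteq> fingerprints B}"

text \<open>Worst-case time on multisets of at most \<open>n\<close> elements.\<close>

definition time_bound ::
    "('u, 'f) packing \<Rightarrow> (nat \<Rightarrow> 'f multiset \<Rightarrow> nat) \<Rightarrow> (nat \<Rightarrow> nat) \<Rightarrow> bool" where
  "time_bound B \<tau> T \<longleftrightarrow>
     (\<forall>n. \<forall>i \<in> {1..kinds B}. \<forall>M. set_mset M \<subseteq> fingerprints B \<and> size M \<le> n \<longrightarrow> \<tau> i M \<le> T n)"

text \<open>
  A partition is output as the list, over all items in input order, of the pair \<open>(i, j)\<close> of the
  part containing the item, so that its length does not depend on the number of empty bins.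
\<close>

definition enc_output :: "'u list \<Rightarrow> ('u \<Rightarrow> nat \<times> nat) \<Rightarrow> val" where
  "enc_output us a = enc_list (map (\<lambda>u. PairV (Num (fst (a u))) (Num (snd (a u)))) us)"

definition correct_output :: "('u, 'f) packing \<Rightarrow> 'u list \<Rightarrow> val \<Rightarrow> bool" where
  "correct_output B us out \<longleftrightarrow>
     (\<exists>a. feasible_partition B (\<lambda>i j. {u \<in> items B. a u = (i, j)}) \<and>
          out = PairV (Num 1) (enc_output us a)) \<or>
     (\<nexists>W. feasible_partition B W) \<and> out = Num 0"

lemma single_valued_validity_calls:
  assumes "set fs = fingerprints B"
  shows "single_valued (validity_calls B fs \<tau>)"
proof -
  have inj: "map (\<lambda>g. Num (count M g)) fs = map (\<lambda>g. Num (count N g)) fs"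
    if "enc_list (map (\<lambda>g. Num (count M g)) fs) = enc_list (map (\<lambda>g. Num (count N g)) fs)" for M N
    using that by (induction fs) auto
  have "M = N" if "set_mset M \<subseteq> fingerprints B" "set_mset N \<subseteq> fingerprints B"
    "enc_list (map (\<lambda>g. Num (count M g)) fs) = enc_list (map (\<lambda>g. Num (count N g)) fs)" for M N
  proof (rule multiset_eqI)
    fix x show "count M x = count N x"
      using inj[OF that(3)] that(1,2) assms
      by (cases "x \<in> fingerprints B") (auto simp: subset_iff, metis not_in_iff)
  qed
  then show ?thesis
    unfolding single_valued_def validity_calls_def by blast
qed

end

theory Submission
  imports Defs
begin

text \<open>
  Two items are interchangeable if they have the same fingerprint and size, and a bin of capacity
  \<open>B\<^sub>i\<close> holds at most \<open>norm1 B\<^sub>1\<close> items, so the parameter bounds the number of item types and of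
  configurations (multisets of types filling one bin).  Each configuration is submitted once to the
  validity predicate.  It remains to find multiplicities \<open>x \<ge> 0\<close> of the valid configurations such
  that \<open>\<Sum> x\<^sub>c A\<^sub>c = b\<close>, where \<open>b\<close> lists the number of items of every type and the number of bins of
  every kind.

  The digits of \<open>x\<close> are guessed from the most significant one downwards.  After the digits of
  weight at least \<open>w\<close> have been fixed, the residual \<open>b - \<Sum> (x\<^sub>c - x\<^sub>c mod w) A\<^sub>c = \<Sum> (x\<^sub>c mod w) A\<^sub>c\<close> is
  congruent to \<open>b\<close> modulo \<open>w\<close> and bounded by \<open>w \<Sum> A\<^sub>c\<close>, hence only boundedly many residuals can
  occur at each of the logarithmically many levels, and it suffices to keep one choice of digits for
  each of them.
\<close>

section \<open>Weakest preconditions with running times\<close>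

text \<open>The bin counts are written in binary, so neither the bins nor the multiplicities
  \<open>x\<close> can be enumerated. Guessing binary digits needs only doubling, scaling by small
  column entries, comparison and subtraction, which suits a language without multiplication and
  division.

  Besides its residual, a state carries the history of its choices. States with equal residuals are
  merged, since everything that follows depends on the residual alone; any history that leaves the
  residual 0 is a solution. A history has at most one entry per column and level, although it may
  describe exponentially many bins. The assignment is therefore read off item by item: an item is
  identified by its type and the number \<open>q\<close> of equal items after it, and
  \<open>loc\<close> computes its bin from \<open>q\<close> and the history.

  Empty bins are never listed in the output, but they must be valid. The rows for the bin counts are
  equations, so each empty bin has to be accounted for by the zero configuration of its kind, which
  is a column only if the predicate accepts the empty multiset.\<close>

definition wp :: "prog \<Rightarrow> ext \<Rightarrow> val list \<Rightarrow> expr \<Rightarrow> (val \<Rightarrow> nat \<Rightarrow> bool) \<Rightarrow> bool" where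
  "wp P Q env e \<Phi> \<longleftrightarrow> (\<exists>v t. eval P Q env e v t \<and> \<Phi> v t)"

text \<open>No simplification rule unfolds this constant. Symbolic execution thus stops at each
  call, where a \<open>calls\<close> fact is supplied through \<open>wp_callI\<close>, and recursive
  functions do not make the simplifier loop.\<close>

definition wp_call :: "prog \<Rightarrow> ext \<Rightarrow> nat \<Rightarrow> val \<Rightarrow> (val \<Rightarrow> nat \<Rightarrow> bool) \<Rightarrow> bool" where
  "wp_call P Q g v \<Phi> \<longleftrightarrow> g < length P \<and> wp P Q [v] (P ! g) \<Phi>"

text \<open>As equivalences, these rules let the simplifier execute a function body symbolically up
  to the next call while it accumulates the step count.\<close>

lemma wp_simps [simp]:
  "wp P Q env (Var n) \<Phi> \<longleftrightarrow> n < length env \<and> \<Phi> (env ! n) 1"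
  "wp P Q env (Const k) \<Phi> \<longleftrightarrow> \<Phi> (Num k) 1"
  "wp P Q env (MkPair a b) \<Phi> \<longleftrightarrow>
     wp P Q env a (\<lambda>v s. wp P Q env b (\<lambda>w t. \<Phi> (PairV v w) (s + t + 1)))"
  "wp P Q env (Fst a) \<Phi> \<longleftrightarrow> wp P Q env a (\<lambda>u t. \<exists>v w. u = PairV v w \<and> \<Phi> v (t + 1))"
  "wp P Q env (Snd a) \<Phi> \<longleftrightarrow> wp P Q env a (\<lambda>u t. \<exists>v w. u = PairV v w \<and> \<Phi> w (t + 1))"
  "wp P Q env (Add a b) \<Phi> \<longleftrightarrow> wp P Q env a (\<lambda>v s. wp P Q env b (\<lambda>w t.
     \<exists>x y. v = Num x \<and> w = Num y \<and> \<Phi> (Num (x + y)) (s + t + 1)))"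
  "wp P Q env (Sub a b) \<Phi> \<longleftrightarrow> wp P Q env a (\<lambda>v s. wp P Q env b (\<lambda>w t.
     \<exists>x y. v = Num x \<and> w = Num y \<and> \<Phi> (Num (x - y)) (s + t + 1)))"
  "wp P Q env (LetIn a b) \<Phi> \<longleftrightarrow>
     wp P Q env a (\<lambda>v s. wp P Q (v # env) b (\<lambda>w t. \<Phi> w (s + t + 1)))"
  "wp P Q env (Call g a) \<Phi> \<longleftrightarrow>
     wp P Q env a (\<lambda>v s. wp_call P Q g v (\<lambda>w t. \<Phi> w (s + t + 1)))"
  "wp P Q env (Ext a) \<Phi> \<longleftrightarrow>
     wp P Q env a (\<lambda>v s. \<exists>w t. (v, w, t) \<in> Q \<and> \<Phi> w (s + t + 1))"
  unfolding wp_def wp_call_def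
  subgoal by (auto elim!: eval_VarE intro: eval_Var[unfolded One_nat_def])
  subgoal by (auto elim!: eval_ConstE intro: eval_Const[unfolded One_nat_def])
  subgoal by (fastforce elim!: eval_MkPairE intro: eval_MkPair[simplified])
  subgoal by (fastforce elim!: eval_FstE intro: eval_Fst[simplified])
  subgoal by (fastforce elim!: eval_SndE intro: eval_Snd[simplified])
  subgoal by (fastforce elim!: eval_AddE intro: eval_Add[simplified])
  subgoal by (fastforce elim!: eval_SubE intro: eval_Sub[simplified])
  subgoal by (fastforce elim!: eval_LetInE intro: eval_LetIn[simplified])
  subgoal by (fastforce elim!: eval_CallE intro: eval_Call[simplified])
  subgoal by (fastforce elim!: eval_ExtE intro: eval_Ext[simplified])
  done

lemma wp_Cond [simp]:
  "wp P Q env (Cond c a b) \<Phi> \<longleftrightarrow> wp P Q env c (\<lambda>v s.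
     if v = Num 0 then wp P Q env b (\<lambda>w t. \<Phi> w (s + t + 1))
     else wp P Q env a (\<lambda>w t. \<Phi> w (s + t + 1)))" (is "?L \<longleftrightarrow> ?R")
proof
  assume ?L
  then show ?R
    unfolding wp_def by (elim exE conjE eval_CondE) auto
next
  assume ?R
  then obtain v s where v: "eval P Q env c v s"
    "if v = Num 0 then wp P Q env b (\<lambda>w t. \<Phi> w (s + t + 1))
     else wp P Q env a (\<lambda>w t. \<Phi> w (s + t + 1))"
    unfolding wp_def[of _ _ _ c] by blast
  show ?L
  proof (cases "v = Num 0")
    case True
    then obtain w t where "eval P Q env b w t" "\<Phi> w (s + t + 1)"
      using v(2) by (auto simp: wp_def)
    then show ?thesis
      unfolding wp_def using eval_Cond_zero[of P Q env c s b w t a] v(1) True by blast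
  next
    case False
    then obtain w t where "eval P Q env a w t" "\<Phi> w (s + t + 1)"
      using v(2) by (auto simp: wp_def)
    then show ?thesis
      unfolding wp_def using eval_Cond_nonzero[of P Q env c v s a w t b] v(1) False by blast
  qed
qed

text \<open>An exact result with an upper bound on the time: the form in which induction hypotheses
  and cost estimates compose.\<close>

definition calls :: "prog \<Rightarrow> ext \<Rightarrow> nat \<Rightarrow> val \<Rightarrow> val \<Rightarrow> nat \<Rightarrow> bool" where
  "calls P Q g v w b \<longleftrightarrow> g < length P \<and> wp P Q [v] (P ! g) (\<lambda>w' t. w' = w \<and> t \<le> b)"

lemma wp_callI:
  "calls P Q g v w b \<Longrightarrow> (\<And>t. t \<le> b \<Longrightarrow> \<Phi> w t) \<Longrightarrow> wp_call P Q g v \<Phi>"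
  unfolding calls_def wp_call_def wp_def by blast

lemma calls_mono: "calls P Q g v w b \<Longrightarrow> b \<le> b' \<Longrightarrow> calls P Q g v w b'"
  unfolding calls_def wp_def by fastforce

section \<open>The program\<close>

abbreviation "eN xs \<equiv> enc_list (map Num xs)"
abbreviation "eNN xss \<equiv> enc_list (map (\<lambda>xs. eN xs) xss)"
abbreviation "eNNN xsss \<equiv> enc_list (map (\<lambda>xss. eNN xss) xsss)"

notation MkPair (infixr "\<bowtie>" 60)
notation PairV (infixr "\<parallel>" 60)

abbreviation (input) "X \<equiv> Var 0"
abbreviation (input) "X1 \<equiv> Fst X"
abbreviation (input) "X2 \<equiv> Fst (Snd X)"
abbreviation (input) "X3 \<equiv> Fst (Snd (Snd X))"
abbreviation (input) "X4 \<equiv> Fst (Snd (Snd (Snd X)))"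
abbreviation (input) "X5 \<equiv> Fst (Snd (Snd (Snd (Snd X))))"
abbreviation (input) "R1 \<equiv> Snd X"
abbreviation (input) "R2 \<equiv> Snd (Snd X)"
abbreviation (input) "R3 \<equiv> Snd (Snd (Snd X))"
abbreviation (input) "R4 \<equiv> Snd (Snd (Snd (Snd X)))"
abbreviation (input) "R5 \<equiv> Snd (Snd (Snd (Snd (Snd X))))"

abbreviation (input) "f_mul \<equiv> 1 :: nat"
abbreviation (input) "f_scale \<equiv> 2 :: nat"
abbreviation (input) "f_leq \<equiv> 3 :: nat"
abbreviation (input) "f_sub \<equiv> 4 :: nat"
abbreviation (input) "f_sum \<equiv> 5 :: nat"
abbreviation (input) "f_sums \<equiv> 6 :: nat"
abbreviation (input) "f_eq \<equiv> 7 :: nat"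
abbreviation (input) "f_count \<equiv> 8 :: nat"
abbreviation (input) "f_remdups \<equiv> 9 :: nat"
abbreviation (input) "f_length \<equiv> 10 :: nat"
abbreviation (input) "f_heads \<equiv> 11 :: nat"
abbreviation (input) "f_target \<equiv> 12 :: nat"
abbreviation (input) "f_unit \<equiv> 13 :: nat"
abbreviation (input) "f_pre \<equiv> 14 :: nat"
abbreviation (input) "f_gen \<equiv> 15 :: nat"
abbreviation (input) "f_fsum \<equiv> 16 :: nat"
abbreviation (input) "f_fsums \<equiv> 17 :: nat"
abbreviation (input) "f_filt \<equiv> 18 :: nat"
abbreviation (input) "f_cols \<equiv> 19 :: nat"
abbreviation (input) "f_mem \<equiv> 20 :: nat"
abbreviation (input) "f_ins \<equiv> 21 :: nat"
abbreviation (input) "f_step \<equiv> 22 :: nat"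
abbreviation (input) "f_level \<equiv> 23 :: nat"
abbreviation (input) "f_dp \<equiv> 24 :: nat"
abbreviation (input) "f_look \<equiv> 25 :: nat"
abbreviation (input) "f_offs \<equiv> 26 :: nat"
abbreviation (input) "f_mod \<equiv> 27 :: nat"
abbreviation (input) "f_loc \<equiv> 28 :: nat"
abbreviation (input) "f_out \<equiv> 29 :: nat"
abbreviation (input) "f_find \<equiv> 30 :: nat"

abbreviation (input) "f_types \<equiv> 31 :: nat"
abbreviation (input) "f_solve \<equiv> 32 :: nat"

definition "e_main = Call f_types (X1 \<bowtie> X5 \<bowtie> X4 \<bowtie> Call f_remdups X5)"

definition "e_types = Call f_solve (X2 \<bowtie> X3 \<bowtie> R3 \<bowtie>
   Call f_cols (X1 \<bowtie> R3 \<bowtie> Call f_length X2 \<bowtie> X3 \<bowtie> Const 1 \<bowtie> X3))"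

definition "e_solve = Call f_find (Call f_dp (Call f_sum (Call f_heads X2) \<bowtie> Const 1 \<bowtie>
   Add (Call f_sums R3) (Call f_sums R3) \<bowtie> R3 \<bowtie> Call f_target (X3 \<bowtie> X1 \<bowtie> X2)) \<bowtie> X3 \<bowtie> X1)"

text \<open>Repeated addition costs time linear in the second factor. Calls within
  \<open>packing_prog\<close> therefore pass the possibly exponential weight first and a bounded
  column entry second.\<close>

definition "e_mul = Cond R1 (Add X1 (Call f_mul (X1 \<bowtie> Sub R1 (Const 1)))) (Const 0)"

definition "e_scale = Cond R1
   (Call f_mul (X1 \<bowtie> Fst R1) \<bowtie> Call f_scale (X1 \<bowtie> Snd R1)) (Const 0)"

definition "e_leq = Cond X1
   (Cond (Sub (Fst X1) (Fst R1)) (Const 0) (Call f_leq (Snd X1 \<bowtie> Snd R1))) (Const 1)"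

definition "e_sub = Cond X1
   (Sub (Fst X1) (Fst R1) \<bowtie> Call f_sub (Snd X1 \<bowtie> Snd R1)) (Const 0)"

definition "e_sum = Cond X (Add X1 (Call f_sum R1)) (Const 0)"

definition "e_sums = Cond X (Add (Call f_sum X1) (Call f_sums R1)) (Const 0)"

definition "e_eq = Cond (Call f_leq X) (Call f_leq (R1 \<bowtie> X1)) (Const 0)"

definition "e_count = Cond R1
   (Add (Call f_eq (X1 \<bowtie> Fst R1)) (Call f_count (X1 \<bowtie> Snd R1))) (Const 0)"

text \<open>A nonempty list is the pair of its head and its tail, hence a valid argument of
  \<open>f_count\<close>.\<close>

definition "e_remdups = Cond X
   (Cond (Call f_count X) (Call f_remdups R1) (X1 \<bowtie> Call f_remdups R1)) (Const 0)"

definition "e_length = Cond X (Add (Const 1) (Call f_length R1)) (Const 0)"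

definition "e_heads = Cond X (Fst X1 \<bowtie> Call f_heads R1) (Const 0)"

definition "e_target = Cond X1
   (Call f_count (Fst X1 \<bowtie> X2) \<bowtie> Call f_target (Snd X1 \<bowtie> R1)) (Call f_heads R2)"

text \<open>For nonzero \<open>i\<close>, the truncated difference \<open>1 - (i - 1)\<close> is 1
  exactly if \<open>i = 1\<close>.\<close>

definition "e_unit = Cond R1
   (Cond X1 (Sub (Const 1) (Sub X1 (Const 1))) (Const 0) \<bowtie>
    Call f_unit (Sub X1 (Const 1) \<bowtie> Snd R1)) (Const 0)"

definition "e_pre = Cond X2
   ((X1 \<bowtie> Fst X2) \<bowtie> Call f_pre (X1 \<bowtie> Snd X2 \<bowtie> R2)) R2"

definition "e_gen = Cond X2
   (Call f_pre (X3 \<bowtie> Call f_gen (X1 \<bowtie> Snd X2 \<bowtie> Const 0 \<bowtie> R3) \<bowtie>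
      Cond (Call f_leq ((Const 1 \<bowtie> Snd (Fst X2)) \<bowtie> R3))
        (Call f_gen (X1 \<bowtie> X2 \<bowtie> Add X3 (Const 1) \<bowtie> Call f_sub (R3 \<bowtie> Const 1 \<bowtie> Snd (Fst X2))))
        (Const 0)))
   (X1 \<bowtie> Const 0)"

text \<open>The sum of the two truncated differences is 0 exactly if the fingerprints agree, so the
  multiplicity is taken in the second branch. \<open>e_offs\<close> compares kinds in the same
  way.\<close>

definition "e_fsum = Cond X2
   (Add (Cond (Add (Sub X1 (Fst (Fst X2))) (Sub (Fst (Fst X2)) X1)) (Const 0) (Fst R2))
      (Call f_fsum (X1 \<bowtie> Snd X2 \<bowtie> Snd R2))) (Const 0)"

definition "e_fsums = Cond X1
   (Call f_fsum R1 \<bowtie> Call f_fsums (Sub X1 (Const 1) \<bowtie> Add X2 (Const 1) \<bowtie> R2)) (Const 0)"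

definition "e_filt = Cond X4
   (Cond (Ext (X3 \<bowtie> Call f_fsums (X1 \<bowtie> Const 0 \<bowtie> X2 \<bowtie> Fst X4)))
      ((X3 \<bowtie> Fst X4) \<bowtie> Call f_filt (X1 \<bowtie> X2 \<bowtie> X3 \<bowtie> Snd X4 \<bowtie> R4))
      (Call f_filt (X1 \<bowtie> X2 \<bowtie> X3 \<bowtie> Snd X4 \<bowtie> R4)))
   R4"

text \<open>A column consists of the kind of the bin, the multiplicities of the item types and the unit
  vector of the kind.  The latter makes the equation for the number of bins of each kind a row like
  the others.\<close>

definition "e_cols = Cond R5
   (Call f_filt (X1 \<bowtie> X2 \<bowtie> X5 \<bowtie>
      Call f_gen (Call f_unit (X5 \<bowtie> X4) \<bowtie> X2 \<bowtie> Const 0 \<bowtie> X3 \<bowtie> Snd (Fst R5)) \<bowtie>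
      Call f_cols (X1 \<bowtie> X2 \<bowtie> X3 \<bowtie> X4 \<bowtie> Add X5 (Const 1) \<bowtie> Snd R5)))
   (Const 0)"

definition "e_mem = Cond R1
   (Cond (Call f_eq (X1 \<bowtie> Fst (Fst R1))) (Const 1) (Call f_mem (X1 \<bowtie> Snd R1))) (Const 0)"

definition "e_ins = Cond (Sub (Call f_sum (Fst X2)) X1) R2
   (Cond (Call f_mem (Fst X2 \<bowtie> R2)) R2 (X2 \<bowtie> R2))"

text \<open>A state is a list of vectors: the residual, followed by the choices \<open>w # c\<close> made so far,
  each standing for \<open>w\<close> bins filled according to the column \<open>c\<close>.  In the innermost scope of
  \<open>e_step\<close>, the variables are the current state, the scaled column, the states obtained so far and
  the argument.\<close>

definition "e_step = Cond R3
   (LetIn (Call f_ins (X1 \<bowtie> Fst R3 \<bowtie> Call f_step (X1 \<bowtie> X2 \<bowtie> X3 \<bowtie> Snd R3)))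
    (LetIn (Call f_scale (Fst (Snd (Var 1)) \<bowtie> Snd (Fst (Snd (Snd (Var 1))))))
      (LetIn (Fst (Snd (Snd (Snd (Var 2)))))
       (Cond (Call f_leq (Var 1 \<bowtie> X1))
        (Call f_ins (Fst (Var 3) \<bowtie>
          (Call f_sub (X1 \<bowtie> Var 1) \<bowtie>
           (Fst (Snd (Var 3)) \<bowtie> Fst (Snd (Snd (Var 3)))) \<bowtie> R1) \<bowtie>
          Var 2))
        (Var 2)))))
   (Const 0)"

definition "e_level = Cond X3
   (Call f_level (X1 \<bowtie> X2 \<bowtie> Snd X3 \<bowtie> Call f_step (X1 \<bowtie> X2 \<bowtie> Fst X3 \<bowtie> R3))) R3"

text \<open>The weight doubles on the way into the recursion and the levels are executed on the way
  out, largest weight first, so nothing has to be halved. Once the weight exceeds the number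
  \<open>K\<close> of bins, no multiplicity has a digit that high.\<close>

definition "e_dp = Cond (Sub X2 X1) ((R4 \<bowtie> Const 0) \<bowtie> Const 0)
   (Call f_level (X3 \<bowtie> X2 \<bowtie> X4 \<bowtie> Call f_dp (X1 \<bowtie> Add X2 X2 \<bowtie> Add X3 X3 \<bowtie> R3)))"

definition "e_look = Cond X2
   (Cond (Call f_eq (X1 \<bowtie> Fst X2)) (Fst R2) (Call f_look (X1 \<bowtie> Snd X2 \<bowtie> Snd R2))) (Const 0)"

definition "e_offs = Cond R1
   (Add
      (Cond (Add (Sub X1 (Fst (Snd (Fst R1)))) (Sub (Fst (Snd (Fst R1))) X1))
        (Const 0) (Fst (Fst R1)))
      (Call f_offs (X1 \<bowtie> Snd R1))) (Const 0)"

definition "e_mod = Cond (Sub R1 X1) X1 (Call f_mod (Sub X1 R1 \<bowtie> R1))"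

text \<open>In the innermost scope of \<open>e_loc\<close>, the variables are the list of choices, the number of items
  of the given type that the first choice accommodates and the argument.\<close>

definition "e_loc = Cond R3
   (LetIn (Call f_mul (Fst (Fst R3) \<bowtie> Call f_look (X1 \<bowtie> X2 \<bowtie> Snd (Snd (Fst R3)))))
    (LetIn (Snd (Snd (Snd (Var 1))))
     (Cond (Sub (Var 1) (Fst (Snd (Snd (Var 2)))))
      (Fst (Snd X1) \<bowtie>
        Add (Add (Call f_offs (Fst (Snd X1) \<bowtie> R1))
          (Call f_mod (Fst (Snd (Snd (Var 2))) \<bowtie> Fst X1))) (Const 1))
      (Call f_loc (Fst (Var 2) \<bowtie> Fst (Snd (Var 2)) \<bowtie> Sub (Fst (Snd (Snd (Var 2)))) (Var 1) \<bowtie> R1)))))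
   (Const 0 \<bowtie> Const 0)"

definition "e_out = Cond R2
   (Call f_loc (Fst R2 \<bowtie> X1 \<bowtie> Call f_count R2 \<bowtie> X2) \<bowtie> Call f_out (X1 \<bowtie> X2 \<bowtie> Snd R2))
   (Const 0)"

definition "e_find = Cond X1
   (Cond (Call f_sum (Fst (Fst X1))) (Call f_find (Snd X1 \<bowtie> R1))
      (Const 1 \<bowtie> Call f_out (X2 \<bowtie> Snd (Fst X1) \<bowtie> R2)))
   (Const 0)"

definition "packing_prog =
  [e_main, e_mul, e_scale, e_leq, e_sub, e_sum, e_sums, e_eq, e_count, e_remdups, e_length,
   e_heads, e_target, e_unit, e_pre, e_gen, e_fsum, e_fsums, e_filt, e_cols, e_mem, e_ins,
   e_step, e_level, e_dp, e_look, e_offs, e_mod, e_loc, e_out, e_find, e_types, e_solve]"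

abbreviation "pcalls \<equiv> calls packing_prog"

lemma packing_prog_simps [simp]:
  "length packing_prog = 33"
  "packing_prog ! 0 = e_main" "packing_prog ! Suc 0 = e_mul" "packing_prog ! 2 = e_scale"
  "packing_prog ! 3 = e_leq" "packing_prog ! 4 = e_sub" "packing_prog ! 5 = e_sum"
  "packing_prog ! 6 = e_sums" "packing_prog ! 7 = e_eq" "packing_prog ! 8 = e_count"
  "packing_prog ! 9 = e_remdups" "packing_prog ! 10 = e_length" "packing_prog ! 11 = e_heads"
  "packing_prog ! 12 = e_target" "packing_prog ! 13 = e_unit" "packing_prog ! 14 = e_pre"
  "packing_prog ! 15 = e_gen" "packing_prog ! 16 = e_fsum" "packing_prog ! 17 = e_fsums"
  "packing_prog ! 18 = e_filt" "packing_prog ! 19 = e_cols" "packing_prog ! 20 = e_mem"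
  "packing_prog ! 21 = e_ins" "packing_prog ! 22 = e_step" "packing_prog ! 23 = e_level"
  "packing_prog ! 24 = e_dp" "packing_prog ! 25 = e_look" "packing_prog ! 26 = e_offs"
  "packing_prog ! 27 = e_mod" "packing_prog ! 28 = e_loc" "packing_prog ! 29 = e_out"
  "packing_prog ! 30 = e_find" "packing_prog ! 31 = e_types" "packing_prog ! 32 = e_solve"
  by (simp_all add: packing_prog_def)

section \<open>Arithmetic and list subroutines\<close>

lemma calls_mul_generic:
  assumes "Suc 0 < length P" "P ! Suc 0 = e_mul"
  shows "calls P Q (Suc 0) (Num w \<parallel> Num c) (Num (w * c)) (20 * (c + 1))"
proof (induction c)
  case 0 show ?case using assms by (simp add: calls_def e_mul_def)
next
  case (Suc c) show ?case
    using assms apply (simp add: calls_def e_mul_def)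
    apply (rule wp_callI[OF Suc])
    apply simp
    done
qed

lemma calls_mul: "pcalls Q (Suc 0) (Num w \<parallel> Num c) (Num (w * c)) (20 * (c + 1))"
  by (rule calls_mul_generic) simp_all

definition vscale :: "nat \<Rightarrow> nat list \<Rightarrow> nat list" where
  "vscale w v = map ((*) w) v"

definition vminus :: "nat list \<Rightarrow> nat list \<Rightarrow> nat list" where
  "vminus x y = map2 (-) x y"

lemma length_vscale [simp]: "length (vscale w v) = length v"
  by (simp add: vscale_def)

lemma length_vminus [simp]: "length (vminus x y) = min (length x) (length y)"
  by (simp add: vminus_def)

lemma calls_scale:
  "pcalls Q f_scale (Num w \<parallel> eN v) (eN (vscale w v)) (50 * (sum_list v + length v + 1))"
proof (induction v)
  case Nil show ?case by (simp add: calls_def e_scale_def vscale_def)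
next
  case (Cons c v)
  show ?case
    apply (simp add: calls_def e_scale_def vscale_def)
    apply (rule wp_callI[OF calls_mul])
    apply simp
    apply (rule wp_callI[OF Cons[unfolded vscale_def]])
    apply simp
    done
qed

lemma calls_leq: "length x = length y \<Longrightarrow>
  pcalls Q f_leq (eN x \<parallel> eN y) (Num (of_bool (list_all2 (\<le>) x y))) (30 * (length x + 1))"
proof (induction x y rule: list_induct2)
  case Nil show ?case by (simp add: calls_def e_leq_def)
next
  case (Cons a x b y)
  show ?case
    apply (cases "list_all2 (\<le>) x y")
     apply (simp_all add: calls_def e_leq_def)
     apply (safe; rule wp_callI[OF Cons.IH]; simp)+
    done
qed

lemma calls_sub: "length x = length y \<Longrightarrow>
  pcalls Q f_sub (eN x \<parallel> eN y) (eN (vminus x y)) (30 * (length x + 1))"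
proof (induction x y rule: list_induct2)
  case Nil show ?case by (simp add: calls_def e_sub_def vminus_def)
next
  case (Cons a x b y)
  show ?case
    apply (simp add: calls_def e_sub_def vminus_def)
    apply (rule wp_callI[OF Cons.IH[unfolded vminus_def]])
    apply simp
    done
qed

lemma calls_sum: "pcalls Q f_sum (eN x) (Num (sum_list x)) (20 * (length x + 1))"
proof (induction x)
  case Nil show ?case by (simp add: calls_def e_sum_def)
next
  case (Cons a x)
  show ?case
    apply (simp add: calls_def e_sum_def)
    apply (rule wp_callI[OF Cons.IH])
    apply simp
    done
qed

lemma calls_sums: "\<forall>x \<in> set xs. length x \<le> Z \<Longrightarrow>
  pcalls Q f_sums (eNN xs) (Num (sum_list (map sum_list xs))) ((20 * Z + 60) * (length xs + 1))"
proof (induction xs)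
  case Nil show ?case by (simp add: calls_def e_sums_def)
next
  case (Cons x xs)
  then have "length x \<le> Z" by simp
  then show ?case
    apply (simp add: calls_def e_sums_def)
    apply (rule wp_callI[OF calls_sum])
    apply simp
    apply (rule wp_callI[OF Cons.IH])
    using Cons.prems apply simp
    apply (simp add: algebra_simps)
    done
qed

lemma calls_eq:
  assumes "length x = length y"
  shows "pcalls Q f_eq (eN x \<parallel> eN y) (Num (of_bool (x = y))) (80 * (length x + 1))"
proof (cases "x = y")
  case True
  then show ?thesis
    using wp_callI[OF calls_leq[OF refl, of Q y]]
    by (simp add: calls_def e_eq_def list_all2_refl)
next
  case neq: False
  show ?thesis
  proof (cases "list_all2 (\<le>) x y")
    case True
    then have "\<not> list_all2 (\<le>) y x"
      using neq by (metis assms list_all2_conv_all_nth nth_equalityI antisym)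
    then show ?thesis
      apply (simp add: calls_def e_eq_def neq)
      apply (rule wp_callI[OF calls_leq[OF assms]])
      apply (simp add: True)
      apply (rule wp_callI[OF calls_leq[OF assms[symmetric]]])
      apply (simp add: assms)
      done
  next
    case False
    then show ?thesis
      apply (simp add: calls_def e_eq_def neq)
      apply (rule wp_callI[OF calls_leq[OF assms]])
      apply simp
      done
  qed
qed

lemma calls_count: "\<forall>y \<in> set ys. length y = length x \<Longrightarrow>
  pcalls Q f_count (eN x \<parallel> eNN ys) (Num (count_list ys x)) (100 * (length x + 1) * (length ys + 1))"
proof (induction ys)
  case Nil show ?case by (simp add: calls_def e_count_def)
next
  case (Cons y ys)
  have l: "length x = length y" using Cons.prems by simp
  have IH: "pcalls Q f_count (eN x \<parallel> eNN ys) (Num (count_list ys x))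
      (100 * (length x + 1) * (length ys + 1))"
    using Cons.prems by (intro Cons.IH) simp
  show ?case
  proof (cases "x = y")
    case True
    show ?thesis
      apply (simp add: calls_def e_count_def True[symmetric])
      apply (rule wp_callI[OF calls_eq[OF refl]])
      apply simp
      apply (rule wp_callI[OF IH])
      apply (simp add: algebra_simps)
      done
  next
    case False
    then show ?thesis
      apply (simp add: calls_def e_count_def)
      apply (rule wp_callI[OF calls_eq[OF l]])
      apply simp
      apply (rule wp_callI[OF IH])
      apply (simp add: algebra_simps)
      done
  qed
qed

lemma calls_remdups: "\<forall>y \<in> set ys. length y = d \<Longrightarrow>
  pcalls Q f_remdups (eNN ys) (eNN (remdups ys)) (130 * (d + 1) * (length ys + 1) ^ 2)"
proof (induction ys)
  case Nil show ?case by (simp add: calls_def e_remdups_def)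
next
  case (Cons y ys)
  have d: "\<forall>z \<in> set ys. length z = length y" "length y = d" using Cons.prems by auto
  have IH: "pcalls Q f_remdups (eNN ys) (eNN (remdups ys)) (130 * (d + 1) * (length ys + 1) ^ 2)"
    using Cons.prems by (intro Cons.IH) simp
  show ?case
    apply (cases "y \<in> set ys")
     apply (simp_all add: calls_def e_remdups_def)
     apply (rule wp_callI[OF calls_count[OF d(1)]])
     apply (simp add: count_list_0_iff)
     apply (rule wp_callI[OF IH])
     apply (simp add: algebra_simps power2_eq_square d(2))
    apply (rule wp_callI[OF calls_count[OF d(1)]])
    apply (simp add: count_list_0_iff)
    apply (rule wp_callI[OF IH])
    apply (simp add: algebra_simps power2_eq_square d(2))
    done
qed

lemma calls_length: "pcalls Q f_length (enc_list xs) (Num (length xs)) (20 * (length xs + 1))"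
proof (induction xs)
  case Nil show ?case by (simp add: calls_def e_length_def)
next
  case (Cons x xs)
  show ?case
    apply (simp add: calls_def e_length_def)
    apply (rule wp_callI[OF Cons.IH])
    apply simp
    done
qed

lemma calls_heads: "[] \<notin> set xs \<Longrightarrow>
  pcalls Q f_heads (eNN xs) (eN (map hd xs)) (20 * (length xs + 1))"
proof (induction xs)
  case Nil show ?case by (simp add: calls_def e_heads_def)
next
  case (Cons x xs)
  then obtain a y where "x = a # y" by (cases x) auto
  then show ?case
    apply (simp add: calls_def e_heads_def)
    apply (rule wp_callI[OF Cons.IH])
    using Cons.prems apply simp_all
    done
qed

lemma calls_target:
  assumes "\<forall>y \<in> set ys. length y = d" "[] \<notin> set ks"
  shows "\<forall>t \<in> set ts. length t = d \<Longrightarrow>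
    pcalls Q f_target (eNN ts \<parallel> eNN ys \<parallel> eNN ks) (eN (map (count_list ys) ts @ map hd ks))
      (130 * (d + 1) * (length ys + 1) * (length ts + 1) + 20 * length ks)"
proof (induction ts)
  case Nil
  show ?case
    apply (simp add: calls_def e_target_def)
    apply (rule wp_callI[OF calls_heads])
    using assms apply simp
    apply (simp add: algebra_simps)
    done
next
  case (Cons t ts)
  show ?case
    apply (simp add: calls_def e_target_def)
    apply (rule wp_callI[OF calls_count])
    using Cons.prems assms apply simp
    apply simp
    apply (rule wp_callI[OF Cons.IH])
    using Cons.prems apply simp
    using Cons.prems apply (simp add: algebra_simps)
    done
qed

text \<open>Indices start at 1 and the list only supplies the length. Truncated subtraction keeps
  the index at 0 after the unit entry, and 0 produces no further 1.\<close>

fun unit_vec :: "nat \<Rightarrow> 'a list \<Rightarrow> nat list" where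
  "unit_vec i [] = []"
| "unit_vec i (k # ks) = of_bool (i = 1) # unit_vec (i - 1) ks"

lemma calls_unit: "pcalls Q f_unit (Num i \<parallel> enc_list ks) (eN (unit_vec i ks)) (40 * (length ks + 1))"
proof (induction ks arbitrary: i)
  case Nil show ?case by (simp add: calls_def e_unit_def)
next
  case (Cons k ks)
  show ?case
    apply (cases "i = 0"; cases "i = 1")
       apply (simp_all add: calls_def e_unit_def)
      apply (rule wp_callI[OF Cons.IH[of 0, simplified]], simp)
     apply (rule wp_callI[OF Cons.IH[of 0, simplified]], simp)
    apply (rule wp_callI[OF Cons.IH], simp)
    done
qed

lemma calls_pre:
  "pcalls Q f_pre (Num c \<parallel> eNN xs \<parallel> eNN ys) (eNN (map ((#) c) xs @ ys)) (40 * (length xs + 1))"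
proof (induction xs)
  case Nil show ?case by (simp add: calls_def e_pre_def)
next
  case (Cons x xs)
  show ?case
    apply (simp add: calls_def e_pre_def)
    apply (rule wp_callI[OF Cons.IH])
    apply simp
    done
qed

section \<open>Configurations\<close>

text \<open>The first entry of an item (its fingerprint) is replaced by 1, so that the first capacity
  bounds the number of items.  This keeps oracle calls within \<open>T (card (items B))\<close> and makes the
  recursion of \<open>gen\<close> terminate.\<close>

definition load :: "nat list \<Rightarrow> nat list" where
  "load t = 1 # tl t"

lemma sum_list_vminus:
  "list_all2 (\<le>) x y \<Longrightarrow> sum_list (vminus y x) + sum_list x = sum_list (y :: nat list)"
  by (induction x y rule: list_all2_induct) (auto simp: vminus_def)

text \<open>Here \<open>c\<close> is the number of copies of the first type packed so far. Either it
  is final and the next type starts from 0, or one more copy is loaded. \<open>base\<close>, later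
  the unit vector of the bin kind, is appended at the leaves.\<close>

function gen :: "nat list \<Rightarrow> nat list list \<Rightarrow> nat \<Rightarrow> nat list \<Rightarrow> nat list list" where
  "gen base [] c cap = [base]"
| "gen base (t # ts) c cap = map ((#) c) (gen base ts 0 cap) @
     (if list_all2 (\<le>) (load t) cap
      then gen base (t # ts) (Suc c) (vminus cap (load t)) else [])"
  by pat_completeness auto
termination
proof (relation "measures [\<lambda>(b, ts, c, cap). length ts, \<lambda>(b, ts, c, cap). sum_list cap]")
  fix base c cap ts and t :: "nat list"
  assume "list_all2 (\<le>) (load t) cap"
  from sum_list_vminus[OF this]
  show "((base, t # ts, Suc c, vminus cap (load t)), base, t # ts, c, cap)
    \<in> measures [\<lambda>(b, ts, c, cap). length ts, \<lambda>(b, ts, c, cap). sum_list cap]"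
    by (simp add: load_def)
qed auto

declare gen.simps(2) [simp del]

lemma gen_nonempty: "gen base ts c cap \<noteq> []"
  by (induction base ts c cap rule: gen.induct) (auto simp: gen.simps(2))

text \<open>Every branch yields at least one vector, so the time is proportional to the output: the
  work at a node is charged to the vectors with \<open>c\<close> final, whose recursive call has a
  smaller factor for the number of types.\<close>

lemma calls_gen:
  assumes "\<forall>t \<in> set ts. length t = length cap" "cap \<noteq> []"
  shows "pcalls Q f_gen (eN base \<parallel> eNN ts \<parallel> Num c \<parallel> eN cap) (eNN (gen base ts c cap))
    (300 * (length cap + 1) * (length ts + 1) * length (gen base ts c cap))"
  using assms
proof (induction base ts c cap rule: gen.induct)
  case (1 base c cap) show ?case by (simp add: calls_def e_gen_def)
next
  case (2 base t ts c cap)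
  obtain a t' where t: "t = a # t'" using 2(3,4) by (cases t) auto
  have load: "load t = 1 # t'" "length (load t) = length cap" using t 2(3) by (auto simp: load_def)
  let ?z = "length cap + 1" and ?k = "length ts + 1"
  let ?n1 = "length (gen base ts 0 cap)"
  let ?fit = "list_all2 (\<le>) (load t) cap"
  let ?G2 = "if ?fit then gen base (t # ts) (Suc c) (vminus cap (load t)) else []"
  have n1: "?n1 \<ge> 1" using gen_nonempty[of base ts 0 cap] by (simp add: Suc_le_eq)
  have IH1: "pcalls Q f_gen (eN base \<parallel> eNN ts \<parallel> Num 0 \<parallel> eN cap) (eNN (gen base ts 0 cap))
      (300 * ?z * ?k * ?n1)"
    using 2 by simp
  define b1 where "b1 = 300 * ?z * ?k * ?n1"
  define b2 where "b2 = 300 * ?z * (?k + 1) * length ?G2"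
  define p where "p = length cap * ?n1"
  note IH1 = IH1[folded b1_def]
  have le: "length cap \<le> p" using n1 by (simp add: p_def)
  have len: "300 * ?z * (length (t # ts) + 1) * length (gen base (t # ts) c cap) =
      b1 + b2 + 300 * p + 300 * ?n1"
    unfolding b1_def b2_def p_def by (simp add: gen.simps(2) algebra_simps)
  have ne: "vminus cap (load t) \<noteq> []"
    using 2(4) load(2) by (metis length_vminus min.idem length_0_conv)
  have IH2: "?fit \<Longrightarrow> pcalls Q f_gen (eN base \<parallel> eNN (t # ts) \<parallel> Num (Suc c) \<parallel> eN (vminus cap (load t)))
      (eNN ?G2) b2"
    unfolding b2_def using 2(2) 2(3,4) load(2) ne by simp
  have leq: "pcalls Q f_leq ((Num (Suc 0) \<parallel> eN t') \<parallel> eN cap) (Num (of_bool ?fit)) (30 * ?z)"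
    using calls_leq[OF load(2), of Q] unfolding load(2) by (simp add: load(1))
  have sub: "pcalls Q f_sub (eN cap \<parallel> Num (Suc 0) \<parallel> eN t') (eN (vminus cap (load t))) (30 * ?z)"
    using calls_sub[OF load(2)[symmetric], of Q] by (simp add: load(1))
  show ?case
  proof (cases ?fit)
    case True
    let ?n2 = "length (gen base (t # ts) (Suc c) (vminus cap (load t)))"
    note [simp del] = enc_list.simps(2)
    have IH2': "pcalls Q f_gen
      (eN base \<parallel> ((Num a \<parallel> eN t') \<parallel> eNN ts) \<parallel> Num (Suc c) \<parallel> eN (vminus cap (load t)))
      (eNN (gen base (t # ts) (Suc c) (vminus cap (load t)))) b2"
      using IH2 True by (simp add: t enc_list.simps(2))
    show ?thesis
      unfolding calls_def len
      apply (simp add: t e_gen_def enc_list.simps(2) del: One_nat_def)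
      apply (rule wp_callI[OF IH1])
      apply simp
      apply (rule wp_callI[OF leq])
      apply (simp add: True)
      apply (rule wp_callI[OF sub])
      apply simp
      apply (rule wp_callI[OF IH2'])
      apply (rule wp_callI[OF calls_pre])
      using n1 le True apply (simp add: gen.simps(2)[of base "a # t'"] t)
      done
  next
    case False
    show ?thesis
      unfolding calls_def len
      apply (simp add: t e_gen_def)
      apply (rule wp_callI[OF IH1])
      apply (rule wp_callI[OF leq])
      apply (simp add: False)
      apply (rule wp_callI[OF calls_pre[of _ _ _ "[]", simplified]])
      using n1 le False apply (simp add: gen.simps(2)[of base "a # t'"] t)
      done
  qed
qed

definition load_total :: "nat list \<Rightarrow> nat list list \<Rightarrow> nat \<Rightarrow> nat" where
  "load_total u ts j = sum_list (map2 (\<lambda>a t. a * load t ! j) u ts)"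

definition fit :: "nat list \<Rightarrow> nat list list \<Rightarrow> nat list \<Rightarrow> bool" where
  "fit u ts cap \<longleftrightarrow> length u = length ts \<and> (\<forall>j < length cap. load_total u ts j \<le> cap ! j)"

text \<open>Compensates for starting \<open>gen\<close> with \<open>c\<close> copies already packed:
  the multiplicity of the first type comes out larger by \<open>c\<close>.\<close>

fun bump :: "nat \<Rightarrow> nat list \<Rightarrow> nat list" where
  "bump c [] = []"
| "bump c (a # u) = (c + a) # u"

lemma fit_Cons_0 [simp]: "fit (0 # u) (t # ts) cap \<longleftrightarrow> fit u ts cap"
  by (simp add: fit_def load_total_def)

text \<open>Removing one copy of the first type subtracts its load from the capacity. That the load
  fits is a separate condition because \<open>vminus\<close> truncates.\<close>

lemma fit_Cons_Suc:
  assumes "length (load t) = length cap"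
  shows "fit (Suc a # u) (t # ts) cap \<longleftrightarrow>
    list_all2 (\<le>) (load t) cap \<and> fit (a # u) (t # ts) (vminus cap (load t))"
proof -
  have "(\<forall>j<length cap. load t ! j + x j \<le> cap ! j) \<longleftrightarrow>
    list_all2 (\<le>) (load t) cap \<and> (\<forall>j<length cap. x j \<le> vminus cap (load t) ! j)" for x
  proof -
    have "load t ! j + x j \<le> cap ! j \<longleftrightarrow> load t ! j \<le> cap ! j \<and> x j \<le> cap ! j - load t ! j" for j
      by linarith
    then show ?thesis using assms by (auto simp: list_all2_conv_all_nth vminus_def)
  qed
  from this[of "\<lambda>j. load_total (a # u) (t # ts) j"] show ?thesis
    using assms by (auto simp: fit_def load_total_def add_ac)
qed

lemma set_gen:
  assumes "\<forall>t \<in> set ts. length t = length cap" "cap \<noteq> []"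
  shows "set (gen base ts c cap) = (\<lambda>u. bump c u @ base) ` {u. fit u ts cap}"
  using assms
proof (induction base ts c cap rule: gen.induct)
  case (1 base c cap)
  then show ?case by (auto simp: fit_def load_total_def)
next
  case (2 base t ts c cap)
  have l: "length (load t) = length cap" using 2(3,4) by (cases t) (auto simp: load_def)
  have ne: "vminus cap (load t) \<noteq> []"
    using 2(4) l by (metis length_vminus min.idem length_0_conv)
  have 1: "set (gen base ts 0 cap) = (\<lambda>u. bump 0 u @ base) ` {u. fit u ts cap}"
    using 2 by simp
  have b0: "bump 0 u = u" for u by (cases u) auto
  have 2: "set (gen base (t # ts) (Suc c) (vminus cap (load t))) =
      (\<lambda>u. bump (Suc c) u @ base) ` {u. fit u (t # ts) (vminus cap (load t))}"
    if "list_all2 (\<le>) (load t) cap"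
    using 2(2)[OF that] 2(3,4) l ne by simp
  have len: "\<exists>a u. x = a # u" if "fit x (t # ts) cap'" for x cap'
    using that by (cases x) (auto simp: fit_def)
  \<comment> \<open>The two branches of \<open>gen\<close>: a fitting vector starts with 0, or
    lowering its first entry by 1 makes it fit the reduced capacity.\<close>
  have split: "{x. fit x (t # ts) cap} = (\<lambda>u. 0 # u) ` {u. fit u ts cap} \<union>
     (if list_all2 (\<le>) (load t) cap
      then bump 1 ` {x. fit x (t # ts) (vminus cap (load t))} else {})" (is "?L = ?R")
  proof (intro equalityI subsetI)
    fix x assume "x \<in> ?L"
    then have x: "fit x (t # ts) cap" by simp
    from len[OF x] obtain a u where [simp]: "x = a # u" by auto
    show "x \<in> ?R"
    proof (cases a)
      case 0 then show ?thesis using x by auto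
    next
      case (Suc a')
      then have "list_all2 (\<le>) (load t) cap" "fit (a' # u) (t # ts) (vminus cap (load t))"
        using x fit_Cons_Suc[OF l, of a' u] by auto
      moreover have "x = bump 1 (a' # u)" using Suc by simp
      ultimately show ?thesis by (metis (mono_tags, lifting) UnI2 image_eqI mem_Collect_eq)
    qed
  next
    fix x assume "x \<in> ?R"
    then consider u where "x = 0 # u" "fit u ts cap"
      | y where "list_all2 (\<le>) (load t) cap" "fit y (t # ts) (vminus cap (load t))" "x = bump 1 y"
      by (auto split: if_splits)
    then show "x \<in> ?L"
    proof cases
      case 2
      then obtain a u where "y = a # u" using len by blast
      then show ?thesis using 2 fit_Cons_Suc[OF l, of a u] by simp
    qed auto
  qed
  have bb: "bump c (bump (Suc 0) u) = bump (Suc c) u" for u by (cases u) auto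
  let ?f = "\<lambda>u. bump c u @ base"
  have f0: "?f ` (\<lambda>u. 0 # u) ` {u. fit u ts cap} = (#) c ` set (gen base ts 0 cap)"
    unfolding 1 image_image by (simp only: b0 bump.simps append_Cons add_0_right)
  have f1: "?f ` bump 1 ` Y = (\<lambda>u. bump (Suc c) u @ base) ` Y" for Y
    unfolding image_image One_nat_def bb ..
  show ?case
  proof (cases "list_all2 (\<le>) (load t) cap")
    case True
    show ?thesis
      by (subst gen.simps(2)) (simp only: split if_P[OF True] image_Un f0 f1 2[OF True, symmetric] set_append set_map)
  next
    case False
    show ?thesis
      by (subst gen.simps(2)) (simp only: split if_not_P[OF False] image_Un f0 set_append set_map image_empty list.set)
  qed
qed

text \<open>Each further copy of a type uses at least one unit of the true capacity
  \<open>tl cap\<close>, so the first multiplicity takes at most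
  \<open>sum_list (tl cap) + 1\<close> values and every other one at most \<open>H + 1\<close>. The
  row counting items cannot be used here, as its capacity is the number of items and not bounded by
  the parameter.\<close>

lemma length_gen:
  assumes "\<forall>t \<in> set ts. length t = length cap \<and> sum_list (tl t) > 0"
    and "cap \<noteq> []" "sum_list (tl cap) \<le> H"
  shows "length (gen base ts c cap) \<le>
    (if ts = [] then 1 else (sum_list (tl cap) + 1) * (H + 1) ^ (length ts - 1))"
  using assms
proof (induction base ts c cap rule: gen.induct)
  case (1 base c cap)
  then show ?case by simp
next
  case (2 base t ts c cap)
  have l: "length (load t) = length cap" using 2(3,4) by (cases t) (auto simp: load_def)
  have 1: "length (gen base ts 0 cap) \<le> (H + 1) ^ length ts"
  proof -
    have "length (gen base ts 0 cap) \<le>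
        (if ts = [] then 1 else (sum_list (tl cap) + 1) * (H + 1) ^ (length ts - 1))"
      using 2 by simp
    also have "\<dots> \<le> (H + 1) ^ length ts"
      using 2(5) by (cases ts) auto
    finally show ?thesis .
  qed
  show ?case
  proof (cases "list_all2 (\<le>) (load t) cap")
    case True
    obtain a cap' where [simp]: "cap = a # cap'" using 2(4) by (cases cap) auto
    have le: "list_all2 (\<le>) (tl t) cap'" using True by (simp add: load_def)
    have tl: "tl (vminus cap (load t)) = vminus cap' (tl t)"
      by (simp add: vminus_def load_def)
    have ne: "vminus cap (load t) \<noteq> []" by (simp add: vminus_def load_def)
    have s: "sum_list (vminus cap' (tl t)) < sum_list cap'"
      using sum_list_vminus[OF le] 2(3) by simp
    have "length (gen base (t # ts) (Suc c) (vminus cap (load t))) \<le>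
        (if t # ts = [] then 1
         else (sum_list (tl (vminus cap (load t))) + 1) * (H + 1) ^ (length (t # ts) - 1))"
      by (rule 2(2)[OF True _ ne]) (use 2(3,5) l s tl in auto)
    also have "\<dots> = (sum_list (vminus cap' (tl t)) + 1) * (H + 1) ^ length ts"
      using tl by simp
    also have "\<dots> \<le> sum_list cap' * (H + 1) ^ length ts"
      using s by (intro mult_le_mono1) simp
    finally show ?thesis using 1 True by (simp add: gen.simps(2))
  next
    case False
    then show ?thesis using 1 by (simp add: gen.simps(2))
  qed
qed

section \<open>Queries to the validity predicates and the list of columns\<close>

definition fsum :: "nat \<Rightarrow> nat list list \<Rightarrow> nat list \<Rightarrow> nat" where
  "fsum g ts v = sum_list (map2 (\<lambda>t c. if hd t = g then c else 0) ts v)"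

lemma calls_fsum: "\<lbrakk>[] \<notin> set ts; length ts \<le> length v\<rbrakk> \<Longrightarrow>
  pcalls Q f_fsum (Num g \<parallel> eNN ts \<parallel> eN v) (Num (fsum g ts v)) (50 * (length ts + 1))"
proof (induction ts arbitrary: v)
  case Nil show ?case by (simp add: calls_def e_fsum_def fsum_def)
next
  case (Cons t ts)
  then obtain a t' c v' where [simp]: "t = a # t'" "v = c # v'"
    by (cases t; cases v) auto
  have IH: "pcalls Q f_fsum (Num g \<parallel> eNN ts \<parallel> eN v') (Num (fsum g ts v')) (50 * (length ts + 1))"
    using Cons by simp
  show ?case
  proof (cases "a = g")
    case True
    show ?thesis
      apply (simp add: calls_def e_fsum_def True)
      apply (rule wp_callI[OF IH])
      apply (simp add: True fsum_def)
      done
  next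
    case False
    then have "a - g \<noteq> 0 \<or> g - a \<noteq> 0" by auto
    with False show ?thesis
      apply (simp add: calls_def e_fsum_def)
      apply (intro conjI impI)
       apply (rule wp_callI[OF IH], simp add: fsum_def)+
      done
  qed
qed

definition fsums :: "nat \<Rightarrow> nat list list \<Rightarrow> nat list \<Rightarrow> nat list" where
  "fsums F ts v = map (\<lambda>g. fsum g ts v) [0..<F]"

lemma calls_fsums:
  assumes "[] \<notin> set ts" "length ts \<le> length v"
  shows "pcalls Q f_fsums (Num F \<parallel> Num 0 \<parallel> eNN ts \<parallel> eN v) (eN (fsums F ts v))
    (80 * (F + 1) * (length ts + 1))"
proof -
  have "pcalls Q f_fsums (Num F \<parallel> Num g \<parallel> eNN ts \<parallel> eN v) (eN (map (\<lambda>g. fsum g ts v) [g..<g + F]))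
    (80 * (F + 1) * (length ts + 1))" for g
  proof (induction F arbitrary: g)
    case 0 show ?case by (simp add: calls_def e_fsums_def)
  next
    case (Suc F)
    have "[g..<g + Suc F] = g # [Suc g..<Suc g + F]"
      using upt_rec[of g "g + Suc F"] by simp
    then show ?case
      apply (simp add: calls_def e_fsums_def del: upt_Suc map_map)
      apply (rule wp_callI[OF calls_fsum[OF assms]])
      apply (simp del: upt_Suc map_map)
      apply (rule wp_callI[OF Suc.IH])
      apply (simp add: algebra_simps)
      done
  qed
  from this[of 0] show ?thesis by (simp add: fsums_def)
qed

text \<open>Only the presence in \<open>Q\<close> of an answer within time \<open>b\<close> is asked
  for, which separates the analysis of the program from the encoding of multisets.\<close>

definition oracle_ok :: "ext \<Rightarrow> nat \<Rightarrow> nat list list \<Rightarrow> (nat \<Rightarrow> nat list \<Rightarrow> bool) \<Rightarrow> nat \<Rightarrow> nat \<Rightarrow> nat list \<Rightarrow> bool"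
  where "oracle_ok Q F ts ok b i v \<longleftrightarrow>
    (\<exists>t \<le> b. (Num i \<parallel> eN (fsums F ts v), Num (of_bool (ok i v)), t) \<in> Q)"

lemma calls_filt:
  assumes "[] \<notin> set ts"
  shows "\<forall>v \<in> set vs. length ts \<le> length v \<and> oracle_ok Q F ts ok b i v \<Longrightarrow>
    pcalls Q f_filt (Num F \<parallel> eNN ts \<parallel> Num i \<parallel> eNN vs \<parallel> eNN acc)
      (eNN (map ((#) i) (filter (ok i) vs) @ acc))
      ((length vs + 1) * (80 * (F + 1) * (length ts + 1) + b + 100))"
proof (induction vs)
  case Nil show ?case by (simp add: calls_def e_filt_def)
next
  case (Cons v vs)
  let ?A = "80 * (F + 1) * (length ts + 1)"
  have v: "length ts \<le> length v" using Cons by simp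
  obtain t where t: "t \<le> b" "(Num i \<parallel> eN (fsums F ts v), Num (of_bool (ok i v)), t) \<in> Q"
    using Cons.prems by (auto simp: oracle_ok_def)
  define A where "A = ?A"
  have IH: "pcalls Q f_filt (Num F \<parallel> eNN ts \<parallel> Num i \<parallel> eNN vs \<parallel> eNN acc)
      (eNN (map ((#) i) (filter (ok i) vs) @ acc)) ((length vs + 1) * (A + b + 100))"
    unfolding A_def using Cons by simp
  note F = calls_fsums[OF assms v, of Q F, folded A_def]
  show ?case
    unfolding A_def[symmetric]
    apply (cases "ok i v")
     apply (simp_all add: calls_def e_filt_def)
     apply (rule wp_callI[OF F])
     apply (simp del: One_nat_def)?
     apply (rule exI[of _ "Num (Suc 0)"])
     apply (rule exI[of _ t])
     apply (use t in simp)
     apply (rule wp_callI[OF IH])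
     apply (simp add: algebra_simps)
    apply (rule wp_callI[OF F])
    apply (simp del: One_nat_def)?
    apply (rule exI[of _ "Num 0"])
    apply (rule exI[of _ t])
    apply (use t in simp)
    apply (rule wp_callI[OF IH])
    apply (simp add: algebra_simps)
    done
qed

text \<open>The head of a kind, its number of bins, is replaced by \<open>n\<close>, the capacity of
  the row that counts items. Each column holds its kind twice: as a number for reading off the
  assignment and as a unit vector for the equations.\<close>

fun columns :: "(nat \<Rightarrow> nat list \<Rightarrow> bool) \<Rightarrow> nat list list \<Rightarrow> nat \<Rightarrow> nat list list \<Rightarrow> nat \<Rightarrow>
    nat list list \<Rightarrow> nat list list" where
  "columns ok ts n all i [] = []"
| "columns ok ts n all i (k # ks) =
     map ((#) i) (filter (ok i) (gen (unit_vec i all) ts 0 (n # tl k))) @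
     columns ok ts n all (Suc i) ks"

lemma load_total_0:
  "length u = length ts \<Longrightarrow> load_total u ts 0 = sum_list u"
  by (induction u ts rule: list_induct2) (auto simp: load_total_def load_def)

lemma length_unit_vec [simp]: "length (unit_vec i ks) = length ks"
  by (induction i ks rule: unit_vec.induct) auto

lemma unit_vec_map [simp]: "unit_vec i (map g ks) = unit_vec i ks"
  by (induction i ks rule: unit_vec.induct) auto

text \<open>The row counting items keeps every multiset submitted to the oracle within size
  \<open>n\<close>, so each call is covered by the time bound for \<open>n\<close> elements.\<close>

lemma gen_prefix:
  assumes "v \<in> set (gen base ts 0 (n # cap))" "\<forall>t \<in> set ts. length t = Suc (length cap)"
  shows "\<exists>u. v = u @ base \<and> fit u ts (n # cap) \<and> length u = length ts \<and> sum_list u \<le> n"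
proof -
  have b0: "bump 0 u = u" for u by (cases u) auto
  obtain u where u: "v = u @ base" "fit u ts (n # cap)"
    using assms set_gen[of ts "n # cap" base 0] by (auto simp: b0)
  then have "length u = length ts" by (simp add: fit_def)
  moreover have "load_total u ts 0 \<le> n" using u(2) unfolding fit_def by fastforce
  ultimately show ?thesis using u by (auto simp: load_total_0)
qed

lemma calls_cols:
  assumes ts: "\<forall>t \<in> set ts. length t = Suc d \<and> sum_list (tl t) > 0"
    and answers: "\<And>i u. \<lbrakk>i0 \<le> i; i < i0 + length ks; length u = length ts; sum_list u \<le> n\<rbrakk> \<Longrightarrow>
      oracle_ok Q F ts ok b i (u @ unit_vec i all)"
    and G: "\<And>i k. k \<in> set ks \<Longrightarrow> length (gen (unit_vec i all) ts 0 (n # tl k)) \<le> G"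
    and ks: "\<forall>k \<in> set ks. length k = Suc d"
  shows "pcalls Q f_cols
    (Num F \<parallel> eNN ts \<parallel> Num n \<parallel> eNN all \<parallel> Num i0 \<parallel> eNN ks) (eNN (columns ok ts n all i0 ks))
    ((length ks + 1) * ((G + 1) * (400 * (F + d + 2) * (length ts + 1) + b + 200) +
      40 * (length all + 1)))"
  using answers G ks
proof (induction ks arbitrary: i0)
  case Nil show ?case by (simp add: calls_def e_cols_def)
next
  case (Cons k ks)
  let ?vs = "gen (unit_vec i0 all) ts 0 (n # tl k)"
  obtain k0 k' where k: "k = k0 # k'" "length k' = d" using Cons.prems(3) by (cases k) auto
  have ts0: "[] \<notin> set ts" using ts by auto
  define D where "D = (G + 1) * (400 * (F + d + 2) * (length ts + 1) + b + 200) +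
      40 * (length all + 1)"
  have IH: "pcalls Q f_cols
    (Num F \<parallel> eNN ts \<parallel> Num n \<parallel> eNN all \<parallel> Num (Suc i0) \<parallel> eNN ks) (eNN (columns ok ts n all (Suc i0) ks))
    ((length ks + 1) * D)"
    unfolding D_def by (rule Cons.IH) (use Cons.prems in auto)
  have gen: "pcalls Q f_gen (eN (unit_vec i0 all) \<parallel> eNN ts \<parallel> Num 0 \<parallel> Num n \<parallel> eN k') (eNN ?vs)
    (300 * (d + 2) * (length ts + 1) * length ?vs)"
    using calls_gen[of ts "n # k'" Q "unit_vec i0 all" 0] k ts by simp
  have vs: "\<forall>v \<in> set ?vs. length ts \<le> length v \<and> oracle_ok Q F ts ok b i0 v"
  proof
    fix v assume "v \<in> set ?vs"
    from gen_prefix[OF this[unfolded k, simplified]] ts k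
    obtain u where "v = u @ unit_vec i0 all" "length u = length ts" "sum_list u \<le> n" by auto
    then show "length ts \<le> length v \<and> oracle_ok Q F ts ok b i0 v"
      using Cons.prems(1)[of i0 u] by simp
  qed
  have len: "length ?vs \<le> G" using Cons.prems(2) by simp
  have "300 * (d + 2) * (length ts + 1) * length ?vs + (length ?vs + 1) * (80 * (F + 1) * (length ts + 1) + b + 100)
     \<le> 300 * (d + 2) * (length ts + 1) * G + (G + 1) * (80 * (F + 1) * (length ts + 1) + b + 100)"
    by (intro add_mono mult_le_mono len order_refl)
  also have "\<dots> + 40 * (length all + 1) + 100 \<le> D"
    by (simp add: D_def algebra_simps)
  finally have D: "300 * (d + 2) * (length ts + 1) * length ?vs +
      (length ?vs + 1) * (80 * (F + 1) * (length ts + 1) + b + 100) + 40 * (length all + 1) + 100 \<le> D"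
    by simp
  show ?case
    unfolding D_def[symmetric]
    apply (simp add: calls_def e_cols_def k(1))
    apply (rule wp_callI[OF calls_unit[of Q i0 "map (\<lambda>xs. eN xs) all", unfolded unit_vec_map length_map]])
    apply (rule wp_callI[OF gen])
    apply simp?
    apply (rule wp_callI[OF IH])
    apply (rule wp_callI[OF calls_filt[OF ts0 vs]])
    using D apply (simp add: k)
    done
qed

section \<open>The dynamic program\<close>

text \<open>Membership is tested on residuals only: later steps never look at the history, so one
  history per residual is enough.\<close>

definition ins :: "nat \<Rightarrow> nat list list \<Rightarrow> nat list list list \<Rightarrow> nat list list list" where
  "ins bnd s S = (if sum_list (hd s) \<le> bnd \<and> hd s \<notin> hd ` set S then s # S else S)"

lemma calls_mem:
  "\<forall>s \<in> set S. s \<noteq> [] \<and> length (hd s) = length r \<Longrightarrow>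
   pcalls Q f_mem (eN r \<parallel> eNNN S) (Num (of_bool (r \<in> hd ` set S))) (110 * (length r + 1) * (length S + 1))"
proof (induction S)
  case Nil show ?case by (simp add: calls_def e_mem_def)
next
  case (Cons s S)
  obtain r' es where s: "s = r' # es" "length r = length r'" using Cons.prems by (cases s) auto
  have IH: "pcalls Q f_mem (eN r \<parallel> eNNN S) (Num (of_bool (r \<in> hd ` set S)))
      (110 * (length r + 1) * (length S + 1))"
    using Cons by simp
  show ?case
  proof (cases "r = r'")
    case True
    then show ?thesis
      apply (simp add: calls_def e_mem_def s)
      apply (rule wp_callI[OF calls_eq[OF refl]])
      apply simp
      done
  next
    case False
    define A where "A = 110 * (length r + 1) * (length S + 1)"
    have "110 * (length r + 1) * (length (s # S) + 1) = A + 110 * (length r + 1)"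
      by (simp add: A_def)
    with False show ?thesis
      apply (cases "r \<in> hd ` set S")
       apply (simp_all add: calls_def e_mem_def s(1))
       apply (rule wp_callI[OF calls_eq[OF s(2)]])
       apply simp
       apply (rule wp_callI[OF IH[folded A_def]])
       apply simp
      apply (rule wp_callI[OF calls_eq[OF s(2)]])
      apply simp
      apply (rule wp_callI[OF IH[folded A_def]])
      apply simp
      done
  qed
qed

lemma calls_ins:
  assumes "\<forall>s \<in> set S. s \<noteq> [] \<and> length (hd s) = length r"
  shows "pcalls Q f_ins (Num bnd \<parallel> (eN r \<parallel> eNN es) \<parallel> eNNN S) (eNNN (ins bnd (r # es) S))
    (200 * (length r + 1) * (length S + 1))"
proof -
  define A where "A = 200 * (length r + 1) * (length S + 1)"
  define M where "M = 110 * (length r + 1) * (length S + 1)"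
  have A: "20 * (length r + 1) + M + 70 \<le> A" by (simp add: A_def M_def algebra_simps)
  note mem = calls_mem[OF assms, of Q, folded M_def]
  show ?thesis
  proof (cases "sum_list r \<le> bnd")
    case False
    then show ?thesis
      unfolding A_def[symmetric]
      apply (simp add: calls_def e_ins_def ins_def)
      apply (rule wp_callI[OF calls_sum])
      using A apply simp
      apply (rule exI[of _ "sum_list r"])
      apply simp
      done
  next
    case True
    then show ?thesis
      unfolding A_def[symmetric]
      apply (cases "r \<in> hd ` set S")
       apply (simp_all add: calls_def e_ins_def ins_def)
       apply (rule wp_callI[OF calls_sum])
       apply (rule exI[of _ "sum_list r"])
       apply simp
       apply (rule wp_callI[OF mem])
       using A apply simp
      apply (rule wp_callI[OF calls_sum])
      apply (rule exI[of _ "sum_list r"])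
      apply simp
      apply (rule wp_callI[OF mem])
      using A apply simp
      done
  qed
qed

text \<open>Decides the digit of weight \<open>w\<close> of one column in every state: digit 0 keeps
  the state, digit 1 subtracts the scaled column and records the choice.\<close>

fun step :: "nat \<Rightarrow> nat \<Rightarrow> nat list \<Rightarrow> nat list list list \<Rightarrow> nat list list list" where
  "step bnd w col [] = []"
| "step bnd w col (s # S) =
    (let T = ins bnd s (step bnd w col S) in
     if list_all2 (\<le>) (vscale w (tl col)) (hd s)
     then ins bnd (vminus (hd s) (vscale w (tl col)) # (w # col) # tl s) T else T)"

lemma length_ins: "length S \<le> length (ins bnd s S)" "length (ins bnd s S) \<le> length S + 1"
  by (auto simp: ins_def)

text \<open>The result only grows while it is built, so in \<open>calls_step\<close> a bound on its
  final length covers all intermediate lists.\<close>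

lemma length_step_Cons: "length (ins bnd s (step bnd w col S)) \<le> length (step bnd w col (s # S))"
  using length_ins by (auto simp: Let_def)

lemma set_ins: "set (ins bnd s S) \<subseteq> insert s (set S)"
  by (auto simp: ins_def)

lemma hd_ins: "hd ` set (ins bnd s S) = hd ` set S \<union> (if sum_list (hd s) \<le> bnd then {hd s} else {})"
  by (auto simp: ins_def)

lemma step_cases:
  assumes "x \<in> set (step bnd w col S)"
  obtains "x \<in> set S" | s where "s \<in> set S" "list_all2 (\<le>) (vscale w (tl col)) (hd s)"
    "x = vminus (hd s) (vscale w (tl col)) # (w # col) # tl s"
  using assms by (induction S) (auto simp: Let_def dest!: set_ins[THEN subsetD] split: if_splits)

lemma sum_hd_step: "s \<in> set (step bnd w col S) \<Longrightarrow> sum_list (hd s) \<le> bnd"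
  by (induction S) (auto simp: Let_def ins_def split: if_splits)

lemma distinct_hd_step: "distinct (map hd (step bnd w col S))"
  by (induction S) (auto simp: Let_def ins_def)

text \<open>Stated for residuals, since the state itself may be dropped in favour of one with the
  same residual and another history.\<close>

lemma hd_step1:
  "\<lbrakk>s \<in> set S; sum_list (hd s) \<le> bnd\<rbrakk> \<Longrightarrow> hd s \<in> hd ` set (step bnd w col S)"
  by (induction S) (auto simp: Let_def hd_ins)

lemma hd_step2:
  "\<lbrakk>s \<in> set S; list_all2 (\<le>) (vscale w (tl col)) (hd s);
    sum_list (vminus (hd s) (vscale w (tl col))) \<le> bnd\<rbrakk> \<Longrightarrow>
   vminus (hd s) (vscale w (tl col)) \<in> hd ` set (step bnd w col S)"
  by (induction S) (auto simp: Let_def hd_ins)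

definition wf_states :: "nat \<Rightarrow> nat list list list \<Rightarrow> bool" where
  "wf_states R S \<longleftrightarrow> (\<forall>s \<in> set S. s \<noteq> [] \<and> length (hd s) = R)"

lemma wf_step: "\<lbrakk>wf_states R S; length (tl col) = R\<rbrakk> \<Longrightarrow> wf_states R (step bnd w col S)"
  unfolding wf_states_def by (auto elim!: step_cases)

lemma wf_ins: "\<lbrakk>wf_states R S; s \<noteq> []; length (hd s) = R\<rbrakk> \<Longrightarrow> wf_states R (ins bnd s S)"
  using set_ins[of bnd s S] unfolding wf_states_def by blast

lemma calls_step:
  assumes v: "length v = R" "sum_list v \<le> V"
  shows "\<lbrakk>wf_states R S; length (step bnd w (i # v) S) \<le> Y\<rbrakk> \<Longrightarrow>
    pcalls Q f_step (Num bnd \<parallel> Num w \<parallel> eN (i # v) \<parallel> eNNN S) (eNNN (step bnd w (i # v) S))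
      ((length S + 1) * (700 * ((R + 1) * (Y + 1) * (V + 1))))"
proof (induction S)
  case Nil show ?case by (simp add: calls_def e_step_def)
next
  case (Cons s S)
  define A where "A = (R + 1) * (Y + 1) * (V + 1)"
  have A: "R + 1 \<le> A" "V + R + 1 \<le> A" "(R + 1) * (Y + 1) \<le> A" "1 \<le> A"
    by (auto simp: A_def algebra_simps)
  obtain r es where s: "s = r # es" "length r = R"
    using Cons.prems(1) by (cases s) (auto simp: wf_states_def)
  let ?c = "i # v"
  let ?U = "step bnd w ?c S" and ?T = "ins bnd s (step bnd w ?c S)"
  let ?sc = "vscale w v"
  have S: "wf_states R S" using Cons.prems(1) by (simp add: wf_states_def)
  have wf0: "wf_states R ?U" by (rule wf_step[OF S]) (simp add: v)
  have wf1: "wf_states R ?T" by (rule wf_ins[OF wf0]) (simp_all add: s)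
  have l1: "length ?T \<le> Y" using length_step_Cons[of bnd s w ?c S] Cons.prems(2) by linarith
  have l0: "length ?U \<le> Y" using l1 length_ins(1)[of ?U bnd s] by linarith
  have IH: "pcalls Q f_step (Num bnd \<parallel> Num w \<parallel> (Num i \<parallel> eN v) \<parallel> eNNN S) (eNNN ?U)
      ((length S + 1) * (700 * A))"
    using Cons.IH[OF S l0] by (simp add: A_def)
  have ins: "pcalls Q f_ins (Num bnd \<parallel> (eN r' \<parallel> eNN es') \<parallel> eNNN T) (eNNN (ins bnd (r' # es') T))
      (200 * A)" if "wf_states R T" "length r' = R" "length T \<le> Y" for r' es' T
  proof (rule calls_mono[OF calls_ins])
    show "\<forall>s\<in>set T. s \<noteq> [] \<and> length (hd s) = length r'"
      using that by (simp add: wf_states_def)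
    have "(R + 1) * (length T + 1) \<le> (R + 1) * (Y + 1)" using that(3) by (intro mult_le_mono2) simp
    then have "(R + 1) * (length T + 1) \<le> A" using A(3) by (rule order_trans)
    then show "200 * (length r' + 1) * (length T + 1) \<le> 200 * A"
      by (simp only: that(2) mult.assoc)
  qed
  note ins0 = ins[OF wf0 s(2) l0, of es, folded s(1)]
  have scale: "pcalls Q f_scale (Num w \<parallel> eN v) (eN ?sc) (50 * A)"
    by (rule calls_mono[OF calls_scale]) (use A v in simp)
  have leq: "pcalls Q f_leq (eN ?sc \<parallel> eN r) (Num (of_bool (list_all2 (\<le>) ?sc r))) (30 * A)"
    by (rule calls_mono[OF calls_leq]) (use A v s in simp_all)
  have sub: "pcalls Q f_sub (eN r \<parallel> eN ?sc) (eN (vminus r ?sc)) (30 * A)"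
    by (rule calls_mono[OF calls_sub]) (use A v s in simp_all)
  show ?case
    unfolding A_def[symmetric]
  proof (cases "list_all2 (\<le>) ?sc r")
    case True
    have ins1: "pcalls Q f_ins (Num bnd \<parallel> (eN (vminus r ?sc) \<parallel> (Num w \<parallel> Num i \<parallel> eN v) \<parallel> eNN es) \<parallel> eNNN ?T)
        (eNNN (ins bnd (vminus r ?sc # (w # ?c) # es) ?T)) (200 * A)"
      using ins[OF wf1 _ l1, of "vminus r ?sc" "(w # ?c) # es"] v s by simp
    show "pcalls Q f_step (Num bnd \<parallel> Num w \<parallel> eN (i # v) \<parallel> eNNN (s # S))
       (eNNN (step bnd w (i # v) (s # S))) ((length (s # S) + 1) * (700 * A))"
      apply (simp add: calls_def e_step_def del: step.simps(2))
      apply (rule wp_callI[OF IH])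
      apply (subst s(1))
      apply (simp del: step.simps(2))
      apply (rule wp_callI[OF ins0])
      apply (rule wp_callI[OF scale])
      apply (simp add: s del: step.simps(2))
      apply (rule wp_callI[OF leq])
      apply (simp add: True del: step.simps(2))
      apply (rule wp_callI[OF sub])
      apply (rule wp_callI[OF ins1[unfolded s]])
      using A True apply (simp add: Let_def)
      done
  next
    case False
    show "pcalls Q f_step (Num bnd \<parallel> Num w \<parallel> eN (i # v) \<parallel> eNNN (s # S))
       (eNNN (step bnd w (i # v) (s # S))) ((length (s # S) + 1) * (700 * A))"
      apply (simp add: calls_def e_step_def del: step.simps(2))
      apply (rule wp_callI[OF IH])
      apply (subst s(1))
      apply (simp del: step.simps(2))
      apply (rule wp_callI[OF ins0])
      apply (rule wp_callI[OF scale])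
      apply (simp add: s del: step.simps(2))
      apply (rule wp_callI[OF leq])
      using A False apply (simp add: Let_def)
      done
  qed
qed

text \<open>The bound \<open>Y\<close> is assumed after every prefix of the columns: the cost of a
  step depends on the lists before and after it, and a list may shrink again within a level.\<close>

lemma calls_level:
  "\<lbrakk>\<forall>c \<in> set cols. length c = Suc R \<and> sum_list c \<le> V; wf_states R S;
    \<forall>k \<le> length cols. length (fold (step bnd w) (take k cols) S) \<le> Y\<rbrakk> \<Longrightarrow>
   pcalls Q f_level (Num bnd \<parallel> Num w \<parallel> eNN cols \<parallel> eNNN S) (eNNN (fold (step bnd w) cols S))
     ((length cols + 1) * (800 * ((Y + 1) * ((R + 1) * (Y + 1) * (V + 1)))))"
proof (induction cols arbitrary: S)
  case Nil
  have "17 \<le> 800 * ((Y + 1) * ((R + 1) * (Y + 1) * (V + 1)))" by simp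
  then show ?case by (simp add: calls_def e_level_def del: mult_Suc mult_Suc_right)
next
  case (Cons c cols)
  obtain i v where c: "c = i # v" "length v = R" "sum_list v \<le> V"
    using Cons.prems(1) by (cases c) auto
  let ?S = "step bnd w c S"
  define A where "A = (R + 1) * (Y + 1) * (V + 1)"
  define D where "D = (Y + 1) * A"
  have "1 \<le> D" by (simp add: D_def A_def)
  have Y: "length S \<le> Y" "length ?S \<le> Y"
    using Cons.prems(3)[rule_format, of 0] Cons.prems(3)[rule_format, of 1] by auto
  have IH: "pcalls Q f_level (Num bnd \<parallel> Num w \<parallel> eNN cols \<parallel> eNNN ?S)
      (eNNN (fold (step bnd w) cols ?S)) ((length cols + 1) * (800 * D))"
    unfolding D_def A_def
  proof (rule Cons.IH)
    show "wf_states R ?S" using wf_step[OF Cons.prems(2), of c] c by simp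
    show "\<forall>k\<le>length cols. length (fold (step bnd w) (take k cols) ?S) \<le> Y"
    proof (intro allI impI)
      fix k assume "k \<le> length cols"
      then show "length (fold (step bnd w) (take k cols) ?S) \<le> Y"
        using Cons.prems(3)[rule_format, of "Suc k"] by simp
    qed
  qed (use Cons.prems(1) in simp)
  have st: "pcalls Q f_step (Num bnd \<parallel> Num w \<parallel> eN c \<parallel> eNNN S) (eNNN ?S) (700 * D)"
  proof (rule calls_mono)
    show "pcalls Q f_step (Num bnd \<parallel> Num w \<parallel> eN c \<parallel> eNNN S) (eNNN ?S) ((length S + 1) * (700 * A))"
      using calls_step[OF c(2,3) Cons.prems(2), of bnd w i Y Q] Y(2) by (simp add: c(1) A_def)
    have "(length S + 1) * A \<le> (Y + 1) * A" using Y by (intro mult_le_mono1) simp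
    then show "(length S + 1) * (700 * A) \<le> 700 * D" by (simp add: D_def)
  qed
  show ?case
    unfolding A_def[symmetric] D_def[symmetric]
    apply (simp add: calls_def e_level_def)
    apply (rule wp_callI[OF st])
    apply (rule wp_callI[OF IH])
    using \<open>1 \<le> D\<close> apply simp
    done
qed

text \<open>The recursion of \<open>e_dp\<close> with the number of levels as its argument, hence
  structural. The level of smallest weight \<open>w\<close> is applied last.\<close>

fun states :: "nat list list \<Rightarrow> nat list \<Rightarrow> nat \<Rightarrow> nat \<Rightarrow> nat \<Rightarrow> nat list list list" where
  "states cols b 0 w bnd = [[b]]"
| "states cols b (Suc l) w bnd = fold (step bnd w) cols (states cols b l (2 * w) (2 * bnd))"

lemma wf_fold_step:
  "\<lbrakk>wf_states R S; \<forall>c \<in> set cols. length (tl c) = R\<rbrakk> \<Longrightarrow> wf_states R (fold (step bnd w) cols S)"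
  by (induction cols arbitrary: S) (simp_all add: wf_step del: length_tl)

lemma wf_states_states:
  "\<forall>c \<in> set cols. length (tl c) = length b \<Longrightarrow> wf_states (length b) (states cols b l w bnd)"
proof (induction l arbitrary: w bnd)
  case 0 then show ?case by (simp add: wf_states_def)
next
  case (Suc l) then show ?case by (simp add: wf_fold_step del: length_tl)
qed

text \<open>The number \<open>l\<close> of levels is the number of doublings until the weight
  exceeds \<open>K\<close>. It stays existential: later arguments use only that
  \<open>2 ^ l * w\<close> exceeds \<open>K\<close> and that \<open>l \<le> s\<close>.\<close>

lemma calls_dp:
  assumes cols: "\<forall>c \<in> set cols. length c = Suc (length b) \<and> sum_list c \<le> V"
    and Y: "\<And>l w k. w > 0 \<Longrightarrow>
      length (fold (step (2 * w * M) w) (take k cols) (states cols b l (2 * w) (4 * w * M))) \<le> Y"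
  shows "\<lbrakk>K < 2 ^ s * w; w > 0\<rbrakk> \<Longrightarrow> \<exists>l \<le> s. K < 2 ^ l * w \<and>
    pcalls Q f_dp (Num K \<parallel> Num w \<parallel> Num (2 * w * M) \<parallel> eNN cols \<parallel> eN b)
      (eNNN (states cols b l w (2 * w * M)))
      ((s + 1) * ((length cols + 1) * (900 * ((Y + 1) * ((length b + 1) * (Y + 1) * (V + 1))))))"
proof (induction s arbitrary: w)
  case 0
  have "pcalls Q f_dp (Num K \<parallel> Num w \<parallel> Num (2 * w * M) \<parallel> eNN cols \<parallel> eN b) (eNNN [[b]]) 100"
    using 0 by (simp add: calls_def e_dp_def)
  then show ?case using 0
    by (intro exI[of _ 0]) (auto elim!: calls_mono)
next
  case (Suc s)
  define D where "D = (length cols + 1) * ((Y + 1) * ((length b + 1) * (Y + 1) * (V + 1)))"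
  have D: "1 \<le> D" by (simp add: D_def)
  have eq: "(length cols + 1) * (n * ((Y + 1) * ((length b + 1) * (Y + 1) * (V + 1)))) = n * D" for n
    unfolding D_def by (simp only: mult.left_commute)
  show ?case
  proof (cases "K < w")
    case True
    then have "pcalls Q f_dp (Num K \<parallel> Num w \<parallel> Num (2 * w * M) \<parallel> eNN cols \<parallel> eN b) (eNNN [[b]]) 100"
      by (simp add: calls_def e_dp_def)
    then show ?thesis using True
      unfolding eq by (intro exI[of _ 0]) (use D in \<open>auto elim!: calls_mono\<close>)
  next
    case False
    obtain l where l: "K < 2 ^ l * (2 * w)"
      "pcalls Q f_dp (Num K \<parallel> Num (2 * w) \<parallel> Num (2 * (2 * w) * M) \<parallel> eNN cols \<parallel> eN b)
        (eNNN (states cols b l (2 * w) (2 * (2 * w) * M))) ((s + 1) * (900 * D))" "l \<le> s"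
      using Suc.IH[of "2 * w"] Suc.prems unfolding eq by (auto simp: mult_ac)
    let ?S = "states cols b l (2 * w) (2 * (2 * w) * M)"
    have lv: "pcalls Q f_level (Num (2 * w * M) \<parallel> Num w \<parallel> eNN cols \<parallel> eNNN ?S)
        (eNNN (fold (step (2 * w * M) w) cols ?S)) (800 * D)"
      unfolding eq[symmetric]
    proof (rule calls_level[OF cols])
      show "wf_states (length b) ?S" by (rule wf_states_states) (use cols in auto)
      show "\<forall>k\<le>length cols. length (fold (step (2 * w * M) w) (take k cols) ?S) \<le> Y"
        using Y[OF Suc.prems(2)] by (simp add: mult_ac)
    qed
    define w2 where "w2 = 2 * w"
    define B where "B = 2 * w * M"
    define B2 where "B2 = 2 * w2 * M"
    have w2: "w + w = w2" "B + B = B2" by (simp_all add: w2_def B_def B2_def)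
    have st: "states cols b (Suc l) w B = fold (step B w) cols (states cols b l w2 B2)"
      by (simp add: w2_def B_def B2_def mult_ac)
    have "pcalls Q f_dp (Num K \<parallel> Num w \<parallel> Num B \<parallel> eNN cols \<parallel> eN b)
        (eNNN (states cols b (Suc l) w B)) ((Suc s + 1) * (900 * D))"
      unfolding st
      apply (simp add: calls_def e_dp_def w2)
      using False apply simp
      apply (rule wp_callI[OF l(2)[folded w2_def, folded B2_def]])
      apply (rule wp_callI[OF lv[folded B_def, folded w2_def, folded B2_def]])
      using D apply simp
      done
    moreover have "K < 2 ^ Suc l * w" using l(1) by (simp add: mult_ac)
    ultimately show ?thesis unfolding eq B_def using l(3) Suc_le_mono by blast
  qed
qed

text \<open>In a history entry \<open>w' # i # v\<close>, row \<open>j\<close> stands at position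
  \<open>j + 2\<close>, behind the weight and the kind. That all weights are multiples of
  \<open>w\<close> makes the residual congruent to \<open>b\<close> modulo \<open>w\<close>; that
  residual and choices add up to \<open>b\<close> makes residual 0 a solution.\<close>

definition good :: "nat list list \<Rightarrow> nat list \<Rightarrow> nat \<Rightarrow> nat list list \<Rightarrow> bool" where
  "good cols b w s \<longleftrightarrow> (\<exists>r es. s = r # es \<and> length r = length b \<and>
     (\<forall>e \<in> set es. \<exists>c \<in> set cols. \<exists>q > 0. e = (w * q) # c) \<and>
     (\<forall>j < length b. r ! j + (\<Sum>e \<leftarrow> es. hd e * e ! (j + 2)) = b ! j))"

lemma good_init: "good cols b w [b]"
  by (simp add: good_def)

text \<open>Lets the states of the level of weight \<open>2 * w\<close> enter the next
  level.\<close>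

lemma good_double: "good cols b (2 * w) s \<Longrightarrow> good cols b w s"
  unfolding good_def
proof (elim exE conjE, intro exI conjI)
  fix r es
  assume *: "\<forall>e\<in>set es. \<exists>c\<in>set cols. \<exists>q>0. e = (2 * w * q) # c"
  show "\<forall>e\<in>set es. \<exists>c\<in>set cols. \<exists>q>0. e = (w * q) # c"
  proof
    fix e assume "e \<in> set es"
    with * obtain c q where "c \<in> set cols" "q > 0" "e = (w * (2 * q)) # c"
      by (metis mult.assoc mult.commute)
    then show "\<exists>c\<in>set cols. \<exists>q>0. e = (w * q) # c"
      by (metis mult_pos_pos pos2)
  qed
qed

lemma good_step:
  assumes "\<forall>s \<in> set S. good cols b w s" "c \<in> set cols" "length c = Suc (length b)" "w > 0"
    and "s \<in> set (step bnd w c S)"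
  shows "good cols b w s"
  using assms(5)
proof (cases rule: step_cases)
  case 1
  then show ?thesis using assms by blast
next
  case (2 s')
  obtain r es where s': "s' = r # es" "length r = length b"
    "\<forall>e \<in> set es. \<exists>c \<in> set cols. \<exists>q > 0. e = (w * q) # c"
    "\<forall>j < length b. r ! j + (\<Sum>e \<leftarrow> es. hd e * e ! (j + 2)) = b ! j"
    using assms(1) 2(1) by (auto simp: good_def)
  have r: "vminus r (vscale w (tl c)) ! j + w * c ! (j + 1) = r ! j" if "j < length b" for j
  proof -
    have "vscale w (tl c) ! j \<le> r ! j"
      using 2(2) that s' by (auto simp: list_all2_conv_all_nth)
    then show ?thesis
      using that assms(3) s'(2) by (simp add: vscale_def vminus_def nth_tl)
  qed
  have sum: "vminus r (vscale w (tl c)) ! j + (w * c ! (j + 1) + (\<Sum>e \<leftarrow> es. hd e * e ! (j + 2))) = b ! j"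
    if "j < length b" for j
    using r[OF that] s'(4)[rule_format, OF that] by linarith
  have "\<forall>e \<in> set ((w # c) # es). \<exists>c \<in> set cols. \<exists>q > 0. e = (w * q) # c"
  proof
    fix e assume "e \<in> set ((w # c) # es)"
    then consider "e = (w * 1) # c" | "e \<in> set es" by auto
    then show "\<exists>c \<in> set cols. \<exists>q > 0. e = (w * q) # c"
      using s'(3) assms(2) by cases (blast intro: zero_less_one)+
  qed
  moreover have "s = vminus r (vscale w (tl c)) # (w # c) # es" using 2(3) s'(1) by simp
  moreover have "length (vminus r (vscale w (tl c))) = length b" using s'(2) assms(3) by simp
  moreover have "\<forall>j < length b. vminus r (vscale w (tl c)) ! j +
      (\<Sum>e \<leftarrow> (w # c) # es. hd e * e ! (j + 2)) = b ! j"
    using sum by simp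
  ultimately show ?thesis unfolding good_def by blast
qed

lemma dvd_sum_list: "(\<And>x. x \<in> set xs \<Longrightarrow> (d :: nat) dvd f x) \<Longrightarrow> d dvd sum_list (map f xs)"
  by (induction xs) auto

text \<open>All residual vectors are congruent to \<open>b\<close> modulo \<open>w\<close> and their entries are at most
  \<open>2wM\<close>, so they are determined by their entries divided by \<open>w\<close>.\<close>

lemma length_good_le:
  assumes good: "\<forall>s \<in> set S. good cols b w s" and sum: "\<forall>s \<in> set S. sum_list (hd s) \<le> 2 * w * M"
    and "distinct (map hd S)" and w: "w > 0"
  shows "length S \<le> (2 * M + 1) ^ length b"
proof -
  let ?H = "hd ` set S" and ?f = "map (\<lambda>x. x div w)"
  let ?B = "{xs. set xs \<subseteq> {0..2 * M} \<and> length xs = length b}"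
  have mod: "length r = length b \<and> (\<forall>j < length b. r ! j mod w = b ! j mod w)" if r: "r \<in> ?H" for r
  proof -
    obtain es where es: "good cols b w (r # es)"
      using r good by (auto simp: good_def) 
    have "r ! j mod w = b ! j mod w" if j: "j < length b" for j
    proof -
      have "w dvd (\<Sum>e \<leftarrow> es. hd e * e ! (j + 2))"
        using es by (intro dvd_sum_list) (fastforce simp: good_def)
      then obtain q where "(\<Sum>e \<leftarrow> es. hd e * e ! (j + 2)) = w * q" by (rule dvdE)
      moreover have "r ! j + (\<Sum>e \<leftarrow> es. hd e * e ! (j + 2)) = b ! j"
        using es j by (simp add: good_def)
      ultimately have "b ! j = r ! j + w * q" by simp
      then show ?thesis by simp
    qed
    then show ?thesis using es by (auto simp: good_def)
  qed
  have inj: "inj_on ?f ?H"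
  proof (rule inj_onI)
    fix r r' assume r: "r \<in> ?H" "r' \<in> ?H" and eq: "?f r = ?f r'"
    show "r = r'"
    proof (rule nth_equalityI)
      show len: "length r = length r'" using mod r by simp
      fix j assume j: "j < length r"
      have "?f r ! j = ?f r' ! j" using eq by simp
      then have "r ! j div w = r' ! j div w" using j len by simp
      moreover have "r ! j mod w = r' ! j mod w" using mod[OF r(1)] mod[OF r(2)] j by simp
      ultimately show "r ! j = r' ! j" by (metis div_mult_mod_eq)
    qed
  qed
  have sub: "?f ` ?H \<subseteq> ?B"
  proof
    fix xs assume "xs \<in> ?f ` ?H"
    then obtain r where r: "r \<in> ?H" "xs = ?f r" by blast
    have "x div w \<le> 2 * M" if "x \<in> set r" for x
    proof -
      have "x \<le> sum_list r" using that by (auto intro: member_le_sum_list)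
      also have "\<dots> \<le> w * (2 * M)" using sum r by (auto simp: mult_ac)
      finally have "x div w \<le> w * (2 * M) div w" by (rule div_le_mono)
      then show ?thesis using w by simp
    qed
    then show "xs \<in> ?B" using mod r by auto
  qed
  have B: "finite ?B" "card ?B = (2 * M + 1) ^ length b"
    using finite_lists_length_eq[of "{0..2 * M}"] card_lists_length_eq[of "{0..2 * M}"] by simp_all
  have "card ?H \<le> (2 * M + 1) ^ length b"
    using card_mono[OF B(1) sub] card_image[OF inj] B(2) by simp
  moreover have "card ?H = length S"
    using assms(3) distinct_card[of "map hd S"] by simp
  ultimately show ?thesis by simp
qed

lemma good_fold_step:
  assumes "\<forall>s \<in> set S. good cols b w s" "set cs \<subseteq> set cols"
    "\<forall>c \<in> set cols. length c = Suc (length b)" "w > 0"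
  shows "\<forall>s \<in> set (fold (step bnd w) cs S). good cols b w s"
  using assms(1,2)
proof (induction cs arbitrary: S)
  case (Cons c cs)
  show ?case
    unfolding fold_simps
    by (rule Cons.IH) (use Cons.prems good_step[of S cols b w c] assms(3,4) in auto)
qed simp

lemma good_states:
  assumes "\<forall>c \<in> set cols. length c = Suc (length b)"
  shows "w > 0 \<Longrightarrow> \<forall>s \<in> set (states cols b l w bnd). good cols b w s"
proof (induction l arbitrary: w bnd)
  case 0 show ?case by (simp add: good_init)
next
  case (Suc l)
  then have "\<forall>s \<in> set (states cols b l (2 * w) (2 * bnd)). good cols b w s"
    by (auto intro: good_double)
  from good_fold_step[OF this subset_refl assms Suc.prems] show ?case by simp
qed

lemma length_fold_step_le:
  assumes cols: "\<forall>c \<in> set cols. length c = Suc (length b)" and "w > 0"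
    and "\<forall>s \<in> set S. good cols b w s" "length S \<le> (2 * M + 1) ^ length b"
  shows "length (fold (step (2 * w * M) w) (take k cols) S) \<le> (2 * M + 1) ^ length b"
\<comment> \<open>Only the last step matters: each step discards large residuals and duplicates, so
  its output satisfies \<open>length_good_le\<close> on its own. For the empty prefix the bound is
  inherited from the level above.\<close>
proof (cases "take k cols" rule: rev_cases)
  case Nil
  show ?thesis unfolding Nil using assms(4) by simp
next
  case (snoc cs c)
  let ?T = "fold (step (2 * w * M) w) (take k cols) S"
  have T: "?T = step (2 * w * M) w c (fold (step (2 * w * M) w) cs S)" by (simp add: snoc)
  show ?thesis
  proof (rule length_good_le)
    show "\<forall>s \<in> set ?T. good cols b w s"
      using set_take_subset by (intro good_fold_step[OF assms(3) _ cols \<open>w > 0\<close>])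
    show "\<forall>s\<in>set ?T. sum_list (hd s) \<le> 2 * w * M" unfolding T using sum_hd_step by blast
    show "distinct (map hd ?T)" unfolding T by (rule distinct_hd_step)
  qed fact
qed

lemma length_states_le:
  assumes "\<forall>c \<in> set cols. length c = Suc (length b)"
  shows "w > 0 \<Longrightarrow> length (states cols b l w (2 * w * M)) \<le> (2 * M + 1) ^ length b"
proof (induction l arbitrary: w)
  case (Suc l)
  let ?S = "states cols b l (2 * w) (2 * (2 * w) * M)"
  have "length (fold (step (2 * w * M) w) (take (length cols) cols) ?S) \<le> (2 * M + 1) ^ length b"
  proof (rule length_fold_step_le[OF assms Suc.prems])
    show "\<forall>s \<in> set ?S. good cols b w s"
      using good_states[OF assms, of "2 * w"] Suc.prems by (auto intro: good_double)
    show "length ?S \<le> (2 * M + 1) ^ length b"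
      by (rule Suc.IH) (use Suc.prems in simp)
  qed
  then show ?case by (simp add: mult_ac)
qed simp

section \<open>Completeness of the dynamic program\<close>

definition lincomb :: "nat list \<Rightarrow> nat list list \<Rightarrow> nat \<Rightarrow> nat" where
  "lincomb xs cols j = sum_list (map2 (\<lambda>x c. x * c ! (j + 1)) xs cols)"

lemma lincomb_simps [simp]:
  "lincomb [] [] j = 0"
  "lincomb (x # xs) (c # cols) j = x * c ! (j + 1) + lincomb xs cols j"
  by (simp_all add: lincomb_def)

text \<open>Within a level, the digit of weight \<open>w\<close> has been removed from the multiplicities of the
  columns already treated, whose contribution is \<open>r\<close>.\<close>

lemma fold_step_complete:
  assumes "length xs = length cols" "\<forall>c \<in> set cols. length c = Suc R" "w > 0"
    and "s \<in> set S" "length (hd s) = R"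
    and "\<forall>j < R. hd s ! j = r j + lincomb (map (\<lambda>x. x mod (2 * w)) xs) cols j"
    and "(\<Sum>j<R. r j + lincomb (map (\<lambda>x. x mod (2 * w)) xs) cols j) \<le> bnd"
  shows "\<exists>s \<in> set (fold (step bnd w) cols S). length (hd s) = R \<and>
    (\<forall>j < R. hd s ! j = r j + lincomb (map (\<lambda>x. x mod w) xs) cols j)"
  using assms
proof (induction xs cols arbitrary: S s r rule: list_induct2)
  case Nil
  then show ?case by auto
next
  case (Cons x xs c cols)
  let ?y = "x mod (2 * w)" and ?z = "x mod w"
  let ?L = "lincomb (map (\<lambda>x. x mod (2 * w)) xs) cols"
  \<comment> \<open>This column leaves the untreated ones with multiplicity \<open>x mod w\<close>,
    and its contribution moves into \<open>r\<close>.\<close>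
  define r' where "r' j = r j + ?z * c ! (j + 1)" for j
  have c: "length c = Suc R" using Cons.prems by simp
  have yz: "?y = ?z \<or> ?y = ?z + w"
  proof -
    have "?y = w * (x div w mod 2) + ?z" by (simp add: mod_mult2_eq mult.commute[of 2 w])
    moreover have "x div w mod 2 = 0 \<or> x div w mod 2 = 1" by auto
    ultimately show ?thesis by auto
  qed
  \<comment> \<open>Removing a digit never increases the residual, so the bound valid at the start
    of the level persists through it.\<close>
  have le: "r' j + ?L j \<le> r j + lincomb (map (\<lambda>x. x mod (2 * w)) (x # xs)) (c # cols) j" for j
    using yz by (auto simp: r'_def algebra_simps)
  have "\<exists>s' \<in> set (step bnd w c S). length (hd s') = R \<and> (\<forall>j < R. hd s' ! j = r' j + ?L j)"
    using yz
  proof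
    assume y: "?y = ?z"
    have hd: "\<forall>j < R. hd s ! j = r' j + ?L j" using Cons.prems(5) y by (simp add: r'_def add_ac)
    have "sum_list (hd s) = (\<Sum>j<R. hd s ! j)"
      using Cons.prems(4) by (simp add: sum_list_sum_nth atLeast0LessThan)
    also have "\<dots> \<le> bnd" using Cons.prems(5,6) by simp
    finally have "hd s \<in> hd ` set (step bnd w c S)" by (rule hd_step1[OF Cons.prems(3)])
    then obtain s' where "s' \<in> set (step bnd w c S)" "hd s' = hd s" by auto
    then show ?thesis using hd Cons.prems(4) by metis
  next
    assume y: "?y = ?z + w"
    let ?v = "vscale w (tl c)"
    have v: "?v ! j = w * c ! (j + 1)" if "j < R" for j
      using that c by (simp add: vscale_def nth_tl)
    have hd: "hd s ! j = w * c ! (j + 1) + (r' j + ?L j)" if "j < R" for j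
      using Cons.prems(5) that unfolding list.map(2) lincomb_simps(2) y by (simp add: r'_def algebra_simps)
    have all: "list_all2 (\<le>) ?v (hd s)"
      using Cons.prems(4) c hd v by (simp add: list_all2_conv_all_nth)
    have m: "vminus (hd s) ?v ! j = r' j + ?L j" if "j < R" for j
      using that hd[OF that] v[OF that] Cons.prems(4) c by (simp add: vminus_def)
    have len: "length (vminus (hd s) ?v) = R" using Cons.prems(4) c by simp
    have "sum_list (vminus (hd s) ?v) = (\<Sum>j<R. r' j + ?L j)"
      using len m by (simp add: sum_list_sum_nth atLeast0LessThan del: length_vminus)
    also have "\<dots> \<le> (\<Sum>j<R. r j + lincomb (map (\<lambda>x. x mod (2 * w)) (x # xs)) (c # cols) j)"
      by (rule sum_mono) (rule le)
    also have "\<dots> \<le> bnd" using Cons.prems(6) .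
    finally have "vminus (hd s) ?v \<in> hd ` set (step bnd w c S)"
      by (rule hd_step2[OF Cons.prems(3) all])
    then obtain s' where "s' \<in> set (step bnd w c S)" "hd s' = vminus (hd s) ?v" by auto
    then show ?thesis using m len by metis
  qed
  then obtain s' where s': "s' \<in> set (step bnd w c S)" "length (hd s') = R"
    "\<forall>j < R. hd s' ! j = r' j + ?L j" by blast
  have "(\<Sum>j<R. r' j + ?L j) \<le> bnd"
    using sum_mono[of "{..<R}", OF le] Cons.prems(6) by (rule order_trans)
  from Cons.IH[OF _ Cons.prems(2) s' this] Cons.prems(1) show ?case
    by (simp add: r'_def add_ac)
qed

lemma lincomb_sum_le:
  assumes "length xs = length cols" "\<forall>c \<in> set cols. length c = Suc R" "\<forall>x \<in> set xs. x \<le> B"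
  shows "(\<Sum>j<R. lincomb xs cols j) \<le> B * sum_list (map sum_list cols)"
  using assms
proof (induction xs cols rule: list_induct2)
  case (Cons x xs c cols)
  obtain i v where c: "c = i # v" "length v = R" using Cons.prems by (cases c) auto
  have "(\<Sum>j<R. x * c ! (j + 1)) = x * sum_list v"
    using c by (simp add: sum_distrib_left sum_list_sum_nth atLeast0LessThan)
  also have "\<dots> \<le> B * sum_list c" using Cons.prems c by (intro mult_le_mono) auto
  finally show ?case using Cons by (simp add: sum.distrib algebra_simps)
qed simp

text \<open>For \<open>l = 0\<close> all multiplicities are below \<open>w\<close>, so
  \<open>b\<close> itself is the residual sought. Each level passes from residues modulo
  \<open>2 * w\<close> to residues modulo \<open>w\<close>. The surviving state has the residual
  that \<open>xs\<close> prescribes, but its history need not consist of the digits of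
  \<open>xs\<close>.\<close>

lemma states_complete:
  assumes cols: "\<forall>c \<in> set cols. length c = Suc (length b)" and xs: "length xs = length cols"
    and b: "\<forall>j < length b. b ! j = lincomb xs cols j"
    and M: "M = sum_list (map sum_list cols)"
  shows "\<lbrakk>w > 0; \<forall>x \<in> set xs. x < 2 ^ l * w\<rbrakk> \<Longrightarrow>
    \<exists>s \<in> set (states cols b l w (2 * w * M)). length (hd s) = length b \<and>
      (\<forall>j < length b. hd s ! j = lincomb (map (\<lambda>x. x mod w) xs) cols j)"
proof (induction l arbitrary: w)
  case 0
  then have "map (\<lambda>x. x mod w) xs = xs" by (intro map_idI) auto
  then show ?case using b by simp
next
  case (Suc l)
  then obtain s where s: "s \<in> set (states cols b l (2 * w) (2 * (2 * w) * M))"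
    "length (hd s) = length b"
    "\<forall>j < length b. hd s ! j = lincomb (map (\<lambda>x. x mod (2 * w)) xs) cols j"
    using Suc.IH[of "2 * w"] by (auto simp: mult_ac)
  \<comment> \<open>Origin of the bound \<open>2 * w * M\<close>: at the start of the level the
    multiplicities are residues modulo \<open>2 * w\<close>, and \<open>M\<close> is the sum of all
    column entries.\<close>
  have "(\<Sum>j<length b. 0 + lincomb (map (\<lambda>x. x mod (2 * w)) xs) cols j) \<le> 2 * w * M"
    unfolding M add_0 by (rule lincomb_sum_le) (use xs cols Suc.prems(1) in \<open>auto simp: less_imp_le\<close>)
  from fold_step_complete[OF xs cols Suc.prems(1) s(1,2) _ this] s(3)
  show ?case by (simp add: mult_ac)
qed

text \<open>Residues modulo 1 vanish, so the state obtained at weight 1 has nothing left.\<close>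

lemma states_complete_zero:
  assumes "\<forall>c \<in> set cols. length c = Suc (length b)" "length xs = length cols"
    and "\<forall>j < length b. b ! j = lincomb xs cols j" "\<forall>x \<in> set xs. x < 2 ^ l"
  shows "\<exists>s \<in> set (states cols b l 1 (2 * 1 * sum_list (map sum_list cols))). sum_list (hd s) = 0"
proof -
  obtain s where s: "s \<in> set (states cols b l 1 (2 * 1 * sum_list (map sum_list cols)))"
    "length (hd s) = length b" "\<forall>j < length b. hd s ! j = lincomb (map (\<lambda>x. x mod 1) xs) cols j"
    using states_complete[OF assms(1-3) refl, of 1 l] assms(4) by auto
  have "lincomb (map (\<lambda>x. x mod 1) xs) cols j = 0" for j
    using assms(2) by (induction xs cols rule: list_induct2) auto
  then have "sum_list (hd s) = 0" using s by (simp add: sum_list_sum_nth)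
  then show ?thesis using s(1) by blast
qed

section \<open>Assignment of the items to bins\<close>

fun look :: "nat list \<Rightarrow> nat list list \<Rightarrow> nat list \<Rightarrow> nat" where
  "look t [] v = 0"
| "look t (t' # ts) v = (if t = t' then hd v else look t ts (tl v))"

lemma calls_look:
  "\<lbrakk>\<forall>t' \<in> set ts. length t' = length t; length ts \<le> length v\<rbrakk> \<Longrightarrow>
   pcalls Q f_look (eN t \<parallel> eNN ts \<parallel> eN v) (Num (look t ts v)) (120 * (length t + 1) * (length ts + 1))"
proof (induction ts arbitrary: v)
  case Nil show ?case by (simp add: calls_def e_look_def)
next
  case (Cons t' ts)
  obtain c v' where v: "v = c # v'" using Cons.prems by (cases v) auto
  define A where "A = 120 * (length t + 1) * (length ts + 1)"
  have IH: "pcalls Q f_look (eN t \<parallel> eNN ts \<parallel> eN v') (Num (look t ts v')) A"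
    unfolding A_def using Cons v by simp
  have l: "length t = length t'" using Cons.prems by simp
  have A: "120 * (length t + 1) * (length (t' # ts) + 1) = A + 120 * (length t + 1)"
    by (simp add: A_def)
  show ?case
  proof (cases "t = t'")
    case True
    show ?thesis
      unfolding A
      apply (simp add: calls_def e_look_def v True)
      apply (rule wp_callI[OF calls_eq[OF refl]])
      apply simp
      done
  next
    case False
    then show ?thesis
      unfolding A
      apply (simp add: calls_def e_look_def v)
      apply (rule wp_callI[OF calls_eq[OF l]])
      apply simp
      apply (rule wp_callI[OF IH])
      apply simp
      done
  qed
qed

lemma look_le: "length ts \<le> length v \<Longrightarrow> look t ts v \<le> sum_list v"
proof (induction ts arbitrary: v)
  case (Cons t' ts)
  then obtain c v' where "v = c # v'" by (cases v) auto
  then show ?case using Cons.IH[of v'] Cons.prems by auto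
qed simp

definition offs :: "nat \<Rightarrow> nat list list \<Rightarrow> nat" where
  "offs i es = (\<Sum>e \<leftarrow> es. if e ! 1 = i then hd e else 0)"

text \<open>The length and the sum of \<open>v\<close> bound the costs of looking up a multiplicity
  and of multiplying by it; \<open>w > 0\<close> makes \<open>f_mod\<close> terminate.\<close>

definition entry_ok :: "nat \<Rightarrow> nat \<Rightarrow> nat list \<Rightarrow> bool" where
  "entry_ok k V e \<longleftrightarrow> (\<exists>w i v. e = w # i # v \<and> w > 0 \<and> k \<le> length v \<and> sum_list v \<le> V)"

lemma calls_offs:
  "\<forall>e \<in> set es. entry_ok k V e \<Longrightarrow>
   pcalls Q f_offs (Num i \<parallel> eNN es) (Num (offs i es)) (60 * (length es + 1))"
proof (induction es)
  case Nil show ?case by (simp add: calls_def e_offs_def offs_def)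
next
  case (Cons e es)
  obtain w i' v where e: "e = w # i' # v" using Cons.prems by (auto simp: entry_ok_def)
  have IH: "pcalls Q f_offs (Num i \<parallel> eNN es) (Num (offs i es)) (60 * (length es + 1))"
    using Cons by simp
  show ?case
  proof (cases "i = i'")
    case True
    show ?thesis
      apply (simp add: calls_def e_offs_def e True)
      apply (rule wp_callI[OF IH[unfolded True]])
      apply (simp add: offs_def)
      done
  next
    case False
    then have "i - i' \<noteq> 0 \<or> i' - i \<noteq> 0" by auto
    with False show ?thesis
      apply (simp add: calls_def e_offs_def e)
      apply (intro conjI impI)
       apply (rule wp_callI[OF IH], simp add: offs_def)+
      done
  qed
qed

text \<open>Repeated subtraction is affordable because \<open>q\<close> will be a number of items,
  which the input lists one by one; the weight may be arbitrarily large.\<close>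

lemma calls_mod: "w > 0 \<Longrightarrow> pcalls Q f_mod (Num q \<parallel> Num w) (Num (q mod w)) (30 * (q + 1))"
proof (induction q rule: less_induct)
  case (less q)
  show ?case
  proof (cases "q < w")
    case True
    then show ?thesis by (simp add: calls_def e_mod_def)
  next
    case False
    then have "pcalls Q f_mod (Num (q - w) \<parallel> Num w) (Num ((q - w) mod w)) (30 * (q - w + 1))"
      using less by simp
    note IH = wp_callI[OF this]
    show ?thesis
      using False less.prems
      apply (simp add: calls_def e_mod_def)
      apply (rule IH)
      apply (simp add: le_mod_geq)
      done
  qed
qed

text \<open>The bin of the item of type \<open>t\<close> that is followed by exactly \<open>q\<close> items of type \<open>t\<close>.  A choice
  \<open>w # i # v\<close> receives the \<open>w\<close> bins of kind \<open>i\<close> following those of the later choices of kind \<open>i\<close>, and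
  the residue of \<open>q\<close> modulo \<open>w\<close> spreads the items of type \<open>t\<close> evenly over them.\<close>

fun loc :: "nat list list \<Rightarrow> nat list \<Rightarrow> nat \<Rightarrow> nat list list \<Rightarrow> nat \<times> nat" where
  "loc ts t q [] = (0, 0)"
| "loc ts t q (e # es) =
    (let p = hd e * look t ts (tl (tl e)) in
     if q < p then (e ! 1, offs (e ! 1) es + q mod hd e + 1) else loc ts t (q - p) es)"

abbreviation "eP ij \<equiv> Num (fst ij) \<parallel> Num (snd ij)"

lemma calls_loc:
  assumes ts: "\<forall>t' \<in> set ts. length t' = length t"
  shows "\<forall>e \<in> set es. entry_ok (length ts) V e \<Longrightarrow>
    pcalls Q f_loc (eN t \<parallel> eNN ts \<parallel> Num q \<parallel> eNN es) (eP (loc ts t q es))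
      ((length es + 1) * (300 * ((length t + 1) * (length ts + 1) * (V + 1))) + 30 * (q + 1))"
proof (induction es arbitrary: q)
  case Nil show ?case by (simp add: calls_def e_loc_def)
next
  case (Cons e es)
  define A where "A = (length t + 1) * (length ts + 1) * (V + 1)"
  have A: "(length t + 1) * (length ts + 1) \<le> A" "V + 1 \<le> A" "1 \<le> A"
    by (simp_all add: A_def)
  obtain w i v where e: "e = w # i # v" "w > 0" "length ts \<le> length v" "sum_list v \<le> V"
    using Cons.prems by (auto simp: entry_ok_def)
  have es: "\<forall>e \<in> set es. entry_ok (length ts) V e" using Cons.prems by simp
  let ?c = "look t ts v"
  have lk: "pcalls Q f_look (eN t \<parallel> eNN ts \<parallel> eN v) (Num ?c) (120 * A)"
  proof (rule calls_mono[OF calls_look[OF ts e(3)]])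
    show "120 * (length t + 1) * (length ts + 1) \<le> 120 * A"
      using A(1) by (simp only: mult.assoc)
  qed
  have mul: "pcalls Q (Suc 0) (Num w \<parallel> Num ?c) (Num (w * ?c)) (20 * A)"
    by (rule calls_mono[OF calls_mul]) (use look_le[OF e(3), of t] e(4) A(2) in simp)
  show ?case
    unfolding A_def[symmetric]
  proof (cases "q < w * ?c")
    case True
    show "pcalls Q f_loc (eN t \<parallel> eNN ts \<parallel> Num q \<parallel> eNN (e # es)) (eP (loc ts t q (e # es)))
      ((length (e # es) + 1) * (300 * A) + 30 * (q + 1))"
    proof -
      \<comment> \<open>\<open>f_offs\<close> scans the rest of the history once, when the bin has
        been found, so its cost fits into the allowance for the entries not visited.\<close>
      have sixty: "60 * length es \<le> length es * (300 * A)" using A(3) by simp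
      from A(3) True show ?thesis
        apply (simp add: calls_def e_loc_def e)
        apply (rule wp_callI[OF lk])
        apply (rule wp_callI[OF mul])
        apply (rule exI[of _ "w * ?c"])
        apply simp
        apply (rule wp_callI[OF calls_offs[OF es]])
        apply (rule wp_callI[OF calls_mod[OF e(2)]])
        apply simp
        using sixty apply linarith
        done
    qed
  next
    case False
    have IH: "pcalls Q f_loc (eN t \<parallel> eNN ts \<parallel> Num (q - w * ?c) \<parallel> eNN es) (eP (loc ts t (q - w * ?c) es))
      ((length es + 1) * (300 * A) + 30 * (q - w * ?c + 1))"
      unfolding A_def using Cons.IH[OF es] by blast
    show "pcalls Q f_loc (eN t \<parallel> eNN ts \<parallel> Num q \<parallel> eNN (e # es)) (eP (loc ts t q (e # es)))
      ((length (e # es) + 1) * (300 * A) + 30 * (q + 1))"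
      using False A(3)
      apply (simp add: calls_def e_loc_def e)
      apply (rule wp_callI[OF lk])
      apply (rule wp_callI[OF mul])
      apply (rule exI[of _ "w * ?c"])
      apply simp
      apply (rule wp_callI[OF IH])
      apply simp
      done
  qed
qed

text \<open>Counting the equal items that follow numbers the items of each type 0, 1, ... from the
  end, without a counter for every type.\<close>

fun out :: "nat list list \<Rightarrow> nat list list \<Rightarrow> nat list list \<Rightarrow> (nat \<times> nat) list" where
  "out ts es [] = []"
| "out ts es (t # its) = loc ts t (count_list its t) es # out ts es its"

lemma calls_out:
  assumes ts: "\<forall>t \<in> set ts. length t = D" and es: "\<forall>e \<in> set es. entry_ok (length ts) V e"
  shows "\<lbrakk>\<forall>t \<in> set its. length t = D; length its \<le> n\<rbrakk> \<Longrightarrow>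
    pcalls Q f_out (eNN ts \<parallel> eNN es \<parallel> eNN its) (enc_list (map eP (out ts es its)))
      ((length its + 1) * ((length es + 1) * (300 * ((D + 1) * (length ts + 1) * (V + 1))) +
        200 * ((D + 1) * (n + 1))))"
proof (induction its)
  case Nil show ?case by (simp add: calls_def e_out_def)
next
  case (Cons t its)
  have t: "length t = D" "\<forall>t' \<in> set ts. length t' = length t" "\<forall>y \<in> set its. length y = length t"
    using Cons.prems ts by auto
  define L where "L = (length es + 1) * (300 * ((D + 1) * (length ts + 1) * (V + 1)))"
  define E where "E = (D + 1) * (n + 1)"
  have "(D + 1) * (length its + 1) \<le> E"
    using Cons.prems unfolding E_def by (intro mult_le_mono2) simp
  then have count: "pcalls Q f_count (eN t \<parallel> eNN its) (Num (count_list its t)) (100 * E)"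
    by (intro calls_mono[OF calls_count[OF t(3)]]) (simp only: t(1) mult.assoc)
  have E: "n + 1 \<le> E" by (simp add: E_def)
  have "count_list its t \<le> length its" by (rule count_le_length)
  then have "30 * (count_list its t + 1) \<le> 30 * E" using E Cons.prems(2) by simp
  then have lc: "pcalls Q f_loc (eN t \<parallel> eNN ts \<parallel> Num (count_list its t) \<parallel> eNN es)
      (eP (loc ts t (count_list its t) es)) (L + 30 * E)"
    by (intro calls_mono[OF calls_loc[OF t(2) es]]) (simp add: L_def t(1) del: add_mult_distrib add_mult_distrib2)
  have IH: "pcalls Q f_out (eNN ts \<parallel> eNN es \<parallel> eNN its) (enc_list (map eP (out ts es its)))
      ((length its + 1) * (L + 200 * E))"
    unfolding L_def E_def using Cons by simp
  show ?case
    unfolding L_def[symmetric] E_def[symmetric]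
    using E
    apply (simp add: calls_def e_out_def)
    apply (rule wp_callI[OF count])
    apply (rule wp_callI[OF lc])
    apply (rule wp_callI[OF IH])
    apply simp
    done
qed

fun find_state :: "nat list list \<Rightarrow> nat list list \<Rightarrow> nat list list list \<Rightarrow> val" where
  "find_state ts its [] = Num 0"
| "find_state ts its (s # S) = (if sum_list (hd s) = 0
     then Num 1 \<parallel> enc_list (map eP (out ts (tl s) its)) else find_state ts its S)"

lemma calls_find:
  assumes ts: "\<forall>t \<in> set ts. length t = D" "\<forall>t \<in> set its. length t = D"
  shows "\<lbrakk>wf_states R S;
      \<forall>s \<in> set S. (\<forall>e \<in> set (tl s). entry_ok (length ts) V e) \<and> length (tl s) \<le> h\<rbrakk> \<Longrightarrow>
    pcalls Q f_find (eNNN S \<parallel> eNN ts \<parallel> eNN its) (find_state ts its S)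
      ((length S + 1) * (80 * (R + 1)) +
       (length its + 1) * ((h + 1) * (300 * ((D + 1) * (length ts + 1) * (V + 1))) +
         200 * ((D + 1) * (length its + 1))))"
proof (induction S)
  case Nil show ?case by (simp add: calls_def e_find_def)
next
  case (Cons s S)
  define C where "C = (length its + 1) * ((h + 1) * (300 * ((D + 1) * (length ts + 1) * (V + 1))) +
         200 * ((D + 1) * (length its + 1)))"
  obtain r es where s: "s = r # es" "length r = R" using Cons.prems(1)
    by (cases s) (auto simp: wf_states_def)
  have IH: "pcalls Q f_find (eNNN S \<parallel> eNN ts \<parallel> eNN its) (find_state ts its S)
      ((length S + 1) * (80 * (R + 1)) + C)"
    unfolding C_def using Cons by (simp add: wf_states_def)
  have es: "\<forall>e \<in> set es. entry_ok (length ts) V e" "length es \<le> h" using Cons.prems(2) s by auto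
  have out: "pcalls Q f_out (eNN ts \<parallel> eNN es \<parallel> eNN its) (enc_list (map eP (out ts es its))) C"
    unfolding C_def using es(2)
    by (intro calls_mono[OF calls_out[OF ts(1) es(1) ts(2) order_refl]] mult_le_mono add_mono) simp_all
  show ?case
    unfolding C_def[symmetric]
  proof (cases "sum_list r = 0")
    case True
    show "pcalls Q f_find (eNNN (s # S) \<parallel> eNN ts \<parallel> eNN its) (find_state ts its (s # S))
      ((length (s # S) + 1) * (80 * (R + 1)) + C)"
      apply (simp add: calls_def e_find_def s(1) True del: sum_list_eq_0_iff)
      apply (rule wp_callI[OF calls_sum])
      apply (simp add: True del: sum_list_eq_0_iff)?
      apply (rule wp_callI[OF out])
      apply (simp add: s(2))
      done
  next
    case False
    show "pcalls Q f_find (eNNN (s # S) \<parallel> eNN ts \<parallel> eNN its) (find_state ts its (s # S))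
      ((length (s # S) + 1) * (80 * (R + 1)) + C)"
      apply (simp add: calls_def e_find_def s(1) False del: sum_list_eq_0_iff)
      apply (rule wp_callI[OF calls_sum])
      apply (simp add: False del: sum_list_eq_0_iff)?
      apply (rule wp_callI[OF IH])
      apply (simp add: s(2))
      done
  qed
qed

section \<open>Length of the histories\<close>

lemma length_history_step:
  "\<forall>s \<in> set S. length (tl s) \<le> h \<Longrightarrow> \<forall>s \<in> set (step bnd w c S). length (tl s) \<le> Suc h"
  by (auto elim!: step_cases intro: le_SucI simp del: length_tl)

lemma length_history_fold:
  "\<forall>s \<in> set S. length (tl s) \<le> h \<Longrightarrow>
   \<forall>s \<in> set (fold (step bnd w) cols S). length (tl s) \<le> h + length cols"
proof (induction cols arbitrary: S h)
  case (Cons c cols)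
  from Cons.IH[OF length_history_step[OF Cons.prems, of bnd w c]] show ?case
    by (simp del: length_tl)
qed simp

text \<open>Each column is recorded at most once per level.\<close>

lemma length_history:
  "\<forall>s \<in> set (states cols b l w bnd). length (tl s) \<le> l * length cols"
proof (induction l arbitrary: w bnd)
  case (Suc l)
  from length_history_fold[OF this, of bnd w cols] show ?case by (simp add: add.commute del: length_tl)
qed simp

section \<open>The running time\<close>

lemma set_columns:
  assumes ts: "\<forall>t \<in> set ts. length t = Suc d"
  shows "\<forall>k \<in> set ks. length k = Suc d \<Longrightarrow> set (columns ok ts n all i ks) =
    {(i + j) # u @ unit_vec (i + j) all | j u. j < length ks \<and> fit u ts (n # tl (ks ! j)) \<and>
      ok (i + j) (u @ unit_vec (i + j) all)}"
proof (induction ks arbitrary: i)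
  case (Cons k ks)
  have b0: "bump 0 u = u" for u by (cases u) auto
  have "set (gen (unit_vec i all) ts 0 (n # tl k)) = {u @ unit_vec i all | u. fit u ts (n # tl k)}"
    using set_gen[of ts "n # tl k"] ts Cons.prems by (auto simp: b0)
  then have "set (columns ok ts n all i (k # ks)) =
      {i # u @ unit_vec i all | u. fit u ts (n # tl k) \<and> ok i (u @ unit_vec i all)} \<union>
      {(Suc i + j) # u @ unit_vec (Suc i + j) all | j u. j < length ks \<and> fit u ts (n # tl (ks ! j)) \<and>
      ok (Suc i + j) (u @ unit_vec (Suc i + j) all)}"
    using Cons by auto
  also have "\<dots> = {(i + j) # u @ unit_vec (i + j) all | j u. j < length (k # ks) \<and>
      fit u ts (n # tl ((k # ks) ! j)) \<and> ok (i + j) (u @ unit_vec (i + j) all)}" (is "?A \<union> ?B = ?C")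
  proof (intro equalityI subsetI)
    fix x assume "x \<in> ?A \<union> ?B"
    then show "x \<in> ?C"
    proof
      assume "x \<in> ?A" then show ?thesis by (auto intro!: exI[of _ 0])
    next
      assume "x \<in> ?B"
      then obtain j u where "x = (Suc i + j) # u @ unit_vec (Suc i + j) all" "j < length ks"
        "fit u ts (n # tl (ks ! j))" "ok (Suc i + j) (u @ unit_vec (Suc i + j) all)" by blast
      then show ?thesis by (auto intro!: exI[of _ "Suc j"])
    qed
  next
    fix x assume "x \<in> ?C"
    then obtain j u where j: "x = (i + j) # u @ unit_vec (i + j) all" "j < length (k # ks)"
      "fit u ts (n # tl ((k # ks) ! j))" "ok (i + j) (u @ unit_vec (i + j) all)" by blast
    then show "x \<in> ?A \<union> ?B"
      by (cases j) auto
  qed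
  finally show ?case .
qed simp

lemma length_columns:
  "(\<And>i k. k \<in> set ks \<Longrightarrow> length (gen (unit_vec i all) ts 0 (n # tl k)) \<le> G) \<Longrightarrow>
   length (columns ok ts n all i ks) \<le> length ks * G"
proof (induction ks arbitrary: i)
  case (Cons k ks)
  have "length (filter (ok i) (gen (unit_vec i all) ts 0 (n # tl k))) \<le> G"
    using length_filter_le Cons.prems[of k i] by (metis list.set_intros(1) order_trans)
  then show ?case using Cons.IH[of "Suc i"] Cons.prems by (simp add: add_mono)
qed simp

lemma sum_unit_vec_le: "sum_list (unit_vec i ks) \<le> 1"
proof -
  have 0: "sum_list (unit_vec 0 ks) = 0" for ks :: "'a list" by (induction ks) auto
  show ?thesis by (induction i ks rule: unit_vec.induct) (auto simp: 0)
qed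

text \<open>Item sizes are nonzero, so every item contributes at least 1 to the load in the true
  dimensions, which are the rows after the first.\<close>

lemma sum_le_sum_load_total:
  "\<lbrakk>length u = length ts; \<forall>t \<in> set ts. length t = Suc d \<and> sum_list (tl t) > 0\<rbrakk> \<Longrightarrow>
   sum_list u \<le> (\<Sum>j<d. load_total u ts (Suc j))"
proof (induction u ts rule: list_induct2)
  case (Cons a u t ts)
  have "(\<Sum>j<d. a * load t ! Suc j) = a * sum_list (tl t)"
    using Cons.prems by (simp add: load_def sum_distrib_left sum_list_sum_nth atLeast0LessThan)
  moreover have "a * 1 \<le> a * sum_list (tl t)" using Cons.prems by (intro mult_le_mono2) auto
  moreover have "(\<Sum>j<d. load_total (a # u) (t # ts) (Suc j)) =
      (\<Sum>j<d. a * load t ! Suc j) + (\<Sum>j<d. load_total u ts (Suc j))"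
    by (simp add: load_total_def sum.distrib)
  moreover have "sum_list u \<le> (\<Sum>j<d. load_total u ts (Suc j))" using Cons by simp
  ultimately show ?case unfolding sum_list.Cons by linarith
qed (simp add: load_total_def)

lemma fit_sum_le:
  assumes "fit u ts (n # cap)" "\<forall>t \<in> set ts. length t = Suc (length cap) \<and> sum_list (tl t) > 0"
  shows "sum_list u \<le> sum_list cap"
proof -
  have "sum_list u \<le> (\<Sum>j<length cap. load_total u ts (Suc j))"
    using assms by (intro sum_le_sum_load_total) (auto simp: fit_def)
  also have "\<dots> \<le> (\<Sum>j<length cap. cap ! j)"
    using assms(1) unfolding fit_def by (intro sum_mono) fastforce
  also have "\<dots> = sum_list cap" by (simp add: sum_list_sum_nth atLeast0LessThan)
  finally show ?thesis .
qed

text \<open>\<open>Z\<close> bounds every quantity that depends on the parameter only. The five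
  factors of \<open>Z ^ 5\<close> come from the dynamic program (columns, states twice, rows, sum of
  a column), \<open>(n + 1) ^ 2\<close> from comparing all pairs of items, \<open>s + 1\<close> from
  the levels, and \<open>Z ^ 2 * B\<close> from fewer than \<open>Z\<close> oracle calls for each of
  fewer than \<open>Z\<close> kinds.\<close>

lemma runs_packing_prog:
  fixes its ks :: "nat list list" and ok :: "nat \<Rightarrow> nat list \<Rightarrow> bool"
  defines "ts \<equiv> remdups its" and "n \<equiv> length its" and "m \<equiv> length ks"
  defines "cols \<equiv> columns ok ts n ks 1 ks" and "b \<equiv> map (count_list its) ts @ map hd ks"
  defines "M \<equiv> sum_list (map sum_list cols)"
  assumes its: "\<forall>t \<in> set its. length t = Suc d \<and> sum_list (tl t) > 0"
    and ks: "\<forall>k \<in> set ks. length k = Suc d"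
    and answers: "\<And>i u. \<lbrakk>1 \<le> i; i \<le> m; length u = length ts; sum_list u \<le> n\<rbrakk> \<Longrightarrow>
      oracle_ok Q F ts ok B i (u @ unit_vec i ks)"
    and Z: "F + d + 2 \<le> Z" "length ts + m + 1 \<le> Z" "length cols + 1 \<le> Z"
      "(2 * M + 1) ^ (length ts + m) + 1 \<le> Z"
      "\<And>i k. k \<in> set ks \<Longrightarrow> length (gen (unit_vec i ks) ts 0 (n # tl k)) + 1 \<le> Z"
      "\<And>c. c \<in> set cols \<Longrightarrow> sum_list c + 1 \<le> Z"
    and s: "sum_list (map hd ks) < 2 ^ s"
  shows "\<exists>l t. sum_list (map hd ks) < 2 ^ l \<and>
    runs packing_prog Q (enc_list [Num F, Num d, Num m, eNN ks, eNN its])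
      (find_state ts its (states cols b l 1 (2 * 1 * M))) t \<and>
    t \<le> 3000 * (Z ^ 5 * (n + 1) ^ 2 * (s + 1)) + Z ^ 2 * B"
proof -
  let ?k = "length ts" and ?K = "sum_list (map hd ks)"
  define Y where "Y = (2 * M + 1) ^ (length ts + m)"
  define V where "V = Z - 1"
  have Z1: "Z \<ge> 1" using Z(1) by simp
  have ts: "\<forall>t \<in> set ts. length t = Suc d \<and> sum_list (tl t) > 0" using its by (simp add: ts_def)
  have R: "length b = ?k + m" by (simp add: b_def m_def)
  have cols: "\<forall>c \<in> set cols. length c = Suc (length b)" "\<forall>c \<in> set cols. c \<noteq> []"
    using set_columns[of ts d ks ok n ks 1] ts ks
    by (auto simp: cols_def R fit_def m_def)
  have V: "sum_list c \<le> V" if "c \<in> set cols" for c using Z(6)[OF that] by (simp add: V_def)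
  have ne: "[] \<notin> set ks" "[] \<notin> set its" using ks its by auto
  define S where "S l = states cols b l 1 (2 * 1 * M)" for l
  define P where "P = Z ^ 5 * (n + 1) ^ 2 * (s + 1)"
  have pow: "Z \<le> Z ^ 5" "Z ^ 2 \<le> Z ^ 5" "Z ^ 4 \<le> Z ^ 5" "Z ^ 3 \<le> Z ^ 5" "1 \<le> Z ^ 5"
    using Z1 power_increasing[of _ 5 Z] power_increasing[of 1 5 Z] by auto
  have p: "x ^ 2 = x * x" "x ^ 4 = x * x * x * x" "x ^ 5 = x * x * x * x * x" for x :: nat
    by (simp_all add: eval_nat_numeral)
  \<comment> \<open>Absorbs any monomial with at most these exponents, so that the costs of all
    subroutines add up as multiples of \<open>P\<close>.\<close>
  have P: "x * (n + 1) ^ i * (s + 1) ^ j \<le> P" if "x \<le> Z ^ 5" "i \<le> 2" "j \<le> 1" for x i j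
    unfolding P_def using that power_increasing[of i 2 "n + 1"] power_increasing[of j 1 "s + 1"]
    by (intro mult_le_mono) auto

  have c_remdups: "pcalls Q f_remdups (eNN its) (eNN ts) (130 * P)"
    unfolding ts_def
  proof (rule calls_mono[OF calls_remdups])
    show "\<forall>y \<in> set its. length y = Suc d" using its by simp
    have "(Suc d + 1) * (length its + 1) ^ 2 \<le> Z * (n + 1) ^ 2"
      using Z(1) unfolding n_def by (intro mult_le_mono1) simp
    also have "\<dots> \<le> P" using P[OF pow(1), of 2 0] by simp
    finally show "130 * (Suc d + 1) * (length its + 1) ^ 2 \<le> 130 * P" by (simp only: mult.assoc)
  qed
  have c_length: "pcalls Q f_length (eNN its) (Num n) (20 * P)"
  proof -
    have "pcalls Q f_length (eNN its) (Num n) (20 * (n + 1))"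
      using calls_length[of Q "map (\<lambda>xs. eN xs) its"] by (simp add: n_def)
    then show ?thesis
      by (rule calls_mono) (use P[OF pow(5), of 1 0] in simp)
  qed
  have c_cols: "pcalls Q f_cols (Num F \<parallel> eNN ts \<parallel> Num n \<parallel> eNN ks \<parallel> Num 1 \<parallel> eNN ks) (eNN cols)
    (640 * P + Z ^ 2 * B)"
    unfolding cols_def
  proof (rule calls_mono[OF calls_cols[OF ts _ _ ks, of 1 n Q F ok B ks "Z - 1"]])
    fix i u assume "1 \<le> i" "i < 1 + length ks" "length u = length ts" "sum_list u \<le> n"
    then show "oracle_ok Q F ts ok B i (u @ unit_vec i ks)"
      using answers by (simp add: m_def)
  next
    fix i k assume "k \<in> set ks"
    then show "length (gen (unit_vec i ks) ts 0 (n # tl k)) \<le> Z - 1" using Z(5)[of k i] by simp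
  next
    have "(length ks + 1) * ((Z - 1 + 1) * (400 * (F + d + 2) * (length ts + 1) + B + 200) + 40 * (length ks + 1))
      \<le> Z * (Z * (400 * Z * Z + B + 200) + 40 * Z)"
      using Z Z1 by (intro mult_le_mono add_mono) (auto simp: m_def)
    also have "\<dots> = 400 * Z ^ 4 + 240 * Z ^ 2 + Z ^ 2 * B"
      by (simp add: algebra_simps p)
    also have "\<dots> \<le> 640 * P + Z ^ 2 * B"
      using P[OF pow(3), of 0 0] P[OF pow(2), of 0 0] by simp
    finally show "(length ks + 1) * ((Z - 1 + 1) * (400 * (F + d + 2) * (length ts + 1) + B + 200) +
       40 * (length ks + 1)) \<le> 640 * P + Z ^ 2 * B" .
  qed
  have c_heads: "pcalls Q f_heads (eNN ks) (eN (map hd ks)) (20 * P)"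
    "pcalls Q f_sum (eN (map hd ks)) (Num ?K) (20 * P)"
  proof -
    have "m + 1 \<le> P" using Z(2) P[OF pow(1), of 0 0] by simp
    then have le: "20 * (length ks + 1) \<le> 20 * P" by (simp add: m_def)
    show "pcalls Q f_heads (eNN ks) (eN (map hd ks)) (20 * P)"
      by (rule calls_mono[OF calls_heads[OF ne(1)] le])
    show "pcalls Q f_sum (eN (map hd ks)) (Num ?K) (20 * P)"
      by (rule calls_mono[OF calls_sum]) (use le in simp)
  qed
  have c_sums: "pcalls Q f_sums (eNN cols) (Num M) (80 * P)"
    unfolding M_def
  proof (rule calls_mono[OF calls_sums])
    show "\<forall>c \<in> set cols. length c \<le> Z" using cols R Z(2) by simp
    have "(20 * Z + 60) * (length cols + 1) \<le> (80 * Z) * Z"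
      using Z Z1 by (intro mult_le_mono) auto
    also have "\<dots> \<le> 80 * P" using P[OF pow(2), of 0 0] by (simp add: power2_eq_square)
    finally show "(20 * Z + 60) * (length cols + 1) \<le> 80 * P" .
  qed
  have c_target: "pcalls Q f_target (eNN ts \<parallel> eNN its \<parallel> eNN ks) (eN b) (150 * P)"
    unfolding b_def
  proof (rule calls_mono[OF calls_target[OF _ ne(1)]])
    show "\<forall>y\<in>set its. length y = Suc d" "\<forall>t\<in>set ts. length t = Suc d" using its ts by auto
    have "130 * (Suc d + 1) * (length its + 1) * (length ts + 1) + 20 * length ks
        \<le> 130 * Z * (n + 1) * Z + 20 * Z"
      using Z by (intro mult_le_mono add_mono) (auto simp: n_def m_def)
    also have "\<dots> = 130 * (Z ^ 2 * (n + 1)) + 20 * Z" by (simp add: power2_eq_square algebra_simps)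
    also have "\<dots> \<le> 150 * P" using P[OF pow(2), of 1 0] P[OF pow(1), of 0 0] by simp
    finally show "130 * (Suc d + 1) * (length its + 1) * (length ts + 1) + 20 * length ks \<le> 150 * P" .
  qed
  have Yb: "length (fold (step (2 * w * M) w) (take k cols) (states cols b l (2 * w) (4 * w * M))) \<le> Y"
    if "w > 0" for l w k
    unfolding Y_def R[symmetric]
  proof (rule length_fold_step_le[OF cols(1) that])
    show "\<forall>s\<in>set (states cols b l (2 * w) (4 * w * M)). good cols b w s"
      using good_states[OF cols(1), of "2 * w"] that by (auto intro: good_double)
    show "length (states cols b l (2 * w) (4 * w * M)) \<le> (2 * M + 1) ^ length b"
      using length_states_le[OF cols(1), of "2 * w" l M] that by simp
  qed
  have colsV: "\<forall>c \<in> set cols. length c = Suc (length b) \<and> sum_list c \<le> V" using cols V by blast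
  from calls_dp[OF colsV, of M Y ?K s 1 Q] Yb s obtain l where l: "l \<le> s" "?K < 2 ^ l"
    and dp: "pcalls Q f_dp (Num ?K \<parallel> Num 1 \<parallel> Num (2 * M) \<parallel> eNN cols \<parallel> eN b) (eNNN (S l))
      ((s + 1) * ((length cols + 1) * (900 * ((Y + 1) * ((length b + 1) * (Y + 1) * (V + 1))))))"
    by (auto simp: S_def)
  have c_dp: "pcalls Q f_dp (Num ?K \<parallel> Num 1 \<parallel> Num (2 * M) \<parallel> eNN cols \<parallel> eN b) (eNNN (S l)) (900 * P)"
  proof (rule calls_mono[OF dp])
    have "(s + 1) * ((length cols + 1) * (900 * ((Y + 1) * ((length b + 1) * (Y + 1) * (V + 1)))))
      \<le> (s + 1) * (Z * (900 * (Z * (Z * Z * Z))))"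
      using Z Z1 by (intro mult_le_mono) (auto simp: Y_def R V_def)
    also have "\<dots> = 900 * (Z ^ 5 * (s + 1))" by (simp add: algebra_simps p)
    also have "\<dots> \<le> 900 * P" using P[of "Z ^ 5" 0 1] by simp
    finally show "(s + 1) * ((length cols + 1) * (900 * ((Y + 1) * ((length b + 1) * (Y + 1) * (V + 1)))))
      \<le> 900 * P" .
  qed
  have c_find: "pcalls Q f_find (eNNN (S l) \<parallel> eNN ts \<parallel> eNN its) (find_state ts its (S l)) (580 * P)"
  proof (rule calls_mono[OF calls_find[of ts "Suc d" its "length b" "S l" V "s * length cols"]])
    show "\<forall>t\<in>set ts. length t = Suc d" "\<forall>t\<in>set its. length t = Suc d" using ts its by auto
    show "wf_states (length b) (S l)"
      unfolding S_def by (rule wf_states_states) (use cols in simp)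
    have "(\<forall>e \<in> set (tl x). entry_ok (length ts) V e) \<and> length (tl x) \<le> s * length cols"
      if x: "x \<in> set (S l)" for x
    proof
      have "good cols b 1 x" using good_states[OF cols(1), of 1] x unfolding S_def by simp
      then have "\<forall>e \<in> set (tl x). \<exists>c\<in>set cols. \<exists>q>0. e = q # c" by (auto simp: good_def)
      then show "\<forall>e \<in> set (tl x). entry_ok (length ts) V e"
      proof (intro ballI)
        fix e assume "e \<in> set (tl x)" "\<forall>e \<in> set (tl x). \<exists>c\<in>set cols. \<exists>q>0. e = q # c"
        then obtain c q where e: "e = q # c" "q > 0" "c \<in> set cols" by blast
        then obtain i v where "c = i # v" using cols(2) by (cases c) auto
        then show "entry_ok (length ts) V e"
          using e V[OF e(3)] cols(1) R by (auto simp: entry_ok_def)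
      qed
      have "length (tl x) \<le> l * length cols"
        using length_history[of cols b l 1] x unfolding S_def by blast
      also have "\<dots> \<le> s * length cols" using l(1) by (intro mult_le_mono1)
      finally show "length (tl x) \<le> s * length cols" .
    qed
    then show "\<forall>x\<in>set (S l). (\<forall>e \<in> set (tl x). entry_ok (length ts) V e) \<and> length (tl x) \<le> s * length cols"
      by blast
    have lS: "length (S l) \<le> Y"
      using length_states_le[OF cols(1), of 1 l M] unfolding S_def Y_def R by simp
    have "s * length cols \<le> s * Z" using Z(3) by (intro mult_le_mono2) simp
    then have h1: "s * length cols + 1 \<le> (s + 1) * Z" using Z1 unfolding add_mult_distrib by linarith
    have h2: "(length (S l) + 1) * (80 * (length b + 1)) \<le> Z * (80 * Z)"
      using Z lS by (intro mult_le_mono) (auto simp: Y_def R)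
    have h3: "(Suc d + 1) * (length ts + 1) * (V + 1) \<le> Z * Z * Z"
      using Z Z1 by (intro mult_le_mono) (auto simp: V_def)
    have h4: "(Suc d + 1) * (length its + 1) \<le> Z * (n + 1)"
      using Z by (intro mult_le_mono) (auto simp: n_def)
    have "(length (S l) + 1) * (80 * (length b + 1)) +
      (length its + 1) * ((s * length cols + 1) * (300 * ((Suc d + 1) * (length ts + 1) * (V + 1))) +
        200 * ((Suc d + 1) * (length its + 1)))
      \<le> Z * (80 * Z) + (n + 1) * (((s + 1) * Z) * (300 * (Z * Z * Z)) + 200 * (Z * (n + 1)))"
      by (rule add_mono[OF h2 mult_le_mono[OF _ add_mono[OF mult_le_mono[OF h1 mult_le_mono2[OF h3]]
        mult_le_mono2[OF h4]]]]) (simp add: n_def)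
    also have "\<dots> = 80 * Z ^ 2 + 300 * (Z ^ 4 * (n + 1) * (s + 1)) + 200 * (Z * (n + 1) ^ 2)"
      by (simp add: algebra_simps p)
    also have "\<dots> \<le> 580 * P"
      using P[OF pow(2), of 0 0] P[OF pow(3), of 1 1] P[OF pow(1), of 2 0] by simp
    finally show "(length (S l) + 1) * (80 * (length b + 1)) +
      (length its + 1) * ((s * length cols + 1) * (300 * ((Suc d + 1) * (length ts + 1) * (V + 1))) +
        200 * ((Suc d + 1) * (length its + 1))) \<le> 580 * P" .
  qed
  have P1: "1 \<le> P" using P[OF pow(5), of 0 0] by simp
  have c_solve: "pcalls Q f_solve (eNN its \<parallel> eNN ks \<parallel> eNN ts \<parallel> eNN cols) (find_state ts its (S l))
     (1900 * P)"
    apply (simp add: calls_def e_solve_def)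
    apply (rule wp_callI[OF c_heads(1)])
    apply (rule wp_callI[OF c_heads(2)])
    apply (rule wp_callI[OF c_sums])
    apply (rule wp_callI[OF c_sums])
    apply (rule exI[of _ M])
    apply simp
    apply (rule wp_callI[OF c_target])
    apply (rule wp_callI[OF c_dp[unfolded mult_2 One_nat_def]])
    apply (rule wp_callI[OF c_find])
    using P1 apply simp
    done
  have c_types: "pcalls Q f_types (Num F \<parallel> eNN its \<parallel> eNN ks \<parallel> eNN ts) (find_state ts its (S l))
     (2700 * P + Z ^ 2 * B)"
    apply (simp add: calls_def e_types_def)
    apply (rule wp_callI[OF c_length])
    apply (rule wp_callI[OF c_cols[unfolded One_nat_def]])
    apply (rule wp_callI[OF c_solve])
    using P1 apply simp
    done
  have "wp packing_prog Q [enc_list [Num F, Num d, Num m, eNN ks, eNN its]] e_main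
     (\<lambda>w t. w = find_state ts its (S l) \<and> t \<le> 3000 * P + Z ^ 2 * B)"
    apply (simp add: e_main_def)
    apply (rule wp_callI[OF c_remdups])
    apply (rule wp_callI[OF c_types])
    using P1 apply simp
    done
  then have "\<exists>t. runs packing_prog Q (enc_list [Num F, Num d, Num m, eNN ks, eNN its])
      (find_state ts its (S l)) t \<and> t \<le> 3000 * P + Z ^ 2 * B"
    unfolding wp_def runs_def by (auto simp flip: length_greater_0_conv)
  then show ?thesis using l(2) unfolding S_def P_def by blast
qed

section \<open>Correctness\<close>

text \<open>A choice of weight \<open>w\<close> deals out its \<open>w * c\<close> items of a type
  by residue; each of its \<open>w\<close> bins receives exactly \<open>c\<close> of them.\<close>

lemma card_mod_eq:
  assumes "r < w"
  shows "card {q. q < w * c \<and> q mod w = r} = (c :: nat)"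
proof -
  have "{q. q < w * c \<and> q mod w = r} = (\<lambda>x. w * x + r) ` {..<c}"
  proof (intro equalityI subsetI)
    fix q assume q: "q \<in> {q. q < w * c \<and> q mod w = r}"
    then have "q = w * (q div w) + r" by auto
    moreover have "q div w < c" using q by (simp add: less_mult_imp_div_less mult.commute)
    ultimately show "q \<in> (\<lambda>x. w * x + r) ` {..<c}" by blast
  next
    fix q assume "q \<in> (\<lambda>x. w * x + r) ` {..<c}"
    then obtain x where x: "x < c" "q = w * x + r" by auto
    have "w * x + r < w * Suc x" using assms by simp
    also have "\<dots> \<le> w * c" using x(1) by (intro mult_le_mono2) simp
    finally show "q \<in> {q. q < w * c \<and> q mod w = r}" using x assms by simp
  qed
  moreover have "inj_on (\<lambda>x. w * x + r) {..<c}" using assms by (auto simp: inj_on_def)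
  ultimately show ?thesis by (simp add: card_image)
qed

definition stock :: "nat list list \<Rightarrow> nat list \<Rightarrow> nat list list \<Rightarrow> nat" where
  "stock ts t es = (\<Sum>e \<leftarrow> es. hd e * look t ts (tl (tl e)))"

text \<open>The first choice serves the smallest numbers and spreads them evenly over its own block
  of bins; larger numbers are shifted down and left to the rest.\<close>

lemma card_loc_Cons:
  assumes "hd e > 0"
  shows "card {q. q < stock ts t (e # es) \<and> loc ts t q (e # es) = (i, j)} =
    (if e ! 1 = i \<and> offs i es < j \<and> j \<le> offs i es + hd e then look t ts (tl (tl e)) else 0) +
    card {q. q < stock ts t es \<and> loc ts t q es = (i, j)}"
proof -
  let ?c = "look t ts (tl (tl e))"
  let ?p = "hd e * ?c"
  let ?A = "{q. q < ?p \<and> (e ! 1, offs (e ! 1) es + q mod hd e + 1) = (i, j)}"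
  let ?B = "{q. q < stock ts t es \<and> loc ts t q es = (i, j)}"
  have "{q. q < stock ts t (e # es) \<and> loc ts t q (e # es) = (i, j)} = ?A \<union> (\<lambda>q. ?p + q) ` ?B"
  proof (intro equalityI subsetI)
    fix q assume q: "q \<in> {q. q < stock ts t (e # es) \<and> loc ts t q (e # es) = (i, j)}"
    show "q \<in> ?A \<union> (\<lambda>q. ?p + q) ` ?B"
    proof (cases "q < ?p")
      case True
      then show ?thesis using q by auto
    next
      case False
      then have "q - ?p \<in> ?B" "q = ?p + (q - ?p)" using q by (auto simp: stock_def)
      then show ?thesis by blast
    qed
  qed (auto simp: stock_def)
  moreover have "card (?A \<union> (\<lambda>q. ?p + q) ` ?B) = card ?A + card ((\<lambda>q. ?p + q) ` ?B)"
    by (rule card_Un_disjoint) auto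
  moreover have "card ((\<lambda>q. ?p + q) ` ?B) = card ?B" by (rule card_image) auto
  moreover have "card ?A = (if e ! 1 = i \<and> offs i es < j \<and> j \<le> offs i es + hd e then ?c else 0)"
  proof (cases "e ! 1 = i \<and> offs i es < j \<and> j \<le> offs i es + hd e")
    case True
    then have "?A = {q. q < ?p \<and> q mod hd e = j - offs i es - 1}" by auto
    moreover have "j - offs i es - 1 < hd e" using True by linarith
    ultimately show ?thesis using True card_mod_eq[of "j - offs i es - 1" "hd e" ?c] by simp
  next
    case False
    have "?A = {}"
    proof (rule ccontr)
      assume "?A \<noteq> {}"
      then obtain q where "e ! 1 = i" "offs i es + q mod hd e + 1 = j" by auto
      moreover have "q mod hd e < hd e" using assms by simp
      ultimately show False using False by linarith
    qed
    then show ?thesis using False by (simp only: card.empty if_False)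
  qed
  ultimately show ?thesis by simp
qed

lemma offs_Cons [simp]: "offs i (e # es) = (if e ! 1 = i then hd e else 0) + offs i es"
  by (simp add: offs_def)

text \<open>The blocks of kind \<open>i\<close> fill exactly the bins 1 to \<open>offs i es\<close>.
  In particular the default \<open>(0, 0)\<close> of \<open>loc\<close> is not reached by numbers
  below the stock.\<close>

lemma card_loc_eq_0:
  "\<lbrakk>\<forall>e \<in> set es. hd e > 0; \<not> (1 \<le> j \<and> j \<le> offs i es)\<rbrakk> \<Longrightarrow>
   card {q. q < stock ts t es \<and> loc ts t q es = (i, j)} = 0"
proof (induction es)
  case Nil
  show ?case by (simp add: stock_def)
next
  case (Cons e es)
  then have n: "\<not> (1 \<le> j \<and> j \<le> offs i es)"
    "\<not> (e ! 1 = i \<and> offs i es < j \<and> j \<le> offs i es + hd e)"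
    by (auto split: if_splits)
  have "card {q. q < stock ts t es \<and> loc ts t q es = (i, j)} = 0"
    using Cons.IH Cons.prems(1) n(1) by simp
  then show ?case
    using card_loc_Cons[of e ts t es i j] Cons.prems(1) n(2) by (simp only: list.set_intros if_False add_0)
qed

text \<open>The blocks are disjoint, so a single entry is responsible for bin \<open>(i, j)\<close>.
  It is the same for all types \<open>t\<close>; this makes the whole content of the bin one
  configuration.\<close>

lemma card_loc_eq_look:
  "\<lbrakk>\<forall>e \<in> set es. hd e > 0; 1 \<le> j; j \<le> offs i es\<rbrakk> \<Longrightarrow> \<exists>e \<in> set es. e ! 1 = i \<and>
    (\<forall>t. card {q. q < stock ts t es \<and> loc ts t q es = (i, j)} = look t ts (tl (tl e)))"
proof (induction es)
  case Nil
  then show ?case by (simp add: offs_def)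
next
  case (Cons e es)
  have e: "hd e > 0" "\<forall>e \<in> set es. hd e > 0" using Cons.prems by auto
  show ?case
  proof (cases "e ! 1 = i \<and> offs i es < j \<and> j \<le> offs i es + hd e")
    case True
    then have "card {q. q < stock ts t es \<and> loc ts t q es = (i, j)} = 0" for t
      by (intro card_loc_eq_0[OF e(2)]) simp
    then show ?thesis using True card_loc_Cons[OF e(1), of ts _ es i j] by (intro bexI[of _ e]) auto
  next
    case False
    then have "j \<le> offs i es" using Cons.prems(3) by (auto split: if_splits)
    from Cons.IH[OF e(2) Cons.prems(2) this] show ?thesis
      using card_loc_Cons[OF e(1), of ts _ es i j] False by auto
  qed
qed

lemma length_out [simp]: "length (out ts es its) = length its"
  by (induction its) auto

text \<open>The items of type \<open>t\<close> carry the numbers below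
  \<open>count_list its t\<close>, each once, so counting items in a bin becomes counting
  numbers.\<close>

lemma count_out:
  "length (filter (\<lambda>(t', p). t' = t \<and> p = ij) (zip its (out ts es its))) =
   card {q. q < count_list its t \<and> loc ts t q es = ij}"
proof (induction its)
  case (Cons y its)
  have "{q. q < Suc n \<and> loc ts t q es = ij} =
      {q. q < n \<and> loc ts t q es = ij} \<union> (if loc ts t n es = ij then {n} else {})" for n
    by (auto simp: less_Suc_eq)
  then have "card {q. q < Suc n \<and> loc ts t q es = ij} =
      (if loc ts t n es = ij then 1 else 0) + card {q. q < n \<and> loc ts t q es = ij}" for n
    by auto
  then show ?case using Cons by auto
qed simp

lemma look_nth:
  "\<lbrakk>distinct ts; j < length ts; length ts \<le> length v\<rbrakk> \<Longrightarrow> look (ts ! j) ts v = v ! j"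
proof (induction ts arbitrary: j v)
  case (Cons t ts)
  obtain c v' where v: "v = c # v'" using Cons.prems by (cases v) auto
  show ?case
  proof (cases j)
    case (Suc j')
    then have "ts ! j' \<noteq> t" using Cons.prems by auto
    then show ?thesis using Suc Cons.IH[of j' v'] Cons.prems v by simp
  qed (simp add: v)
qed simp

lemma unit_vec_nth: "j < length ks \<Longrightarrow> unit_vec i ks ! j = of_bool (i = Suc j)"
proof (induction i ks arbitrary: j rule: unit_vec.induct)
  case (2 i k ks)
  have 0: "j < length ks \<Longrightarrow> unit_vec 0 ks ! j = 0" for j and ks :: "'a list"
    by (induction ks arbitrary: j) (auto simp: nth_Cons split: nat.splits)
  show ?case
  proof (cases j)
    case (Suc j')
    then show ?thesis using 2 0[of j' ks] by (cases i) auto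
  qed simp
qed simp

lemma lincomb_sum:
  "length xs = length cols \<Longrightarrow> lincomb xs cols j = (\<Sum>c<length cols. xs ! c * cols ! c ! (j + 1))"
proof (induction xs cols rule: list_induct2)
  case (Cons x xs c cols)
  then show ?case by (simp add: sum.lessThan_Suc_shift del: sum.lessThan_Suc)
qed simp

lemma map2_map_self: "map2 g (map f xs) xs = map (\<lambda>x. g (f x) x) xs"
  by (induction xs) auto

lemma zip_append_right: "length xs \<le> length ys \<Longrightarrow> zip xs (ys @ zs) = zip xs ys"
  by (simp add: zip_append2)

section \<open>Instances and their vectors\<close>

locale packing_input =
  fixes B :: "('u, 'f) packing" and us :: "'u list" and fs :: "'f list"
  assumes packing: "is_packing B"
    and us: "distinct us" "set us = items B"
    and fs: "distinct fs" "set fs = fingerprints B"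
begin

abbreviation "dims \<equiv> ndims B"

definition entry :: "'u \<Rightarrow> nat list" where
  "entry u = index_of fs (fingerprint B u) # map (item_size B u) [1..<Suc dims]"

definition kind :: "nat \<Rightarrow> nat list" where
  "kind i = bins B i # map (capacity B i) [1..<Suc dims]"

definition its :: "nat list list" where
  "its = map entry us"

definition ks :: "nat list list" where
  "ks = map kind [1..<Suc (kinds B)]"

definition ts :: "nat list list" where
  "ts = remdups its"

text \<open>Zipping with \<open>ts\<close> cuts off whatever follows the multiplicities, so
  \<open>fp\<close> also applies to vectors that carry the unit vector of a kind.\<close>

definition fp :: "nat list \<Rightarrow> 'f multiset" where
  "fp v = sum_list (map2 (\<lambda>t c. replicate_mset c (fs ! hd t)) ts v)"

definition ok :: "nat \<Rightarrow> nat list \<Rightarrow> bool" where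
  "ok i v = valid B i (fp v)"

definition vec :: "'u set \<Rightarrow> nat list" where
  "vec W = map (\<lambda>t. card {x \<in> W. entry x = t}) ts"

lemma enc_input_eq:
  "enc_input B us fs = enc_list [Num (length fs), Num dims, Num (length ks), eNN ks, eNN its]"
  by (simp add: enc_input_def enc_vec_def ks_def its_def kind_def entry_def comp_def del: upt_Suc)

lemma finite_items: "finite (items B)" and card_items: "card (items B) = length us"
  using packing us distinct_card[OF us(1)] by (auto simp: is_packing_def)

lemma index_of_nth: "x \<in> fingerprints B \<Longrightarrow> index_of fs x < length fs \<and> fs ! index_of fs x = x"
proof -
  assume "x \<in> fingerprints B"
  then obtain i where i: "i < length fs" "fs ! i = x" using fs(2) by (metis in_set_conv_nth)
  then have "index_of fs x = i" unfolding index_of_def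
    using fs(1) by (intro the_equality) (auto simp: nth_eq_iff_index_eq)
  then show ?thesis using i by simp
qed

lemma hd_entry: "u \<in> items B \<Longrightarrow> hd (entry u) < length fs \<and> fs ! hd (entry u) = fingerprint B u"
  using packing index_of_nth by (auto simp: entry_def is_packing_def)

lemma length_entry [simp]: "length (entry u) = Suc dims"
  by (simp add: entry_def)

lemma length_kind [simp]: "length (kind i) = Suc dims"
  by (simp add: kind_def)

lemma load_entry_nth:
  "c \<le> dims \<Longrightarrow> load (entry u) ! c = (if c = 0 then 1 else item_size B u c)"
  by (cases c) (simp_all add: load_def entry_def nth_Cons del: upt_Suc)

lemma set_ts: "set ts = entry ` items B"
  using us by (auto simp: ts_def its_def)

lemma distinct_ts: "distinct ts"
  by (simp add: ts_def)

lemma sum_tl_entry: "sum_list (tl (entry u)) = norm1 dims (item_size B u)"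
  by (simp add: entry_def norm1_def interv_sum_list_conv_sum_set_nat atLeastLessThanSuc_atLeastAtMost del: upt_Suc)

lemma sum_tl_kind: "sum_list (tl (kind i)) = norm1 dims (capacity B i)"
  by (simp add: kind_def norm1_def interv_sum_list_conv_sum_set_nat atLeastLessThanSuc_atLeastAtMost del: upt_Suc)

lemma entries_ok: "\<forall>t \<in> set its. length t = Suc dims \<and> sum_list (tl t) > 0"
proof
  fix t assume "t \<in> set its"
  then obtain u where u: "t = entry u" "u \<in> items B" using us by (auto simp: its_def)
  then obtain c where "c \<in> {1..dims}" "item_size B u c \<noteq> 0"
    using packing by (auto simp: is_packing_def)
  then have "norm1 dims (item_size B u) > 0"
    unfolding norm1_def by (intro sum_pos2[of _ c]) auto
  then show "length t = Suc dims \<and> sum_list (tl t) > 0" using u sum_tl_entry by simp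
qed

lemma entries_ok': "\<forall>t \<in> set ts. length t = Suc dims \<and> sum_list (tl t) > 0"
  using entries_ok by (simp add: ts_def)

lemma ks_ok: "\<forall>k \<in> set ks. length k = Suc dims"
  by (auto simp: ks_def)

lemma length_ks [simp]: "length ks = kinds B"
  by (simp add: ks_def)

lemma ks_nth: "i < kinds B \<Longrightarrow> ks ! i = kind (Suc i)"
  by (simp add: ks_def del: upt_Suc)

text \<open>\<open>W\<close> is partitioned by \<open>entry\<close>, and \<open>g\<close> is
  constant on each class. Loads and fingerprint counts are both instances.\<close>

lemma sum_vec:
  assumes "W \<subseteq> items B"
  shows "(\<Sum>t \<leftarrow> ts. card {x \<in> W. entry x = t} * g t) = (\<Sum>x \<in> W. g (entry x))"
proof -
  have fin: "finite W" using assms finite_items by (rule finite_subset)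
  have "(\<Sum>t \<leftarrow> ts. card {x \<in> W. entry x = t} * g t) = (\<Sum>t \<in> set ts. card {x \<in> W. entry x = t} * g t)"
    by (rule sum_list_distinct_conv_sum_set) (rule distinct_ts)
  also have "\<dots> = (\<Sum>t \<in> set ts. \<Sum>x \<in> {x \<in> W. entry x = t}. g (entry x))"
    by (intro sum.cong refl) simp
  also have "\<dots> = (\<Sum>x \<in> W. g (entry x))"
    by (rule sum.group[OF fin]) (use assms set_ts finite_items in auto)
  finally show ?thesis .
qed

lemma load_total_vec:
  "W \<subseteq> items B \<Longrightarrow> load_total (vec W) ts j = (\<Sum>x \<in> W. load (entry x) ! j)"
  unfolding load_total_def vec_def map2_map_self by (rule sum_vec)

text \<open>The artificial first row only asks that \<open>W\<close> has no more elements than there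
  are items, so for sets of items it excludes nothing.\<close>

lemma fit_vec:
  assumes W: "W \<subseteq> items B"
  shows "fit (vec W) ts (length its # tl (kind i)) \<longleftrightarrow>
    (\<forall>c \<in> {1..dims}. (\<Sum>x \<in> W. item_size B x c) \<le> capacity B i c)"
proof -
  have "card W \<le> length us"
    using card_mono[OF finite_items W] card_items by simp
  then have "load_total (vec W) ts 0 \<le> length its"
    unfolding load_total_vec[OF W] by (simp add: load_entry_nth its_def)
  moreover have "load_total (vec W) ts (Suc c) = (\<Sum>x \<in> W. item_size B x (Suc c))" if "c < dims" for c
    unfolding load_total_vec[OF W] using that by (intro sum.cong refl) (simp add: load_entry_nth)
  moreover have "tl (kind i) ! c = capacity B i (Suc c)" if "c < dims" for c
    using that by (simp add: kind_def del: upt_Suc)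
  moreover have "(\<forall>c \<in> {1..dims}. P c) \<longleftrightarrow> (\<forall>c < dims. P (Suc c))" for P
    by (metis Suc_le_eq atLeastAtMost_iff le_add1 not0_implies_Suc not_one_le_zero plus_1_eq_Suc)
  moreover have "(\<forall>c < Suc dims. P c) \<longleftrightarrow> P 0 \<and> (\<forall>c < dims. P (Suc c))" for P
    by (rule All_less_Suc2)
  ultimately show ?thesis by (simp add: fit_def vec_def[of W])
qed

lemma length_vec [simp]: "length (vec W) = length ts"
  by (simp add: vec_def)

lemma fp_append: "length u = length ts \<Longrightarrow> fp (u @ r) = fp u"
  by (simp add: fp_def zip_append_right)

lemma count_sum_list: "count (sum_list (map f xs)) g = (\<Sum>x \<leftarrow> xs. count (f x) g)"
  by (induction xs) auto

lemma count_fp: "count (fp v) g = (\<Sum>(t, c) \<leftarrow> zip ts v. if fs ! hd t = g then c else 0)"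
  unfolding fp_def count_sum_list by (intro arg_cong[where f = sum_list] map_cong refl) auto

lemma fp_vec:
  assumes W: "W \<subseteq> items B"
  shows "fp (vec W) = image_mset (fingerprint B) (mset_set W)"
proof (rule multiset_eqI)
  fix g
  have fin: "finite W" using W finite_items by (rule finite_subset)
  have zip: "zip xs (map f xs) = map (\<lambda>t. (t, f t)) xs" for f :: "nat list \<Rightarrow> nat" and xs
    by (induction xs) auto
  have "count (fp (vec W)) g = (\<Sum>t \<leftarrow> ts. card {x \<in> W. entry x = t} * of_bool (fs ! hd t = g))"
    unfolding count_fp vec_def zip map_map
    by (intro arg_cong[where f = sum_list] map_cong refl) auto
  also have "\<dots> = (\<Sum>x \<in> W. of_bool (fs ! hd (entry x) = g))" by (rule sum_vec[OF W])
  also have "\<dots> = (\<Sum>x \<in> W. of_bool (fingerprint B x = g))"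
    using W hd_entry by (intro sum.cong refl) auto
  also have "\<dots> = card {x \<in> W. fingerprint B x = g}"
    using fin by (simp add: Int_def of_bool_def flip: sum.inter_filter)
  also have "\<dots> = count (image_mset (fingerprint B) (mset_set W)) g"
    using fin by (simp add: count_image_mset vimage_def Int_def conj_commute)
  finally show "count (fp (vec W)) g = count (image_mset (fingerprint B) (mset_set W)) g" .
qed

lemma fsums_eq: "fsums (length fs) ts v = map (count (fp v)) fs"
proof (rule nth_equalityI)
  fix g assume "g < length (fsums (length fs) ts v)"
  then have g: "g < length fs" by (simp add: fsums_def)
  have "fsum g ts v = count (fp v) (fs ! g)"
    unfolding fsum_def count_fp
  proof (intro arg_cong[where f = sum_list] map_cong refl)
    fix x assume "x \<in> set (zip ts v)"
    moreover obtain t c where x: "x = (t, c)" by (cases x)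
    ultimately have "t \<in> set ts" by (auto dest: set_zip_leftD)
    then have "hd t < length fs" using hd_entry set_ts by auto
    then show "(\<lambda>(t, c). if hd t = g then c else 0) x = (\<lambda>(t, c). if fs ! hd t = fs ! g then c else 0) x"
      using x g fs(1) by (simp add: nth_eq_iff_index_eq)
  qed
  then show "fsums (length fs) ts v ! g = map (count (fp v)) fs ! g"
    using g by (simp add: fsums_def)
qed (simp add: fsums_def)

lemma set_fp: "set_mset (fp v) \<subseteq> fingerprints B"
proof
  fix g assume "g \<in># fp v"
  then have "(\<Sum>(t, c) \<leftarrow> zip ts v. if fs ! hd t = g then c else 0) \<noteq> 0"
    unfolding count_fp[symmetric] by simp
  then obtain t c where "(t, c) \<in> set (zip ts v)" "fs ! hd t = g"
    by (auto split: if_splits)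
  then have "t \<in> set ts" by (auto dest: set_zip_leftD)
  then show "g \<in> fingerprints B" using hd_entry set_ts \<open>fs ! hd t = g\<close> fs(2) by (metis imageE nth_mem)
qed

lemma size_fp: "length u = length ts \<Longrightarrow> size (fp u) = sum_list u"
proof -
  have "length u = length ts' \<Longrightarrow>
    size (sum_list (map2 (\<lambda>t c. replicate_mset c (fs ! hd t)) ts' u)) = sum_list u" for ts'
    by (induction u ts' rule: list_induct2) auto
  then show "length u = length ts \<Longrightarrow> size (fp u) = sum_list u" by (simp add: fp_def)
qed

lemma oracle_answers:
  assumes "time_bound B \<tau> T" "1 \<le> i" "i \<le> kinds B" "length u = length ts" "sum_list u \<le> length its"
  shows "oracle_ok (validity_calls B fs \<tau>) (length fs) ts ok (T (card (items B))) i (u @ unit_vec i ks)"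
proof -
  let ?M = "fp u"
  have "(Num i \<parallel> eN (fsums (length fs) ts (u @ unit_vec i ks)), Num (of_bool (ok i (u @ unit_vec i ks))), \<tau> i ?M)
    \<in> validity_calls B fs \<tau>"
    unfolding validity_calls_def ok_def fsums_eq fp_append[OF assms(4)] map_map comp_def
    using assms(2,3) set_fp by auto
  moreover have "\<tau> i ?M \<le> T (card (items B))"
    using assms set_fp[of u] size_fp[OF assms(4)] card_items
    by (auto simp: time_bound_def its_def)
  ultimately show ?thesis unfolding oracle_ok_def by blast
qed

end

lemma find_state_cases:
  obtains s where "s \<in> set S" "sum_list (hd s) = 0"
    "find_state ts its S = Num 1 \<parallel> enc_list (map eP (out ts (tl s) its))"
  | "\<forall>s \<in> set S. sum_list (hd s) \<noteq> 0" "find_state ts its S = Num 0"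
proof (induction S arbitrary: thesis)
  case Nil
  then show ?case by simp
next
  case (Cons s S)
  show ?case
  proof (cases "sum_list (hd s) = 0")
    case True
    then show ?thesis using Cons.prems(1)[of s] by simp
  next
    case False
    then have fs: "find_state ts its (s # S) = find_state ts its S"
      by (simp only: find_state.simps if_False)
    show ?thesis
    proof (rule Cons.IH)
      fix s' assume "s' \<in> set S" "sum_list (hd s') = 0"
        "find_state ts its S = Num 1 \<parallel> enc_list (map eP (out ts (tl s') its))"
      then show thesis using Cons.prems(1)[of s'] fs by simp
    next
      assume "\<forall>s \<in> set S. sum_list (hd s) \<noteq> 0" "find_state ts its S = Num 0"
      moreover from this False have "\<forall>x \<in> set (s # S). sum_list (hd x) \<noteq> 0"
        by (metis set_ConsD)
      ultimately show thesis using Cons.prems(2) fs by simp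
    qed
  qed
qed

context packing_input
begin

definition cols :: "nat list list" where
  "cols = columns ok ts (length its) ks 1 ks"

definition target :: "nat list" where
  "target = map (count_list its) ts @ map hd ks"

definition bin_ok :: "nat \<Rightarrow> 'u set \<Rightarrow> bool" where
  "bin_ok i W \<longleftrightarrow> (\<forall>c \<in> {1..dims}. (\<Sum>x \<in> W. item_size B x c) \<le> capacity B i c) \<and>
     valid B i (image_mset (fingerprint B) (mset_set W))"

lemma set_cols: "set cols = {i # u @ unit_vec i ks | i u. i \<in> {1..kinds B} \<and>
    fit u ts (length its # tl (kind i)) \<and> ok i (u @ unit_vec i ks)}"
proof -
  have "\<forall>t \<in> set ts. length t = Suc dims" using entries_ok' by blast
  from set_columns[OF this ks_ok, of ok "length its" ks 1] have
    "set cols = {Suc j # u @ unit_vec (Suc j) ks | j u. j < kinds B \<and>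
      fit u ts (length its # tl (kind (Suc j))) \<and> ok (Suc j) (u @ unit_vec (Suc j) ks)}"
    unfolding cols_def by (auto simp: ks_nth)
  also have "\<dots> = {i # u @ unit_vec i ks | i u. i \<in> {1..kinds B} \<and>
    fit u ts (length its # tl (kind i)) \<and> ok i (u @ unit_vec i ks)}" (is "?L = ?R")
  proof (intro equalityI subsetI)
    fix x assume "x \<in> ?R"
    then obtain i u where i: "x = i # u @ unit_vec i ks" "i \<in> {1..kinds B}"
      "fit u ts (length its # tl (kind i))" "ok i (u @ unit_vec i ks)" by blast
    then obtain j where "i = Suc j" by (cases i) auto
    then show "x \<in> ?L" using i by auto
  qed auto
  finally show ?thesis .
qed

lemma length_target: "length target = length ts + kinds B"
  by (simp add: target_def)

lemma length_cols: "\<forall>c \<in> set cols. length c = Suc (length target)"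
  unfolding set_cols length_target by (auto simp: fit_def)

text \<open>For \<open>W = {}\<close> this says that empty bins of kind \<open>i\<close> have a
  column exactly if the predicate accepts the empty multiset.\<close>

lemma col_iff:
  assumes "W \<subseteq> items B" "i \<in> {1..kinds B}"
  shows "i # vec W @ unit_vec i ks \<in> set cols \<longleftrightarrow> bin_ok i W"
  unfolding set_cols bin_ok_def fit_vec[OF assms(1), symmetric] ok_def
    fp_vec[OF assms(1), symmetric]
  using assms(2) by (auto simp: fp_append fit_def)

lemma count_its: "count_list its t = card {x \<in> items B. entry x = t}"
proof -
  have "count_list (map entry xs) t = length (filter (\<lambda>x. entry x = t) xs)" for xs
    by (induction xs) auto
  then show ?thesis using us by (simp add: its_def distinct_length_filter Int_def conj_commute)
qed

lemma target_item: "j < length ts \<Longrightarrow> target ! j = card {x \<in> items B. entry x = ts ! j}"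
  by (simp add: target_def nth_append count_its)

lemma target_kind: "i < kinds B \<Longrightarrow> target ! (length ts + i) = bins B (Suc i)"
  by (simp add: target_def nth_append ks_nth kind_def)

lemma sum_bins: "sum_list (map hd ks) = (\<Sum>i \<in> {1..kinds B}. bins B i)"
  by (simp add: ks_def kind_def comp_def interv_sum_list_conv_sum_set_nat
      atLeastLessThanSuc_atLeastAtMost del: upt_Suc)

text \<open>Every bin, empty or not, has a column, and the multiplicity of a column is the number of
  its bins. It is at most the number of all bins, which is why the doubling of weights may stop
  there.\<close>

lemma states_complete_feasible:
  assumes W: "feasible_partition B W" and l: "sum_list (map hd ks) < 2 ^ l"
  shows "\<exists>s \<in> set (states cols target l 1 (2 * 1 * sum_list (map sum_list cols))). sum_list (hd s) = 0"
proof -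
  define D where "D = (SIGMA i:{1..kinds B}. {1..bins B i})"
  define U where "U p = W (fst p) (snd p)" for p
  have finD: "finite D" by (simp add: D_def)
  have "(\<Union>p \<in> D. U p) = (\<Union>i \<in> {1..kinds B}. \<Union>j \<in> {1..bins B i}. W i j)"
    by (fastforce simp: D_def U_def)
  then have cover: "(\<Union>p \<in> D. U p) = items B"
    using W unfolding feasible_partition_def by metis
  have "U = (\<lambda>(i, j). W i j)" by (auto simp: U_def fun_eq_iff)
  then have disj: "disjoint_family_on U D"
    using W unfolding feasible_partition_def D_def by blast
  have sub: "U p \<subseteq> items B" if "p \<in> D" for p using cover that by blast
  define col where "col p = fst p # vec (U p) @ unit_vec (fst p) ks" for p
  have "col p \<in> set cols" if "p \<in> D" for p
  proof -
    have "fst p \<in> {1..kinds B}" using that by (auto simp: D_def)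
    moreover have "bin_ok (fst p) (U p)"
      using W that by (auto simp: feasible_partition_def bin_ok_def D_def U_def)
    ultimately show ?thesis unfolding col_def using col_iff[OF sub[OF that]] by blast
  qed
  \<comment> \<open>One position is chosen for each bin, so that the multiplicities count every bin
    once even if a column is repeated in \<open>cols\<close>.\<close>
  then have "\<forall>p \<in> D. \<exists>c < length cols. cols ! c = col p" by (metis in_set_conv_nth)
  then obtain idx where idx: "\<And>p. p \<in> D \<Longrightarrow> idx p < length cols \<and> cols ! idx p = col p"
    by metis
  define xs where "xs = map (\<lambda>c. card {p \<in> D. idx p = c}) [0..<length cols]"
  have xs: "length xs = length cols" by (simp add: xs_def)
  have lin: "lincomb xs cols j = (\<Sum>p \<in> D. col p ! (j + 1))" for j
  proof -
    have "lincomb xs cols j = (\<Sum>c<length cols. \<Sum>p \<in> {p \<in> D. idx p = c}. cols ! c ! (j + 1))"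
      unfolding lincomb_sum[OF xs] by (intro sum.cong refl) (simp add: xs_def)
    also have "\<dots> = (\<Sum>c<length cols. \<Sum>p \<in> {p \<in> D. idx p = c}. col p ! (j + 1))"
      using idx by (intro sum.cong refl) auto
    also have "\<dots> = (\<Sum>p \<in> D. col p ! (j + 1))"
      by (rule sum.group[OF finD]) (use idx in auto)
    finally show ?thesis .
  qed
  have "target ! j = lincomb xs cols j" if j: "j < length target" for j
  proof (cases "j < length ts")
    case True
    have "{x \<in> items B. entry x = ts ! j} = (\<Union>p \<in> D. {x \<in> U p. entry x = ts ! j})"
      using cover by blast
    moreover have "card (\<Union>p \<in> D. {x \<in> U p. entry x = ts ! j}) = (\<Sum>p \<in> D. card {x \<in> U p. entry x = ts ! j})"
    proof (rule card_UN_disjoint[OF finD])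
      show "\<forall>p\<in>D. finite {x \<in> U p. entry x = ts ! j}"
        using sub by (intro ballI finite_subset[OF _ finite_items]) auto
      show "\<forall>p\<in>D. \<forall>q\<in>D. p \<noteq> q \<longrightarrow> {x \<in> U p. entry x = ts ! j} \<inter> {x \<in> U q. entry x = ts ! j} = {}"
        using disj unfolding disjoint_family_on_def by blast
    qed
    moreover have "col p ! (j + 1) = card {x \<in> U p. entry x = ts ! j}" for p
      using True by (simp add: col_def nth_append) (simp add: vec_def)
    ultimately show ?thesis unfolding lin target_item[OF True] by simp
  next
    case False
    then obtain i where i: "j = length ts + i" "i < kinds B"
      using j length_target by (metis add_less_cancel_left le_Suc_ex not_less)
    have "col p ! (j + 1) = of_bool (fst p = Suc i)" for p
      using i by (simp add: col_def nth_append unit_vec_nth)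
    then have "lincomb xs cols j = (\<Sum>p \<in> D. of_bool (fst p = Suc i))" unfolding lin by simp
    also have "\<dots> = card {p \<in> D. fst p = Suc i}"
      using finD by (simp add: Int_def of_bool_def flip: sum.inter_filter)
    also have "{p \<in> D. fst p = Suc i} = {Suc i} \<times> {1..bins B (Suc i)}"
      using i(2) by (auto simp: D_def)
    also have "card \<dots> = bins B (Suc i)" by simp
    finally show ?thesis using i target_kind by simp
  qed
  moreover have "x < 2 ^ l" if "x \<in> set xs" for x
  proof -
    obtain c where "x = card {p \<in> D. idx p = c}" using \<open>x \<in> set xs\<close> by (auto simp: xs_def)
    also have "\<dots> \<le> card D" using finD by (intro card_mono) auto
    also have "\<dots> = sum_list (map hd ks)" unfolding sum_bins D_def by simp
    finally show ?thesis using l by simp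
  qed
  ultimately show ?thesis
    by (intro states_complete_zero[OF length_cols xs]) auto
qed

text \<open>With residual 0, the rows of the types say that the choices hold exactly the available
  items (\<open>stock\<close>), and the rows of the kinds that they use exactly the available bins
  (\<open>offs\<close>). The content of each bin is then the configuration of one choice, which is a
  column and hence valid.\<close>

lemma states_sound:
  assumes s: "s \<in> set (states cols target l 1 (2 * 1 * sum_list (map sum_list cols)))"
    and zero: "sum_list (hd s) = 0"
  shows "\<exists>a. feasible_partition B (\<lambda>i j. {u \<in> items B. a u = (i, j)}) \<and>
    enc_list (map eP (out ts (tl s) its)) = enc_output us a"
proof -
  have "good cols target 1 s" using good_states[OF length_cols zero_less_one] s by blast
  then obtain r es where r: "s = r # es" "length r = length target"
    "\<forall>e \<in> set es. \<exists>c \<in> set cols. \<exists>q > 0. e = (1 * q) # c"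
    "\<forall>j < length target. r ! j + (\<Sum>e \<leftarrow> es. hd e * e ! (j + 2)) = target ! j"
    unfolding good_def by blast
  have "r ! j = 0" if "j < length target" for j
    using zero that r(1,2) by (simp add: sum_list_eq_0_iff)
  then have row: "(\<Sum>e \<leftarrow> es. hd e * e ! (j + 2)) = target ! j" if "j < length target" for j
    using r(4) that by simp
  have es: "\<exists>q i u. e = q # i # u @ unit_vec i ks \<and> q > 0 \<and> length u = length ts \<and>
      i \<in> {1..kinds B} \<and> i # u @ unit_vec i ks \<in> set cols" if e: "e \<in> set es" for e
  proof -
    obtain c q where c: "c \<in> set cols" "q > 0" "e = q # c" using r(3) e unfolding mult_1 by blast
    then obtain i u where "c = i # u @ unit_vec i ks" "length u = length ts" "i \<in> {1..kinds B}"
      unfolding set_cols by (auto simp: fit_def)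
    then show ?thesis using c by blast
  qed
  have pos: "\<forall>e \<in> set es. hd e > 0" using es by fastforce
  have stock: "stock ts t es = count_list its t" if t: "t \<in> set ts" for t
  proof -
    obtain j where j: "j < length ts" "t = ts ! j" using t by (metis in_set_conv_nth)
    have "hd e * look t ts (tl (tl e)) = hd e * e ! (j + 2)" if e: "e \<in> set es" for e
    proof -
      obtain q i u where "e = q # i # u @ unit_vec i ks" "length u = length ts" using es[OF e] by blast
      then show ?thesis using j look_nth[OF distinct_ts j(1), of "u @ unit_vec i ks"] by simp
    qed
    then have "stock ts t es = (\<Sum>e \<leftarrow> es. hd e * e ! (j + 2))"
      unfolding stock_def by (intro arg_cong[where f = sum_list] map_cong refl) auto
    then show ?thesis
      using row[of j] j length_target by (simp add: target_def nth_append)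
  qed
  have offs: "offs i es = bins B i" if i: "i \<in> {1..kinds B}" for i
  proof -
    obtain i' where i': "i = Suc i'" "i' < kinds B" using i by (cases i) auto
    have "(if e ! 1 = i then hd e else 0) = hd e * e ! (length ts + i' + 2)" if e: "e \<in> set es" for e
    proof -
      obtain q k u where "e = q # k # u @ unit_vec k ks" "length u = length ts" using es[OF e] by blast
      then show ?thesis using i' by (simp add: nth_append unit_vec_nth)
    qed
    then have "offs i es = (\<Sum>e \<leftarrow> es. hd e * e ! (length ts + i' + 2))"
      unfolding offs_def by (intro arg_cong[where f = sum_list] map_cong refl) auto
    then show ?thesis
      using row[of "length ts + i'"] target_kind i' length_target by simp
  qed
  let ?out = "out ts es its"
  have len: "length us = length ?out" by (simp add: its_def)
  define a where "a u = the (map_of (zip us ?out) u)" for u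
  have out: "map a us = ?out"
  proof (rule nth_equalityI)
    fix p assume "p < length (map a us)"
    then show "map a us ! p = ?out ! p"
      using map_of_zip_nth[OF len us(1), of p] len by (simp add: a_def)
  qed (use len in simp)
  define W where "W i j = {u \<in> items B. a u = (i, j)}" for i j
  have sub: "W i j \<subseteq> items B" for i j by (auto simp: W_def)
  have count: "card {x \<in> W i j. entry x = t} = card {q. q < stock ts t es \<and> loc ts t q es = (i, j)}"
    if "t \<in> set ts" for i j t
  proof -
    have "card {x \<in> W i j. entry x = t} = length (filter (\<lambda>x. entry x = t \<and> a x = (i, j)) us)"
      using us by (simp add: distinct_length_filter W_def Int_def conj_ac)
    also have "\<dots> = length (filter (\<lambda>(t', p). t' = t \<and> p = (i, j)) (zip its (map a us)))"
    proof -
      have "length (filter (\<lambda>x. entry x = t \<and> a x = (i, j)) xs) =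
        length (filter (\<lambda>(t', p). t' = t \<and> p = (i, j)) (zip (map entry xs) (map a xs)))" for xs
        by (induction xs) auto
      then show ?thesis by (simp add: its_def)
    qed
    also have "\<dots> = card {q. q < stock ts t es \<and> loc ts t q es = (i, j)}"
      unfolding out count_out stock[OF that] ..
    finally show ?thesis .
  qed
  \<comment> \<open>An item placed in \<open>(i, j)\<close> makes the set of numbers sent there
    nonempty, whereas \<open>loc\<close> sends no number below the stock outside the available
    bins.\<close>
  have range: "i \<in> {1..kinds B} \<and> j \<in> {1..bins B i}" if u: "u \<in> items B" "a u = (i, j)" for u i j
  proof -
    have t: "entry u \<in> set ts" using u set_ts by blast
    have "u \<in> {x \<in> W i j. entry x = entry u}" using u by (simp add: W_def)
    moreover have "finite {x \<in> W i j. entry x = entry u}"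
      using finite_subset[OF sub finite_items] by simp
    ultimately have "card {q. q < stock ts (entry u) es \<and> loc ts (entry u) q es = (i, j)} \<noteq> 0"
      unfolding count[OF t, symmetric] by (metis card_0_eq empty_iff)
    then have j: "1 \<le> j \<and> j \<le> offs i es" using card_loc_eq_0[OF pos, of j i ts "entry u"] by argo
    then obtain e where "e \<in> set es" "e ! 1 = i" using card_loc_eq_look[OF pos, of j i ts] by blast
    then have "i \<in> {1..kinds B}" using es by fastforce
    then show ?thesis using j offs by simp
  qed
  have ok: "bin_ok i (W i j)" if ij: "i \<in> {1..kinds B}" "j \<in> {1..bins B i}" for i j
  proof -
    have "1 \<le> j" "j \<le> offs i es" using ij offs by auto
    then obtain e where e: "e \<in> set es" "e ! 1 = i"
      "\<And>t. card {q. q < stock ts t es \<and> loc ts t q es = (i, j)} = look t ts (tl (tl e))"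
      using card_loc_eq_look[OF pos, of j i ts] by blast
    obtain q k u where u: "e = q # k # u @ unit_vec k ks" "length u = length ts"
      "k # u @ unit_vec k ks \<in> set cols" using es[OF e(1)] by blast
    have k: "k = i" using e(2) u(1) by simp
    have "vec (W i j) = u"
    proof (rule nth_equalityI)
      fix p assume "p < length (vec (W i j))"
      then have p: "p < length ts" by simp
      have "vec (W i j) ! p = look (ts ! p) ts (u @ unit_vec i ks)"
        using p e(3) count[of "ts ! p"] u(1) k by (simp add: vec_def)
      also have "\<dots> = u ! p" using p u(2) look_nth[OF distinct_ts p] by (simp add: nth_append)
      finally show "vec (W i j) ! p = u ! p" .
    qed (simp add: u(2))
    then show ?thesis using u(3) k col_iff[OF sub ij(1), of i j] by simp
  qed
  have "feasible_partition B W"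
    unfolding feasible_partition_def
  proof (intro conjI)
    show "(\<Union>i\<in>{1..kinds B}. \<Union>j\<in>{1..bins B i}. W i j) = items B"
    proof (intro equalityI subsetI)
      fix u assume u: "u \<in> items B"
      obtain i j where "a u = (i, j)" by (cases "a u")
      then show "u \<in> (\<Union>i\<in>{1..kinds B}. \<Union>j\<in>{1..bins B i}. W i j)"
        using range[OF u] u by (auto simp: W_def)
    qed (auto simp: W_def)
    show "disjoint_family_on (\<lambda>(i, j). W i j) (SIGMA i:{1..kinds B}. {1..bins B i})"
      by (auto simp: disjoint_family_on_def W_def)
    show "\<forall>i\<in>{1..kinds B}. \<forall>j\<in>{1..bins B i}.
       (\<forall>c\<in>{1..ndims B}. (\<Sum>u\<in>W i j. item_size B u c) \<le> capacity B i c) \<and>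
       valid B i (image_mset (fingerprint B) (mset_set (W i j)))"
      using ok unfolding bin_ok_def by blast
  qed
  moreover have "enc_list (map eP ?out) = enc_output us a"
    unfolding out[symmetric] enc_output_def by (simp add: comp_def)
  ultimately show ?thesis unfolding W_def r(1) list.sel by blast
qed

lemma find_state_correct:
  assumes "sum_list (map hd ks) < 2 ^ l"
  shows "correct_output B us
    (find_state ts its (states cols target l 1 (2 * 1 * sum_list (map sum_list cols))))"
proof (cases rule: find_state_cases[of "states cols target l 1 (2 * 1 * sum_list (map sum_list cols))" ts its])
  case (1 s)
  then show ?thesis using states_sound[OF 1(1,2)] unfolding correct_output_def by auto
next
  case 2
  then have "\<nexists>W. feasible_partition B W"
    using states_complete_feasible[OF _ assms] by blast
  then show ?thesis using 2(2) unfolding correct_output_def by simp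
qed

end

section \<open>The parameter dependence\<close>

definition e_pow :: expr where
  "e_pow = Cond R1 (Call 1 (X1 \<bowtie> Call 2 (X1 \<bowtie> Sub R1 (Const 1)))) (Const 1)"

text \<open>Here \<open>k\<close> exceeds the number of item types, \<open>g\<close> the number of configurations, \<open>a * g\<close> the number
  of columns and \<open>a * g * a\<close> the sum of all their entries.\<close>

definition parameter_bound :: "nat \<Rightarrow> nat" where
  "parameter_bound K = (let a = K + 2; k = a ^ a; g = a ^ k in (a * (a * g * a)) ^ (k + a))"

definition e_bound :: expr where
  "e_bound = LetIn (Add X (Const 2)) (LetIn (Call 2 (X \<bowtie> X)) (LetIn (Call 2 (Var 1 \<bowtie> X))
      (LetIn (Call 2 (Call 1 (Var 2 \<bowtie> Call 1 (Call 1 (Var 2 \<bowtie> X) \<bowtie> Var 2)) \<bowtie> Add (Var 1) (Var 2)))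
        (Call 1 (Const 6000 \<bowtie> Call 2 (X \<bowtie> Const 5))))))"

definition bound_prog :: prog where
  "bound_prog = [e_bound, e_mul, e_pow]"

lemma bound_prog_simps:
  "length bound_prog = 3" "bound_prog ! 0 = e_bound" "bound_prog ! Suc 0 = e_mul"
  "bound_prog ! 2 = e_pow"
  by (simp_all add: bound_prog_def)

lemma calls_bound_mul: "calls bound_prog Q (Suc 0) (Num x \<parallel> Num y) (Num (x * y)) (20 * (y + 1))"
  by (rule calls_mul_generic) (simp_all add: bound_prog_simps)

text \<open>Computability asks for termination only, so the time remains existential.\<close>

lemma calls_pow: "\<exists>b. calls bound_prog Q 2 (Num x \<parallel> Num n) (Num (x ^ n)) b"
proof (induction n)
  case 0
  have "calls bound_prog Q 2 (Num x \<parallel> Num 0) (Num (x ^ 0)) 100"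
    by (simp add: calls_def bound_prog_simps e_pow_def)
  then show ?case ..
next
  case (Suc n)
  then obtain b where b: "calls bound_prog Q 2 (Num x \<parallel> Num n) (Num (x ^ n)) b" ..
  have "calls bound_prog Q 2 (Num x \<parallel> Num (Suc n)) (Num (x ^ Suc n)) (100 + b + 20 * (x ^ n + 1))"
    apply (simp add: calls_def bound_prog_simps e_pow_def)
    apply (rule wp_callI[OF b])
    apply (rule wp_callI[OF calls_bound_mul])
    apply simp
    done
  then show ?case ..
qed

lemma wp_pow: "(\<And>t. \<Phi> (Num (x ^ n)) t) \<Longrightarrow> wp_call bound_prog Q 2 (Num x \<parallel> Num n) \<Phi>"
  using calls_pow wp_callI by metis

lemma wp_mul: "(\<And>t. \<Phi> (Num (x * y)) t) \<Longrightarrow> wp_call bound_prog Q (Suc 0) (Num x \<parallel> Num y) \<Phi>"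
  using calls_bound_mul wp_callI by metis

text \<open>The factor 6000 is twice the 3000 of \<open>runs_packing_prog\<close>, because
  \<open>s + 1\<close> is estimated by twice the input size; the exponent is that of
  \<open>Z\<close>.\<close>

lemma computable_bound: "computable (\<lambda>K. 6000 * parameter_bound K ^ 5)"
proof -
  have "wp bound_prog {} [Num K] (bound_prog ! 0) (\<lambda>w t. w = Num (6000 * parameter_bound K ^ 5))" for K
    apply (simp add: bound_prog_simps e_bound_def Let_def parameter_bound_def)
    apply (rule wp_pow wp_mul | simp)+
    done
  then show ?thesis
    unfolding computable_def runs_def wp_def
    by (intro exI[of _ bound_prog]) (auto simp: bound_prog_def)
qed

text \<open>To be used with \<open>k\<close> item types, \<open>m\<close> kinds, at most
  \<open>G\<close> configurations per kind, \<open>N\<close> columns and the sum \<open>M\<close> of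
  their entries. The fourth conclusion, for the number of residuals with one row per type and kind,
  dictates the outer exponent.\<close>

lemma parameter_bound:
  assumes k: "k \<le> (K + 1) ^ (K + 1)" and m: "m \<le> K" and G: "G \<le> (K + 1) ^ k"
    and N: "N \<le> m * G" and M: "M \<le> N * (K + 1)"
  shows "K + 2 \<le> parameter_bound K" "k + m + 1 \<le> parameter_bound K"
    "N + 1 \<le> parameter_bound K" "(2 * M + 1) ^ (k + m) + 1 \<le> parameter_bound K"
    "G + 1 \<le> parameter_bound K"
proof -
  define a where "a = K + 2"
  define kk where "kk = a ^ a"
  define g where "g = a ^ kk"
  define x where "x = a * (a * g * a)"
  have z: "parameter_bound K = x ^ (kk + a)"
    by (simp add: parameter_bound_def a_def kk_def g_def x_def Let_def)
  have a2: "a \<ge> 2" by (simp add: a_def)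
  have "(K + 1) ^ (K + 1) \<le> a ^ (K + 1)" by (rule power_mono) (auto simp: a_def)
  also have "\<dots> < a ^ a" using a2 by (intro power_strict_increasing) (auto simp: a_def)
  finally have kk: "k + 1 \<le> kk" using k by (simp add: kk_def)
  have "(K + 1) ^ k \<le> a ^ k" by (rule power_mono) (auto simp: a_def)
  also have "\<dots> < a ^ kk" using a2 kk by (intro power_strict_increasing) auto
  finally have g: "G + 1 \<le> g" using G by (simp add: g_def)
  have "m * G + 1 \<le> a * (G + 1)" using mult_le_mono1[of m a G] m by (simp add: a_def)
  also have "\<dots> \<le> a * g" using g by (rule mult_le_mono2)
  finally have N1: "N + 1 \<le> a * g" using N by simp
  have "M + 1 \<le> (N + 1) * a" using M by (simp add: a_def algebra_simps)
  also have "\<dots> \<le> a * g * a" using N1 by (rule mult_le_mono1)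
  finally have "2 * (M + 1) \<le> x" unfolding x_def using a2 by (intro mult_le_mono)
  then have x: "2 * M + 1 \<le> x" "2 \<le> x" by auto
  have xz: "x \<le> parameter_bound K" unfolding z using x(2) kk by (intro self_le_power) auto
  have "1 \<le> a * g * a" using g a2 by (auto simp: Suc_le_eq)
  then have "a * 1 \<le> x" unfolding x_def by (rule mult_le_mono2)
  then show "K + 2 \<le> parameter_bound K" using xz by (simp add: a_def)
  have "a * g * 1 \<le> a * g * a" using a2 by (intro mult_le_mono2) simp
  also have "\<dots> \<le> x" unfolding x_def using a2 by simp
  finally have agx: "a * g \<le> x" by simp
  then show "N + 1 \<le> parameter_bound K" using N1 xz by simp
  have "g \<le> a * g" using a2 by simp
  then show "G + 1 \<le> parameter_bound K" using g agx xz by linarith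
  have e: "k + m + 1 \<le> kk + a" using kk m by (simp add: a_def)
  also have "\<dots> < 2 ^ (kk + a)" by (rule less_exp)
  also have "\<dots> \<le> x ^ (kk + a)" using x(2) by (rule power_mono) simp
  finally show "k + m + 1 \<le> parameter_bound K" by (simp add: z)
  have "(2 * M + 1) ^ (k + m) + 1 \<le> x ^ (k + m) + x ^ (k + m)"
    using power_mono[OF x(1), of "k + m"] x(2) by (intro add_mono) auto
  also have "\<dots> \<le> x ^ (k + m + 1)" using mult_le_mono1[OF x(2), of "x ^ (k + m)"] unfolding Suc_eq_plus1[symmetric] power_Suc by linarith
  also have "\<dots> \<le> x ^ (kk + a)" using e x(2) by (intro power_increasing) auto
  finally show "(2 * M + 1) ^ (k + m) + 1 \<le> parameter_bound K" by (simp add: z)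
qed

section \<open>Bounds in terms of the input size and the parameter\<close>

lemma val_size_le_enc_list: "v \<in> set vs \<Longrightarrow> val_size v \<le> val_size (enc_list vs)"
  by (induction vs) auto

lemma length_le_val_size: "length vs + 1 \<le> val_size (enc_list vs)"
  by (induction vs) auto

text \<open>A number is below 2 to its binary length, and \<open>A + B \<le> 2 * A * B\<close> for
  positive \<open>A\<close> and \<open>B\<close>, while lengths add up. Hence the number of bins
  requires no more levels than the size of the input.\<close>

lemma sum_hd_less_val_size:
  "[] \<notin> set xs \<Longrightarrow> sum_list (map hd xs) < 2 ^ val_size (eNN xs)"
proof (induction xs)
  case (Cons x xs)
  then obtain y z where x: "x = y # z" by (cases x) auto
  have y: "y < 2 ^ floorlog 2 y"
    using floorlog_bounds[of y 2] by (cases "y = 0") auto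
  define A B where "A = (2::nat) ^ floorlog 2 y" and "B = (2::nat) ^ val_size (eNN xs)"
  have "y < A" "sum_list (map hd xs) < B" "1 \<le> B" using y Cons by (auto simp: A_def B_def)
  then have "y + sum_list (map hd xs) < A + B" "A \<ge> 1" by auto
  moreover have "A + B \<le> 2 * A * B"
  proof -
    have "A * 1 \<le> A * B" "1 * B \<le> A * B" using \<open>A \<ge> 1\<close> \<open>1 \<le> B\<close> by (auto intro: mult_le_mono)
    then show ?thesis unfolding mult.assoc by linarith
  qed
  moreover have "2 * A * B \<le> 2 ^ val_size (eNN (x # xs))"
  proof -
    have "2 * A * B = 2 ^ (1 + floorlog 2 y + val_size (eNN xs))"
      by (simp add: A_def B_def power_add)
    also have "\<dots> \<le> 2 ^ val_size (eNN (x # xs))" by (intro power_increasing) (auto simp: x)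
    finally show ?thesis .
  qed
  ultimately show ?case by (simp add: x)
qed simp

context packing_input
begin

abbreviation "parameter \<equiv> card (fingerprints B) + dims + kinds B + norm1 dims (capacity B 1)"

lemma length_fs: "length fs = card (fingerprints B)"
  using fs distinct_card by metis

lemma norm_capacity_le: "i \<in> {1..kinds B} \<Longrightarrow> norm1 dims (capacity B i) \<le> norm1 dims (capacity B 1)"
proof (induction i)
  case (Suc i)
  show ?case
  proof (cases "i = 0")
    case False
    then have i: "i \<in> {1..<kinds B}" using Suc.prems by auto
    then have "norm1 dims (capacity B (Suc i)) \<le> norm1 dims (capacity B i)"
      using packing unfolding is_packing_def by blast
    then show ?thesis using Suc.IH i by auto
  qed simp
qed simp

text \<open>A type is a vector of \<open>dims + 1\<close> entries between 0 and
  \<open>parameter\<close>: a fingerprint position, and sizes bounded by the norm of the first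
  capacity.\<close>

lemma length_ts_le: "length ts \<le> (parameter + 1) ^ (parameter + 1)"
proof -
  let ?K = parameter
  let ?X = "{xs. set xs \<subseteq> {0..?K} \<and> length xs = Suc dims}"
  have "set ts \<subseteq> ?X"
  proof
    fix t assume "t \<in> set ts"
    then obtain u where u: "t = entry u" "u \<in> items B" using set_ts by blast
    have "x \<le> ?K" if "x \<in> set t" for x
    proof -
      have "x = hd t \<or> x \<in> set (tl t)" using that by (cases t) auto
      then show ?thesis
      proof
        assume "x = hd t"
        then show ?thesis using hd_entry[OF u(2)] u(1) length_fs by simp
      next
        assume "x \<in> set (tl t)"
        then have "x \<le> sum_list (tl t)" by (auto intro: member_le_sum_list)
        also have "\<dots> \<le> norm1 dims (capacity B 1)"
          using u packing by (simp add: sum_tl_entry is_packing_def)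
        finally show ?thesis by simp
      qed
    qed
    then show "t \<in> ?X" using u by auto
  qed
  then have "card (set ts) \<le> card ?X"
    by (rule card_mono[OF finite_lists_length_eq, rotated]) simp
  also have "\<dots> = (?K + 1) ^ Suc dims"
    using card_lists_length_eq[of "{0..?K}" "Suc dims"] by simp
  also have "\<dots> \<le> (?K + 1) ^ (?K + 1)" by (rule power_increasing) auto
  finally show ?thesis using distinct_card[OF distinct_ts] by simp
qed

lemma length_gen_le:
  assumes "k \<in> set ks"
  shows "length (gen (unit_vec i ks) ts 0 (length its # tl k)) \<le> (parameter + 1) ^ length ts"
proof -
  let ?H = "norm1 dims (capacity B 1)"
  obtain j where j: "k = kind j" "j \<in> {1..kinds B}" using assms by (auto simp: ks_def)
  have sum: "sum_list (tl k) \<le> ?H" using norm_capacity_le[OF j(2)] by (simp add: j sum_tl_kind)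
  have "length (gen (unit_vec i ks) ts 0 (length its # tl k)) \<le>
      (if ts = [] then 1 else (sum_list (tl (length its # tl k)) + 1) * (?H + 1) ^ (length ts - 1))"
    by (rule length_gen) (use entries_ok' sum j in auto)
  also have "\<dots> \<le> (?H + 1) ^ length ts" using sum by (cases ts) auto
  also have "\<dots> \<le> (parameter + 1) ^ length ts" by (rule power_mono) auto
  finally show ?thesis .
qed

lemma length_cols_le: "length cols \<le> kinds B * (parameter + 1) ^ length ts"
  using length_columns[of ks ks ts "length its" _ ok 1, OF length_gen_le] by (simp add: cols_def)

text \<open>The kind contributes at most \<open>kinds B\<close>, the multiplicities at most the norm
  of the capacity because sizes are nonzero, and the unit vector at most 1.\<close>

lemma sum_col_le:
  assumes "c \<in> set cols"
  shows "sum_list c \<le> parameter + 1"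
proof -
  obtain i u where c: "c = i # u @ unit_vec i ks" "i \<in> {1..kinds B}"
    "fit u ts (length its # tl (kind i))" using assms unfolding set_cols by blast
  have "sum_list u \<le> sum_list (tl (kind i))"
    by (rule fit_sum_le[OF c(3)]) (use entries_ok' in simp)
  also have "\<dots> \<le> norm1 dims (capacity B 1)"
    unfolding sum_tl_kind by (rule norm_capacity_le[OF c(2)])
  finally show ?thesis using c sum_unit_vec_le[of i ks] by simp
qed

lemma sum_cols_le: "sum_list (map sum_list cols) \<le> length cols * (parameter + 1)"
proof -
  have "\<forall>c \<in> set xs. sum_list c \<le> C \<Longrightarrow> sum_list (map sum_list xs) \<le> length xs * C"
    for xs :: "nat list list" and C
    by (induction xs) auto
  then show ?thesis using sum_col_le by blast
qed

lemma input_size_bounds: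
  "length its + 1 \<le> input_size B us fs" "sum_list (map hd ks) < 2 ^ input_size B us fs"
proof -
  have "val_size (eNN its) \<le> input_size B us fs" "val_size (eNN ks) \<le> input_size B us fs"
    unfolding input_size_def enc_input_eq by (intro val_size_le_enc_list; simp)+
  moreover have "length its + 1 \<le> val_size (eNN its)"
    using length_le_val_size[of "map (\<lambda>xs. eN xs) its"] by simp
  moreover have "sum_list (map hd ks) < 2 ^ val_size (eNN ks)"
    by (rule sum_hd_less_val_size) (use ks_ok in auto)
  ultimately show "length its + 1 \<le> input_size B us fs" "sum_list (map hd ks) < 2 ^ input_size B us fs"
    by (auto elim: order_trans less_le_trans intro: power_increasing)
qed

lemma packing_prog_correct:
  assumes T: "time_bound B \<tau> T"
  shows "\<exists>out t. runs packing_prog (validity_calls B fs \<tau>) (enc_input B us fs) out t \<and>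
    correct_output B us out \<and>
    t \<le> 6000 * parameter_bound parameter ^ 5 * (T (card (items B)) + input_size B us fs ^ 3)"
proof -
  let ?Z = "parameter_bound parameter" and ?S = "input_size B us fs" and ?T = "T (card (items B))"
  note Z = parameter_bound[OF length_ts_le, of "kinds B" "(parameter + 1) ^ length ts" "length cols"
      "sum_list (map sum_list cols)", OF _ order_refl length_cols_le sum_cols_le]
  have "\<exists>l t. sum_list (map hd ks) < 2 ^ l \<and>
    runs packing_prog (validity_calls B fs \<tau>)
      (enc_list [Num (length fs), Num dims, Num (length ks), eNN ks, eNN its])
      (find_state ts its (states cols target l 1 (2 * 1 * sum_list (map sum_list cols)))) t \<and>
    t \<le> 3000 * (?Z ^ 5 * (length its + 1) ^ 2 * (?S + 1)) + ?Z ^ 2 * ?T"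
  proof (rule runs_packing_prog[where ok = ok, OF entries_ok ks_ok, folded ts_def,
        folded cols_def target_def])
    show "length fs + dims + 2 \<le> ?Z" using Z(1) by (simp add: length_fs)
    show "length ts + length ks + 1 \<le> ?Z" using Z(2) by simp
    show "length cols + 1 \<le> ?Z" using Z(3) by simp
    show "(2 * sum_list (map sum_list cols) + 1) ^ (length ts + length ks) + 1 \<le> ?Z"
      using Z(4) by simp
    show "length (gen (unit_vec i ks) ts 0 (length its # tl k)) + 1 \<le> ?Z" if "k \<in> set ks" for i k
      using Z(5) length_gen_le[OF that, of i] by simp
    show "sum_list c + 1 \<le> ?Z" if "c \<in> set cols" for c
      using Z(1) sum_col_le[OF that] by simp
    show "sum_list (map hd ks) < 2 ^ ?S" by (rule input_size_bounds)
    show "oracle_ok (validity_calls B fs \<tau>) (length fs) ts ok ?T i (u @ unit_vec i ks)"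
      if "1 \<le> i" "i \<le> length ks" "length u = length ts" "sum_list u \<le> length its" for i u
      using oracle_answers[OF T] that by simp
  qed
  then obtain l t where l: "sum_list (map hd ks) < 2 ^ l"
    and run: "runs packing_prog (validity_calls B fs \<tau>) (enc_input B us fs)
      (find_state ts its (states cols target l 1 (2 * 1 * sum_list (map sum_list cols)))) t"
    and t: "t \<le> 3000 * (?Z ^ 5 * (length its + 1) ^ 2 * (?S + 1)) + ?Z ^ 2 * ?T"
    unfolding enc_input_eq by blast
  note t
  \<comment> \<open>The exponent 3 of the input size: it bounds \<open>length its + 1\<close>, which
    enters squared, and it is the number of levels allowed for.\<close>
  also have "3000 * (?Z ^ 5 * (length its + 1) ^ 2 * (?S + 1)) + ?Z ^ 2 * ?T \<le>
      3000 * (?Z ^ 5 * ?S ^ 2 * (2 * ?S)) + ?Z ^ 5 * ?T"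
    using input_size_bounds(1) Z(1)
    by (intro add_mono mult_le_mono power_mono power_increasing) auto
  also have "\<dots> \<le> 6000 * ?Z ^ 5 * (?T + ?S ^ 3)"
    by (simp add: algebra_simps power2_eq_square power3_eq_cube)
  finally show ?thesis using run find_state_correct[OF l] by blast
qed

end

theorem theorem4p19:
  shows "\<exists>(f :: nat \<Rightarrow> nat) (P :: prog) (e :: nat). computable f \<and>
    (\<forall>(B :: (nat, nat) packing) us fs \<tau> T.
       is_packing B \<and>
       distinct us \<and> set us = items B \<and> distinct fs \<and> set fs = fingerprints B \<and>
       time_bound B \<tau> T \<longrightarrow>
       (\<exists>out t. runs P (validity_calls B fs \<tau>) (enc_input B us fs) out t \<and>
          correct_output B us out \<and>
          t \<le> f (card (fingerprints B) + ndims B + kinds B + norm1 (ndims B) (capacity B 1)) *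
                (T (card (items B)) + input_size B us fs ^ e)))"
proof (rule exI[of _ "\<lambda>K. 6000 * parameter_bound K ^ 5"], rule exI[of _ packing_prog], rule exI[of _ 3],
    intro conjI computable_bound allI impI; elim conjE)
  fix B :: "(nat, nat) packing" and us fs \<tau> T
  assume "is_packing B" "distinct us" "set us = items B" "distinct fs" "set fs = fingerprints B"
    and T: "time_bound B \<tau> T"
  then interpret packing_input B us fs by unfold_locales
  show "\<exists>out t. runs packing_prog (validity_calls B fs \<tau>) (enc_input B us fs) out t \<and>
      correct_output B us out \<and>
      t \<le> 6000 * parameter_bound (card (fingerprints B) + ndims B + kinds B + norm1 (ndims B) (capacity B 1)) ^ 5 *
        (T (card (items B)) + input_size B us fs ^ 3)"
    by (rule packing_prog_correct[OF T])
qed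

end
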